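(* Let $\mathcal{A}$ be a locally noetherian Grothendieck category, and let $\overline{E}(\cdot)$ be the map sending an atom $\overline{H}$ in $\mathcal{A}$ to (the isomorphism class of) the injective hull $E(H)$ of $H$ (this is well defined on atoms). (1) The map $\overline{E}(\cdot)$ gives a one-to-one correspondence between atoms in $\mathcal{A}$ and isomorphism classes of indecomposable injective objects in $\mathcal{A}$. (2) The map $\overline{E}(\cdot)$ sends the atom support $\operatorname{ASupp} M$ of a noetherian object $M$ in $\mathcal{A}$ to $\mathcal{O}(M)=\{I\in\operatorname{Zg}\mathcal{A}\mid \operatorname{Hom}_{\mathcal{A}}(M,I)\neq 0\}$. (3) $\operatorname{ASpec}\mathcal{A}$ is homeomorphic to $\operatorname{Zg}\mathcal{A}$.
   Context: A Grothendieck category is locally noetherian if it has a set of generators consisting of noetherian objects. A nonzero object $H$ of $\mathcal{A}$ is a monoform object if for every nonzero subobject $N$ of $H$ there does not exist a nonzero subobject of $H$ which is isomorphic to a subobject of $H/N$. Monoform objects $H$ and $H'$ are atom-equivalent if there exists a common nonzero subobject of $H$ and $H'$ (a nonzero object isomorphic to a subobject of each); this is an equivalence relation. The atom spectrum $\operatorname{ASpec}\mathcal{A}$ is the collection of equivalence classes of monoform objects; the class of $H$ is denoted $\overline{H}$ and called the atom of $H$; an atom in $\mathcal{A}$ is an element of $\operatorname{ASpec}\mathcal{A}$. For an object $M$, the atom support $\operatorname{ASupp}M$ is the collection of atoms $\overline{H}$ such that some $H'\in\overline{H}$ is a subquotient of $M$ (a subobject of a quotient object of $M$). A subset $\Phi\subset\operatorname{ASpec}\mathcal{A}$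 is open if for any $\overline{H}\in\Phi$ there exists $H'\in\overline{H}$ such that $\operatorname{ASupp}H'\subset\Phi$. Monoform objects $H,H'$ in $\mathcal{A}$ are atom-equivalent if and only if $E(H)\cong E(H')$, so $\overline{E}(\overline{H})=E(H)$ is well defined. The Ziegler spectrum $\operatorname{Zg}\mathcal{A}$ is the collection of all isomorphism classes of indecomposable injective objects in $\mathcal{A}$, with the topology having as a basis of open sets the sets $\mathcal{O}(M)$, where $M$ runs over the noetherian objects in $\mathcal{A}$. *)

theory Defs
  imports "HOL-Analysis.Analysis" "HOL-Algebra.Group" "HOL-Library.Equipollence"
begin

section \<open>Preadditive categories and arrows\<close>

text \<open>
  Only the part of the data lying over \<open>Obj\<close> and \<open>Arr\<close> is meaningful. Composition is written
  in the order of function composition.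
\<close>

record ('o, 'm) category =
  Obj :: "'o set"
  Arr :: "'m set"
  Dom :: "'m \<Rightarrow> 'o"
  Cod :: "'m \<Rightarrow> 'o"
  Ident :: "'o \<Rightarrow> 'm"
  Comp :: "'m \<Rightarrow> 'm \<Rightarrow> 'm" (infixl \<open>\<cdot>\<index>\<close> 70)
  AddArr :: "'m \<Rightarrow> 'm \<Rightarrow> 'm"
  ZeroArr :: "'o \<Rightarrow> 'o \<Rightarrow> 'm"

definition Hom :: "('o, 'm) category \<Rightarrow> 'o \<Rightarrow> 'o \<Rightarrow> 'm set" where
  "Hom C X Y = {f \<in> Arr C. Dom C f = X \<and> Cod C f = Y}"

locale preadditive_category =
  fixes C :: "('o, 'm) category" (structure)
  assumes Dom_Obj: "f \<in> Arr C \<Longrightarrow> Dom C f \<in> Obj C"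
    and Cod_Obj: "f \<in> Arr C \<Longrightarrow> Cod C f \<in> Obj C"
    and Ident_Hom: "X \<in> Obj C \<Longrightarrow> Ident C X \<in> Hom C X X"
    and Comp_Hom: "f \<in> Hom C X Y \<Longrightarrow> g \<in> Hom C Y Z \<Longrightarrow> g \<cdot> f \<in> Hom C X Z"
    and Comp_Ident: "f \<in> Hom C X Y \<Longrightarrow> f \<cdot> Ident C X = f"
    and Ident_Comp: "f \<in> Hom C X Y \<Longrightarrow> Ident C Y \<cdot> f = f"
    and Comp_assoc: "f \<in> Hom C W X \<Longrightarrow> g \<in> Hom C X Y \<Longrightarrow> h \<in> Hom C Y Z \<Longrightarrow>
                      (h \<cdot> g) \<cdot> f = h \<cdot> (g \<cdot> f)"
    and Hom_comm_group: "X \<in> Obj C \<Longrightarrow> Y \<in> Obj C \<Longrightarrow>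
          comm_group \<lparr>carrier = Hom C X Y, monoid.mult = AddArr C, one = ZeroArr C X Y\<rparr>"
    and Comp_AddArr: "f \<in> Hom C X Y \<Longrightarrow> f' \<in> Hom C X Y \<Longrightarrow> g \<in> Hom C Y Z \<Longrightarrow>
                      g \<cdot> AddArr C f f' = AddArr C (g \<cdot> f) (g \<cdot> f')"
    and AddArr_Comp: "f \<in> Hom C X Y \<Longrightarrow> g \<in> Hom C Y Z \<Longrightarrow> g' \<in> Hom C Y Z \<Longrightarrow>
                      AddArr C g g' \<cdot> f = AddArr C (g \<cdot> f) (g' \<cdot> f)"

definition mono_arr :: "('o, 'm) category \<Rightarrow> 'm \<Rightarrow> bool" where
  "mono_arr C m \<longleftrightarrow> m \<in> Arr C \<and>
     (\<forall>X. \<forall>f \<in> Hom C X (Dom C m). \<forall>g \<in> Hom C X (Dom C m).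
        m \<cdot>\<^bsub>C\<^esub> f = m \<cdot>\<^bsub>C\<^esub> g \<longrightarrow> f = g)"

definition epi_arr :: "('o, 'm) category \<Rightarrow> 'm \<Rightarrow> bool" where
  "epi_arr C e \<longleftrightarrow> e \<in> Arr C \<and>
     (\<forall>Y. \<forall>f \<in> Hom C (Cod C e) Y. \<forall>g \<in> Hom C (Cod C e) Y.
        f \<cdot>\<^bsub>C\<^esub> e = g \<cdot>\<^bsub>C\<^esub> e \<longrightarrow> f = g)"

definition isomorphic :: "('o, 'm) category \<Rightarrow> 'o \<Rightarrow> 'o \<Rightarrow> bool" where
  "isomorphic C X Y \<longleftrightarrow> X \<in> Obj C \<and> Y \<in> Obj C \<and>
     (\<exists>f \<in> Hom C X Y. \<exists>g \<in> Hom C Y X. g \<cdot>\<^bsub>C\<^esub> f = Ident C X \<and> f \<cdot>\<^bsub>C\<^esub> g = Ident C Y)"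

definition zero_obj :: "('o, 'm) category \<Rightarrow> 'o \<Rightarrow> bool" where
  "zero_obj C Z \<longleftrightarrow> Z \<in> Obj C \<and>
     (\<forall>X \<in> Obj C. (\<exists>!f. f \<in> Hom C X Z) \<and> (\<exists>!f. f \<in> Hom C Z X))"

definition nonzero_obj :: "('o, 'm) category \<Rightarrow> 'o \<Rightarrow> bool" where
  "nonzero_obj C X \<longleftrightarrow> X \<in> Obj C \<and> \<not> zero_obj C X"

definition is_kernel :: "('o, 'm) category \<Rightarrow> 'm \<Rightarrow> 'm \<Rightarrow> bool" where
  "is_kernel C f k \<longleftrightarrow> f \<in> Arr C \<and> k \<in> Arr C \<and> Cod C k = Dom C f \<and>
     f \<cdot>\<^bsub>C\<^esub> k = ZeroArr C (Dom C k) (Cod C f) \<and>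
     (\<forall>X. \<forall>h \<in> Hom C X (Dom C f). f \<cdot>\<^bsub>C\<^esub> h = ZeroArr C X (Cod C f) \<longrightarrow>
        (\<exists>!u. u \<in> Hom C X (Dom C k) \<and> k \<cdot>\<^bsub>C\<^esub> u = h))"

definition is_cokernel :: "('o, 'm) category \<Rightarrow> 'm \<Rightarrow> 'm \<Rightarrow> bool" where
  "is_cokernel C f q \<longleftrightarrow> f \<in> Arr C \<and> q \<in> Arr C \<and> Dom C q = Cod C f \<and>
     q \<cdot>\<^bsub>C\<^esub> f = ZeroArr C (Dom C f) (Cod C q) \<and>
     (\<forall>Y. \<forall>h \<in> Hom C (Cod C f) Y. h \<cdot>\<^bsub>C\<^esub> f = ZeroArr C (Dom C f) Y \<longrightarrow>
        (\<exists>!u. u \<in> Hom C (Cod C q) Y \<and> u \<cdot>\<^bsub>C\<^esub> q = h))"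

text \<open>Exactness of \<open>0 \<rightarrow> X \<rightarrow> Y \<rightarrow> Z \<rightarrow> 0\<close> in an abelian category.\<close>

definition short_exact :: "('o, 'm) category \<Rightarrow> 'm \<Rightarrow> 'm \<Rightarrow> bool" where
  "short_exact C f g \<longleftrightarrow> is_kernel C g f \<and> is_cokernel C f g"

definition is_biproduct ::
  "('o, 'm) category \<Rightarrow> 'o \<Rightarrow> 'o \<Rightarrow> 'o \<Rightarrow> 'm \<Rightarrow> 'm \<Rightarrow> 'm \<Rightarrow> 'm \<Rightarrow> bool" where
  "is_biproduct C X Y S i j p q \<longleftrightarrow> S \<in> Obj C \<and>
     i \<in> Hom C X S \<and> j \<in> Hom C Y S \<and> p \<in> Hom C S X \<and> q \<in> Hom C S Y \<and>
     p \<cdot>\<^bsub>C\<^esub> i = Ident C X \<and> q \<cdot>\<^bsub>C\<^esub> j = Ident C Y \<and>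
     p \<cdot>\<^bsub>C\<^esub> j = ZeroArr C Y X \<and> q \<cdot>\<^bsub>C\<^esub> i = ZeroArr C X Y \<and>
     AddArr C (i \<cdot>\<^bsub>C\<^esub> p) (j \<cdot>\<^bsub>C\<^esub> q) = Ident C S"

locale abelian_category = preadditive_category +
  assumes ex_zero_obj: "\<exists>Z. zero_obj C Z"
    and ex_biproduct: "X \<in> Obj C \<Longrightarrow> Y \<in> Obj C \<Longrightarrow> \<exists>S i j p q. is_biproduct C X Y S i j p q"
    and ex_kernel: "f \<in> Arr C \<Longrightarrow> \<exists>k. is_kernel C f k"
    and ex_cokernel: "f \<in> Arr C \<Longrightarrow> \<exists>q. is_cokernel C f q"
    and mono_normal: "mono_arr C m \<Longrightarrow> \<exists>f. is_kernel C f m"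
    and epi_normal: "epi_arr C e \<Longrightarrow> \<exists>f. is_cokernel C f e"


section \<open>Grothendieck categories\<close>

text \<open>
  Smallness is measured by a set \<open>U\<close> of inaccessible cardinality, which plays the role of a
  Grothendieck universe: a set \<open>A\<close> (of any type) is small iff \<open>A \<prec> U\<close>. Homs are small, and
  coproducts, direct limits and generating sets are indexed by small sets, whereas the
  collection of all objects is unrestricted. Index sets are taken in the type of \<open>U\<close>, since
  every small set is equipollent to a subset of \<open>U\<close>.
\<close>

definition universe :: "'u set \<Rightarrow> bool" where
  "universe U \<longleftrightarrow>
     (UNIV :: nat set) \<prec> U \<and>
     (\<forall>A :: 'u set. A \<prec> U \<longrightarrow> Pow A \<prec> U) \<and>
     (\<forall>(I :: 'u set) (A :: 'u \<Rightarrow> 'u set).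
        I \<prec> U \<longrightarrow> (\<forall>i \<in> I. A i \<prec> U) \<longrightarrow> (\<Union>i \<in> I. A i) \<prec> U)"

definition is_coproduct ::
  "('o, 'm) category \<Rightarrow> 'i set \<Rightarrow> ('i \<Rightarrow> 'o) \<Rightarrow> 'o \<Rightarrow> ('i \<Rightarrow> 'm) \<Rightarrow> bool" where
  "is_coproduct C I X S c \<longleftrightarrow> S \<in> Obj C \<and> (\<forall>i \<in> I. c i \<in> Hom C (X i) S) \<and>
     (\<forall>Y \<in> Obj C. \<forall>g. (\<forall>i \<in> I. g i \<in> Hom C (X i) Y) \<longrightarrow>
        (\<exists>!u. u \<in> Hom C S Y \<and> (\<forall>i \<in> I. u \<cdot>\<^bsub>C\<^esub> c i = g i)))"

definition directed_set :: "'i set \<Rightarrow> ('i \<times> 'i) set \<Rightarrow> bool" where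
  "directed_set I r \<longleftrightarrow> I \<noteq> {} \<and> preorder_on I r \<and>
     (\<forall>i \<in> I. \<forall>j \<in> I. \<exists>k \<in> I. (i, k) \<in> r \<and> (j, k) \<in> r)"

text \<open>Here \<open>t i j : X i \<rightarrow> X j\<close> is the transition arrow for \<open>(i, j) \<in> r\<close>.\<close>

definition direct_system ::
  "('o, 'm) category \<Rightarrow> 'i set \<Rightarrow> ('i \<times> 'i) set \<Rightarrow> ('i \<Rightarrow> 'o) \<Rightarrow> ('i \<Rightarrow> 'i \<Rightarrow> 'm) \<Rightarrow> bool" where
  "direct_system C I r X t \<longleftrightarrow> directed_set I r \<and>
     (\<forall>i \<in> I. X i \<in> Obj C \<and> t i i = Ident C (X i)) \<and>
     (\<forall>i j. (i, j) \<in> r \<longrightarrow> t i j \<in> Hom C (X i) (X j)) \<and>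
     (\<forall>i j k. (i, j) \<in> r \<longrightarrow> (j, k) \<in> r \<longrightarrow> t j k \<cdot>\<^bsub>C\<^esub> t i j = t i k)"

definition is_cocone ::
  "('o, 'm) category \<Rightarrow> 'i set \<Rightarrow> ('i \<times> 'i) set \<Rightarrow> ('i \<Rightarrow> 'o) \<Rightarrow> ('i \<Rightarrow> 'i \<Rightarrow> 'm) \<Rightarrow>
   'o \<Rightarrow> ('i \<Rightarrow> 'm) \<Rightarrow> bool" where
  "is_cocone C I r X t L l \<longleftrightarrow> L \<in> Obj C \<and> (\<forall>i \<in> I. l i \<in> Hom C (X i) L) \<and>
     (\<forall>i j. (i, j) \<in> r \<longrightarrow> l j \<cdot>\<^bsub>C\<^esub> t i j = l i)"

definition is_direct_limit ::
  "('o, 'm) category \<Rightarrow> 'i set \<Rightarrow> ('i \<times> 'i) set \<Rightarrow> ('i \<Rightarrow> 'o) \<Rightarrow> ('i \<Rightarrow> 'i \<Rightarrow> 'm) \<Rightarrow>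
   'o \<Rightarrow> ('i \<Rightarrow> 'm) \<Rightarrow> bool" where
  "is_direct_limit C I r X t L l \<longleftrightarrow> is_cocone C I r X t L l \<and>
     (\<forall>Y g. is_cocone C I r X t Y g \<longrightarrow>
        (\<exists>!u. u \<in> Hom C L Y \<and> (\<forall>i \<in> I. u \<cdot>\<^bsub>C\<^esub> l i = g i)))"

definition system_morphism ::
  "('o, 'm) category \<Rightarrow> 'i set \<Rightarrow> ('i \<times> 'i) set \<Rightarrow> ('i \<Rightarrow> 'o) \<Rightarrow> ('i \<Rightarrow> 'i \<Rightarrow> 'm) \<Rightarrow>
   ('i \<Rightarrow> 'o) \<Rightarrow> ('i \<Rightarrow> 'i \<Rightarrow> 'm) \<Rightarrow> ('i \<Rightarrow> 'm) \<Rightarrow> bool" where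
  "system_morphism C I r X s Y t f \<longleftrightarrow> (\<forall>i \<in> I. f i \<in> Hom C (X i) (Y i)) \<and>
     (\<forall>i j. (i, j) \<in> r \<longrightarrow> f j \<cdot>\<^bsub>C\<^esub> s i j = t i j \<cdot>\<^bsub>C\<^esub> f i)"

definition generating_set :: "('o, 'm) category \<Rightarrow> 'o set \<Rightarrow> bool" where
  "generating_set C \<G> \<longleftrightarrow> \<G> \<subseteq> Obj C \<and>
     (\<forall>X Y. \<forall>f \<in> Hom C X Y. \<forall>g \<in> Hom C X Y. f \<noteq> g \<longrightarrow>
        (\<exists>G \<in> \<G>. \<exists>h \<in> Hom C G X. f \<cdot>\<^bsub>C\<^esub> h \<noteq> g \<cdot>\<^bsub>C\<^esub> h))"

text \<open>
  In \<open>direct_limit_exact\<close>, \<open>a\<close> and \<open>b\<close> are the arrows induced on direct limits by a short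
  exact sequence \<open>(f, g)\<close> of direct systems. Existence of direct limits is not assumed
  separately: they are cokernels of arrows between small coproducts.
\<close>

locale grothendieck_category = abelian_category C
  for C :: "('o, 'm) category" (structure) +
  fixes U :: "'u set"
  assumes universe: "universe U"
    and small_Hom: "A \<in> Obj C \<Longrightarrow> B \<in> Obj C \<Longrightarrow> Hom C A B \<prec> U"
    and ex_coproduct: "(I :: 'u set) \<prec> U \<Longrightarrow> (\<And>i. i \<in> I \<Longrightarrow> X i \<in> Obj C) \<Longrightarrow>
                        \<exists>S c. is_coproduct C I X S c"
    and direct_limit_exact:
      "\<lbrakk>(I :: 'u set) \<prec> U;
        direct_system C I r X s; direct_system C I r Y t; direct_system C I r Z w;
        system_morphism C I r X s Y t f; system_morphism C I r Y t Z w g;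
        \<And>i. i \<in> I \<Longrightarrow> short_exact C (f i) (g i);
        is_direct_limit C I r X s L l; is_direct_limit C I r Y t M m;
        is_direct_limit C I r Z w N n;
        a \<in> Hom C L M; \<And>i. i \<in> I \<Longrightarrow> a \<cdot> l i = m i \<cdot> f i;
        b \<in> Hom C M N; \<And>i. i \<in> I \<Longrightarrow> b \<cdot> m i = n i \<cdot> g i\<rbrakk>
       \<Longrightarrow> short_exact C a b"
    and ex_generator: "\<exists>G. generating_set C {G}"


section \<open>Subobjects and noetherian objects\<close>

text \<open>
  Subobjects of \<open>X\<close> are represented by monomorphisms with codomain \<open>X\<close>; \<open>sub_le\<close> is the
  inclusion of subobjects, and \<open>embeds C X Y\<close> says that \<open>X\<close> is isomorphic to a subobject of \<open>Y\<close>.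
\<close>

definition sub_le :: "('o, 'm) category \<Rightarrow> 'm \<Rightarrow> 'm \<Rightarrow> bool" where
  "sub_le C m n \<longleftrightarrow> (\<exists>u \<in> Hom C (Dom C m) (Dom C n). n \<cdot>\<^bsub>C\<^esub> u = m)"

definition embeds :: "('o, 'm) category \<Rightarrow> 'o \<Rightarrow> 'o \<Rightarrow> bool" where
  "embeds C X Y \<longleftrightarrow> (\<exists>m \<in> Hom C X Y. mono_arr C m)"

definition noetherian_obj :: "('o, 'm) category \<Rightarrow> 'o \<Rightarrow> bool" where
  "noetherian_obj C X \<longleftrightarrow> X \<in> Obj C \<and>
     (\<forall>m :: nat \<Rightarrow> 'm.
        (\<forall>n. mono_arr C (m n) \<and> Cod C (m n) = X \<and> sub_le C (m n) (m (Suc n))) \<longrightarrow>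
        (\<exists>N. \<forall>n \<ge> N. sub_le C (m (Suc n)) (m n)))"

locale locally_noetherian_grothendieck_category = grothendieck_category C U
  for C :: "('o, 'm) category" (structure) and U :: "'u set" +
  assumes ex_noetherian_generators:
    "\<exists>\<G>. \<G> \<prec> U \<and> generating_set C \<G> \<and> (\<forall>G \<in> \<G>. noetherian_obj C G)"


section \<open>The atom spectrum\<close>

text \<open>Below, \<open>m : N \<rightarrow> H\<close> is a nonzero subobject and \<open>Cod C q\<close> is the quotient \<open>H / N\<close>.\<close>

definition monoform :: "('o, 'm) category \<Rightarrow> 'o \<Rightarrow> bool" where
  "monoform C H \<longleftrightarrow> nonzero_obj C H \<and>
     (\<forall>m q. mono_arr C m \<and> Cod C m = H \<and> nonzero_obj C (Dom C m) \<and> is_cokernel C m q \<longrightarrow>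
        \<not> (\<exists>L. nonzero_obj C L \<and> embeds C L H \<and> embeds C L (Cod C q)))"

definition atom_rel :: "('o, 'm) category \<Rightarrow> ('o \<times> 'o) set" where
  "atom_rel C = {(H, H'). monoform C H \<and> monoform C H' \<and>
     (\<exists>L. nonzero_obj C L \<and> embeds C L H \<and> embeds C L H')}"

definition ASpec :: "('o, 'm) category \<Rightarrow> 'o set set" where
  "ASpec C = {H. monoform C H} // atom_rel C"

definition atom :: "('o, 'm) category \<Rightarrow> 'o \<Rightarrow> 'o set" where
  "atom C H = atom_rel C `` {H}"

definition subquotient :: "('o, 'm) category \<Rightarrow> 'o \<Rightarrow> 'o \<Rightarrow> bool" where
  "subquotient C X M \<longleftrightarrow> (\<exists>Q. (\<exists>e \<in> Hom C M Q. epi_arr C e) \<and> embeds C X Q)"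

definition ASupp :: "('o, 'm) category \<Rightarrow> 'o \<Rightarrow> 'o set set" where
  "ASupp C M = {\<alpha> \<in> ASpec C. \<exists>H \<in> \<alpha>. subquotient C H M}"

definition atom_topology :: "('o, 'm) category \<Rightarrow> 'o set topology" where
  "atom_topology C = topology (\<lambda>\<Phi>. \<Phi> \<subseteq> ASpec C \<and> (\<forall>\<alpha> \<in> \<Phi>. \<exists>H \<in> \<alpha>. ASupp C H \<subseteq> \<Phi>))"


section \<open>Injective hulls and the Ziegler spectrum\<close>

definition injective_obj :: "('o, 'm) category \<Rightarrow> 'o \<Rightarrow> bool" where
  "injective_obj C I \<longleftrightarrow> I \<in> Obj C \<and>
     (\<forall>m f. mono_arr C m \<and> f \<in> Hom C (Dom C m) I \<longrightarrow>
        (\<exists>g \<in> Hom C (Cod C m) I. g \<cdot>\<^bsub>C\<^esub> m = f))"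

definition indecomposable_obj :: "('o, 'm) category \<Rightarrow> 'o \<Rightarrow> bool" where
  "indecomposable_obj C X \<longleftrightarrow> nonzero_obj C X \<and>
     (\<forall>Y \<in> Obj C. \<forall>Z \<in> Obj C. \<forall>i j p q. is_biproduct C Y Z X i j p q \<longrightarrow>
        zero_obj C Y \<or> zero_obj C Z)"

text \<open>Every nonzero subobject \<open>m\<close> has nonzero intersection with the subobject \<open>e\<close>.\<close>

definition essential_mono :: "('o, 'm) category \<Rightarrow> 'm \<Rightarrow> bool" where
  "essential_mono C e \<longleftrightarrow> mono_arr C e \<and>
     (\<forall>m. mono_arr C m \<and> Cod C m = Cod C e \<and> nonzero_obj C (Dom C m) \<longrightarrow>
        (\<exists>k. mono_arr C k \<and> Cod C k = Cod C e \<and> nonzero_obj C (Dom C k) \<and>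
             sub_le C k m \<and> sub_le C k e))"

definition is_injective_hull :: "('o, 'm) category \<Rightarrow> 'o \<Rightarrow> 'o \<Rightarrow> bool" where
  "is_injective_hull C X E \<longleftrightarrow>
     injective_obj C E \<and> (\<exists>e \<in> Hom C X E. essential_mono C e)"

definition injective_hull :: "('o, 'm) category \<Rightarrow> 'o \<Rightarrow> 'o" where
  "injective_hull C X = (SOME E. is_injective_hull C X E)"

definition iso_rel :: "('o, 'm) category \<Rightarrow> ('o \<times> 'o) set" where
  "iso_rel C = {(X, Y). isomorphic C X Y}"

definition iso_class :: "('o, 'm) category \<Rightarrow> 'o \<Rightarrow> 'o set" where
  "iso_class C X = iso_rel C `` {X}"

definition Zg :: "('o, 'm) category \<Rightarrow> 'o set set" where
  "Zg C = {I. indecomposable_obj C I \<and> injective_obj C I} // iso_rel C"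

definition Zg_open :: "('o, 'm) category \<Rightarrow> 'o \<Rightarrow> 'o set set" where
  "Zg_open C M = {c \<in> Zg C. \<exists>I \<in> c. Hom C M I \<noteq> {ZeroArr C M I}}"

definition Zg_topology :: "('o, 'm) category \<Rightarrow> 'o set topology" where
  "Zg_topology C =
     topology (arbitrary union_of (\<lambda>W. \<exists>M. noetherian_obj C M \<and> W = Zg_open C M))"

definition Ebar :: "('o, 'm) category \<Rightarrow> 'o set \<Rightarrow> 'o set" where
  "Ebar C \<alpha> = iso_class C (injective_hull C (SOME H. H \<in> \<alpha>))"

end

theory Submission
  imports Defs
begin

text \<open>
  The main point is the existence of injective hulls. By Zorn's lemma, every object \<open>X\<close> has an
  essential extension to which all arrows \<open>K \<rightarrow> X\<close> from subobjects \<open>K\<close> of the noetherian generators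
  extend. The union of a countable chain of such extensions is injective by Baer's criterion,
  because an arrow from a noetherian object to the union factors through one of the steps.

  A monoform object \<open>H\<close> is uniform, so \<open>E(H)\<close> is indecomposable, and two monoform objects have
  isomorphic hulls iff they share a nonzero subobject. Conversely, every nonzero object contains a
  noetherian monoform object, whose hull is all of a given indecomposable injective object. The image
  of a nonzero arrow \<open>M \<rightarrow> E(H)\<close> meets \<open>H\<close>, which puts the atom of \<open>H\<close> in the support of \<open>M\<close>. Finally,
  the supports of the noetherian objects form a basis of the topology of the atom spectrum.
\<close>

text \<open>Size shapes the proof. Limits exist only over index sets in the type of \<open>U\<close>
  that are smaller than \<open>U\<close>, and no bound on the essential extensions of an object is
  known in advance. So a subobject is recorded by its elements, the arrows from generators that
  factor through it: they form a small set and determine the subobject. The construction of an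
  extension avoids transfinite recursion. A chain of extensions is a set of labelled arrows whose
  labels name extension problems, of which a small set suffices; unions of such sets need no direct
  limit, and only the maximal one is completed by its limit.

  One pass solves the problems with values in \<open>X\<close> but creates new ones, with values in
  the extension, so the pass is iterated. Subobjects of noetherian generators are noetherian, hence
  countably many passes are enough.

  Hulls come before atoms: transitivity of atom equivalence is read off from isomorphism of hulls.
  Likewise the sets \<open>Zg_open C M\<close> are not intersected directly; their topology is the
  image of the topology on atoms under the injective map \<open>Ebar\<close>.\<close>

lemma Hom_iff [simp]: "f \<in> Hom C X Y \<longleftrightarrow> f \<in> Arr C \<and> Dom C f = X \<and> Cod C f = Y"
  by (simp add: Hom_def)

section \<open>Arithmetic of arrows\<close>

context preadditive_category
begin

definition neg_arr :: "'m \<Rightarrow> 'm" where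
  "neg_arr f = m_inv \<lparr>carrier = Hom C (Dom C f) (Cod C f), monoid.mult = AddArr C,
     one = ZeroArr C (Dom C f) (Cod C f)\<rparr> f"

definition sub_arr :: "'m \<Rightarrow> 'm \<Rightarrow> 'm" where
  "sub_arr f g = AddArr C f (neg_arr g)"

text \<open>A predicate on single arrows, so that vanishing can be stated and transported without
  naming source and target. It includes membership in \<open>Arr C\<close>.\<close>

definition zero_arr :: "'m \<Rightarrow> bool" where
  "zero_arr f \<longleftrightarrow> f \<in> Arr C \<and> f = ZeroArr C (Dom C f) (Cod C f)"

declare Dom_Obj [simp] Cod_Obj [simp]

lemma arr_Ident [simp]:
  assumes "X \<in> Obj C"
  shows "Ident C X \<in> Arr C" "Dom C (Ident C X) = X" "Cod C (Ident C X) = X"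
  using Ident_Hom[OF assms] by auto

lemma arr_Comp [simp]:
  assumes "f \<in> Arr C" "g \<in> Arr C" "Dom C g = Cod C f"
  shows "g \<cdot> f \<in> Arr C" "Dom C (g \<cdot> f) = Dom C f" "Cod C (g \<cdot> f) = Cod C g"
  using Comp_Hom[of f "Dom C f" "Cod C f" g "Cod C g"] assms by auto

lemma Comp_Ident_arr [simp]: "f \<in> Arr C \<Longrightarrow> Dom C f = X \<Longrightarrow> f \<cdot> Ident C X = f"
  using Comp_Ident[of f X "Cod C f"] by simp

lemma Ident_Comp_arr [simp]: "f \<in> Arr C \<Longrightarrow> Cod C f = X \<Longrightarrow> Ident C X \<cdot> f = f"
  using Ident_Comp[of f "Dom C f" X] by simp

lemma assoc:
  "f \<in> Arr C \<Longrightarrow> g \<in> Arr C \<Longrightarrow> h \<in> Arr C \<Longrightarrow> Dom C g = Cod C f \<Longrightarrow> Dom C h = Cod C g \<Longrightarrow>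
   (h \<cdot> g) \<cdot> f = h \<cdot> (g \<cdot> f)"
  using Comp_assoc[of f "Dom C f" "Cod C f" g "Cod C g" h "Cod C h"] by simp

text \<open>Normalising with \<open>assoc\<close> hides a product \<open>h \<cdot> g\<close> of
  known value inside \<open>h \<cdot> (g \<cdot> f)\<close>; this rule recovers it.\<close>

lemma reassoc:
  assumes "h \<cdot> g = k" "f \<in> Arr C" "g \<in> Arr C" "h \<in> Arr C" "Dom C g = Cod C f" "Dom C h = Cod C g"
  shows "h \<cdot> (g \<cdot> f) = k \<cdot> f"
  using assoc[of f g h] assms by simp

lemma arr_Zero [simp]:
  assumes "X \<in> Obj C" "Y \<in> Obj C"
  shows "ZeroArr C X Y \<in> Arr C" "Dom C (ZeroArr C X Y) = X" "Cod C (ZeroArr C X Y) = Y"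
proof -
  interpret comm_group "\<lparr>carrier = Hom C X Y, monoid.mult = AddArr C, one = ZeroArr C X Y\<rparr>"
    by (rule Hom_comm_group[OF assms])
  show "ZeroArr C X Y \<in> Arr C" "Dom C (ZeroArr C X Y) = X" "Cod C (ZeroArr C X Y) = Y"
    using one_closed by auto
qed

lemma arr_Add [simp]:
  assumes "f \<in> Arr C" "g \<in> Arr C" "Dom C g = Dom C f" "Cod C g = Cod C f"
  shows "AddArr C f g \<in> Arr C" "Dom C (AddArr C f g) = Dom C f" "Cod C (AddArr C f g) = Cod C f"
proof -
  interpret comm_group "\<lparr>carrier = Hom C (Dom C f) (Cod C f), monoid.mult = AddArr C,
     one = ZeroArr C (Dom C f) (Cod C f)\<rparr>"
    by (rule Hom_comm_group) (use assms in auto)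
  show "AddArr C f g \<in> Arr C" "Dom C (AddArr C f g) = Dom C f" "Cod C (AddArr C f g) = Cod C f"
    using m_closed[of f g] assms by auto
qed

lemma arr_neg [simp]:
  assumes "f \<in> Arr C"
  shows "neg_arr f \<in> Arr C" "Dom C (neg_arr f) = Dom C f" "Cod C (neg_arr f) = Cod C f"
proof -
  interpret comm_group "\<lparr>carrier = Hom C (Dom C f) (Cod C f), monoid.mult = AddArr C,
     one = ZeroArr C (Dom C f) (Cod C f)\<rparr>"
    by (rule Hom_comm_group) (use assms in auto)
  show "neg_arr f \<in> Arr C" "Dom C (neg_arr f) = Dom C f" "Cod C (neg_arr f) = Cod C f"
    using inv_closed[of f] assms by (auto simp: neg_arr_def)
qed

lemma add_assoc:
  assumes "f \<in> Arr C" "g \<in> Arr C" "h \<in> Arr C" "Dom C g = Dom C f" "Cod C g = Cod C f"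
    "Dom C h = Dom C f" "Cod C h = Cod C f"
  shows "AddArr C (AddArr C f g) h = AddArr C f (AddArr C g h)"
proof -
  interpret comm_group "\<lparr>carrier = Hom C (Dom C f) (Cod C f), monoid.mult = AddArr C,
     one = ZeroArr C (Dom C f) (Cod C f)\<rparr>"
    by (rule Hom_comm_group) (use assms in auto)
  show ?thesis using m_assoc[of f g h] assms by auto
qed

lemma add_comm:
  assumes "f \<in> Arr C" "g \<in> Arr C" "Dom C g = Dom C f" "Cod C g = Cod C f"
  shows "AddArr C f g = AddArr C g f"
proof -
  interpret comm_group "\<lparr>carrier = Hom C (Dom C f) (Cod C f), monoid.mult = AddArr C,
     one = ZeroArr C (Dom C f) (Cod C f)\<rparr>"
    by (rule Hom_comm_group) (use assms in auto)
  show ?thesis using m_comm[of f g] assms by auto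
qed

lemma add_zero [simp]:
  assumes "f \<in> Arr C" "X = Dom C f" "Y = Cod C f"
  shows "AddArr C f (ZeroArr C X Y) = f" "AddArr C (ZeroArr C X Y) f = f"
proof -
  interpret comm_group "\<lparr>carrier = Hom C (Dom C f) (Cod C f), monoid.mult = AddArr C,
     one = ZeroArr C (Dom C f) (Cod C f)\<rparr>"
    by (rule Hom_comm_group) (use assms in auto)
  show "AddArr C f (ZeroArr C X Y) = f" "AddArr C (ZeroArr C X Y) f = f"
    using r_one[of f] l_one[of f] assms by auto
qed

lemma add_neg:
  assumes "f \<in> Arr C"
  shows "AddArr C f (neg_arr f) = ZeroArr C (Dom C f) (Cod C f)"
proof -
  interpret comm_group "\<lparr>carrier = Hom C (Dom C f) (Cod C f), monoid.mult = AddArr C,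
     one = ZeroArr C (Dom C f) (Cod C f)\<rparr>"
    by (rule Hom_comm_group) (use assms in auto)
  show ?thesis using r_inv[of f] assms by (auto simp: neg_arr_def)
qed

lemma add_cancel:
  assumes "f \<in> Arr C" "g \<in> Arr C" "h \<in> Arr C" "Dom C g = Dom C f" "Cod C g = Cod C f"
    "Dom C h = Dom C f" "Cod C h = Cod C f" "AddArr C f g = AddArr C f h"
  shows "g = h"
proof -
  interpret comm_group "\<lparr>carrier = Hom C (Dom C f) (Cod C f), monoid.mult = AddArr C,
     one = ZeroArr C (Dom C f) (Cod C f)\<rparr>"
    by (rule Hom_comm_group) (use assms in auto)
  show ?thesis using Units_l_cancel[of f g h] Units_eq assms by auto
qed

lemma comp_add:
  "f \<in> Arr C \<Longrightarrow> f' \<in> Arr C \<Longrightarrow> g \<in> Arr C \<Longrightarrow> Dom C f' = Dom C f \<Longrightarrow> Cod C f' = Cod C f \<Longrightarrow>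
   Dom C g = Cod C f \<Longrightarrow> g \<cdot> AddArr C f f' = AddArr C (g \<cdot> f) (g \<cdot> f')"
  using Comp_AddArr[of f "Dom C f" "Cod C f" f' g "Cod C g"] by simp

lemma add_comp:
  "f \<in> Arr C \<Longrightarrow> g' \<in> Arr C \<Longrightarrow> g \<in> Arr C \<Longrightarrow> Dom C g' = Dom C g \<Longrightarrow> Cod C g' = Cod C g \<Longrightarrow>
   Dom C g = Cod C f \<Longrightarrow> AddArr C g g' \<cdot> f = AddArr C (g \<cdot> f) (g' \<cdot> f)"
  using AddArr_Comp[of f "Dom C f" "Cod C f" g "Cod C g" g'] by simp

text \<open>Since \<open>0 + 0 = 0\<close>, the composite equals its own double, and cancellation
  makes it zero.\<close>

lemma comp_zero [simp]:
  assumes "g \<in> Arr C" "X \<in> Obj C" "Y = Dom C g"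
  shows "g \<cdot> ZeroArr C X Y = ZeroArr C X (Cod C g)"
proof -
  let ?z = "ZeroArr C X Y"
  have "g \<cdot> AddArr C ?z ?z = AddArr C (g \<cdot> ?z) (g \<cdot> ?z)"
    by (rule comp_add) (use assms in auto)
  then show ?thesis
    using assms add_cancel[of "g \<cdot> ?z" "g \<cdot> ?z" "ZeroArr C X (Cod C g)"] by simp
qed

lemma zero_comp [simp]:
  assumes "g \<in> Arr C" "Y \<in> Obj C" "X = Cod C g"
  shows "ZeroArr C X Y \<cdot> g = ZeroArr C (Dom C g) Y"
proof -
  let ?z = "ZeroArr C X Y"
  have "AddArr C ?z ?z \<cdot> g = AddArr C (?z \<cdot> g) (?z \<cdot> g)"
    by (rule add_comp) (use assms in auto)
  then show ?thesis
    using assms add_cancel[of "?z \<cdot> g" "?z \<cdot> g" "ZeroArr C (Dom C g) Y"] by simp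
qed

lemma arr_sub [simp]:
  assumes "f \<in> Arr C" "g \<in> Arr C" "Dom C g = Dom C f" "Cod C g = Cod C f"
  shows "sub_arr f g \<in> Arr C" "Dom C (sub_arr f g) = Dom C f" "Cod C (sub_arr f g) = Cod C f"
  using assms by (auto simp: sub_arr_def)

lemma neg_unique:
  assumes "f \<in> Arr C" "g \<in> Arr C" "Dom C g = Dom C f" "Cod C g = Cod C f"
    "AddArr C f g = ZeroArr C (Dom C f) (Cod C f)"
  shows "neg_arr f = g"
  using add_cancel[of f "neg_arr f" g] assms add_neg by simp

lemma comp_neg: "f \<in> Arr C \<Longrightarrow> g \<in> Arr C \<Longrightarrow> Dom C g = Cod C f \<Longrightarrow> g \<cdot> neg_arr f = neg_arr (g \<cdot> f)"
  by (rule neg_unique[symmetric]) (simp_all add: comp_add[symmetric] add_neg)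

lemma neg_comp: "f \<in> Arr C \<Longrightarrow> g \<in> Arr C \<Longrightarrow> Dom C g = Cod C f \<Longrightarrow> neg_arr g \<cdot> f = neg_arr (g \<cdot> f)"
  by (rule neg_unique[symmetric]) (simp_all add: add_comp[symmetric] add_neg)

lemma comp_sub:
  "f \<in> Arr C \<Longrightarrow> f' \<in> Arr C \<Longrightarrow> g \<in> Arr C \<Longrightarrow> Dom C f' = Dom C f \<Longrightarrow> Cod C f' = Cod C f \<Longrightarrow>
   Dom C g = Cod C f \<Longrightarrow> g \<cdot> sub_arr f f' = sub_arr (g \<cdot> f) (g \<cdot> f')"
  by (simp add: sub_arr_def comp_add comp_neg)

lemma sub_comp:
  "f \<in> Arr C \<Longrightarrow> g' \<in> Arr C \<Longrightarrow> g \<in> Arr C \<Longrightarrow> Dom C g' = Dom C g \<Longrightarrow> Cod C g' = Cod C g \<Longrightarrow>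
   Dom C g = Cod C f \<Longrightarrow> sub_arr g g' \<cdot> f = sub_arr (g \<cdot> f) (g' \<cdot> f)"
  by (simp add: sub_arr_def add_comp neg_comp)

lemma zero_arrI [simp]: "X \<in> Obj C \<Longrightarrow> Y \<in> Obj C \<Longrightarrow> zero_arr (ZeroArr C X Y)"
  by (simp add: zero_arr_def)

lemma zero_arr_eq: "zero_arr f \<Longrightarrow> zero_arr g \<Longrightarrow> Dom C f = Dom C g \<Longrightarrow> Cod C f = Cod C g \<Longrightarrow> f = g"
  by (metis zero_arr_def)

lemma zero_arr_comp_left:
  assumes "zero_arr f" "f \<in> Arr C" "g \<in> Arr C" "Dom C g = Cod C f"
  shows "zero_arr (g \<cdot> f)"
proof -
  have "f = ZeroArr C (Dom C f) (Cod C f)" using assms(1) by (simp only: zero_arr_def)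
  then have "g \<cdot> f = g \<cdot> ZeroArr C (Dom C f) (Cod C f)" by (rule arg_cong)
  then show ?thesis using assms by simp
qed

lemma zero_arr_comp_right:
  assumes "zero_arr g" "f \<in> Arr C" "g \<in> Arr C" "Dom C g = Cod C f"
  shows "zero_arr (g \<cdot> f)"
proof -
  have "g = ZeroArr C (Dom C g) (Cod C g)" using assms(1) by (simp only: zero_arr_def)
  then have "g \<cdot> f = ZeroArr C (Dom C g) (Cod C g) \<cdot> f" by (rule arg_cong)
  then show ?thesis using assms by simp
qed

lemma sub_add_cancel:
  assumes "f \<in> Arr C" "g \<in> Arr C" "Dom C g = Dom C f" "Cod C g = Cod C f"
  shows "AddArr C (sub_arr f g) g = f"
proof -
  have "AddArr C (neg_arr g) g = ZeroArr C (Dom C f) (Cod C f)"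
    using assms add_comm[of "neg_arr g" g] by (simp add: add_neg)
  then show ?thesis using assms by (simp add: sub_arr_def add_assoc)
qed

lemma zero_arr_sub_iff:
  assumes "f \<in> Arr C" "g \<in> Arr C" "Dom C g = Dom C f" "Cod C g = Cod C f"
  shows "zero_arr (sub_arr f g) \<longleftrightarrow> f = g"
proof
  assume "zero_arr (sub_arr f g)"
  then have "sub_arr f g = ZeroArr C (Dom C f) (Cod C f)" using assms by (simp add: zero_arr_def)
  then show "f = g" using sub_add_cancel[OF assms] assms by simp
next
  assume "f = g"
  then show "zero_arr (sub_arr f g)" using assms by (simp add: sub_arr_def add_neg)
qed

section \<open>Monomorphisms and epimorphisms tested on zero arrows, kernels and cokernels\<close>

lemma mono_arr_arr [simp]: "mono_arr C m \<Longrightarrow> m \<in> Arr C"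
  by (simp add: mono_arr_def)

lemma epi_arr_arr [simp]: "epi_arr C m \<Longrightarrow> m \<in> Arr C"
  by (simp add: epi_arr_def)

lemma mono_cancel:
  "mono_arr C m \<Longrightarrow> m \<cdot> f = m \<cdot> g \<Longrightarrow> f \<in> Arr C \<Longrightarrow> g \<in> Arr C \<Longrightarrow> Dom C f = Dom C g \<Longrightarrow>
   Cod C f = Dom C m \<Longrightarrow> Cod C g = Dom C m \<Longrightarrow> f = g"
  unfolding mono_arr_def by (metis Hom_iff)

lemma epi_cancel:
  "epi_arr C e \<Longrightarrow> f \<cdot> e = g \<cdot> e \<Longrightarrow> f \<in> Arr C \<Longrightarrow> g \<in> Arr C \<Longrightarrow> Cod C f = Cod C g \<Longrightarrow>
   Dom C f = Cod C e \<Longrightarrow> Dom C g = Cod C e \<Longrightarrow> f = g"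
  unfolding epi_arr_def by (metis Hom_iff)

lemma mono_zero_arr:
  assumes "mono_arr C m" "f \<in> Arr C" "Cod C f = Dom C m"
  shows "zero_arr (m \<cdot> f) \<longleftrightarrow> zero_arr f"
proof
  assume "zero_arr (m \<cdot> f)"
  then have "m \<cdot> f = m \<cdot> ZeroArr C (Dom C f) (Cod C f)"
    using assms by (simp add: zero_arr_def)
  then show "zero_arr f"
    using mono_cancel[OF assms(1), of f "ZeroArr C (Dom C f) (Cod C f)"] assms
    by (simp add: zero_arr_def)
qed (use assms in \<open>auto intro: zero_arr_comp_left\<close>)

lemma epi_zero_arr:
  assumes "epi_arr C e" "f \<in> Arr C" "Dom C f = Cod C e"
  shows "zero_arr (f \<cdot> e) \<longleftrightarrow> zero_arr f"
proof
  assume "zero_arr (f \<cdot> e)"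
  then have "f \<cdot> e = ZeroArr C (Dom C f) (Cod C f) \<cdot> e"
    using assms by (simp add: zero_arr_def)
  then show "zero_arr f"
    using epi_cancel[OF assms(1), of f "ZeroArr C (Dom C f) (Cod C f)"] assms
    by (simp add: zero_arr_def)
qed (use assms in \<open>auto intro: zero_arr_comp_right\<close>)

text \<open>Taking differences reduces cancellation of a pair of arrows to the case where one of
  them is zero.\<close>

lemma mono_arrI:
  assumes "m \<in> Arr C" "\<And>f. f \<in> Arr C \<Longrightarrow> Cod C f = Dom C m \<Longrightarrow> zero_arr (m \<cdot> f) \<Longrightarrow> zero_arr f"
  shows "mono_arr C m"
  unfolding mono_arr_def
proof (intro conjI allI ballI impI)
  fix X f g assume "f \<in> Hom C X (Dom C m)" "g \<in> Hom C X (Dom C m)" "m \<cdot> f = m \<cdot> g"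
  then show "f = g"
    using assms(2)[of "sub_arr f g"] assms(1)
    by (simp add: comp_sub zero_arr_sub_iff)
qed (fact assms(1))

lemma epi_arrI:
  assumes "m \<in> Arr C" "\<And>f. f \<in> Arr C \<Longrightarrow> Dom C f = Cod C m \<Longrightarrow> zero_arr (f \<cdot> m) \<Longrightarrow> zero_arr f"
  shows "epi_arr C m"
  unfolding epi_arr_def
proof (intro conjI allI ballI impI)
  fix X f g assume "f \<in> Hom C (Cod C m) X" "g \<in> Hom C (Cod C m) X" "f \<cdot> m = g \<cdot> m"
  then show "f = g"
    using assms(2)[of "sub_arr f g"] assms(1)
    by (simp add: sub_comp zero_arr_sub_iff)
qed (fact assms(1))

lemma mono_Ident [simp]: "X \<in> Obj C \<Longrightarrow> mono_arr C (Ident C X)"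
  by (rule mono_arrI) auto

lemma epi_Ident [simp]: "X \<in> Obj C \<Longrightarrow> epi_arr C (Ident C X)"
  by (rule epi_arrI) auto

lemma mono_comp:
  assumes "mono_arr C f" "mono_arr C g" "Dom C g = Cod C f" shows "mono_arr C (g \<cdot> f)"
  by (rule mono_arrI) (use assms in \<open>auto simp: assoc mono_zero_arr\<close>)

lemma epi_comp:
  assumes "epi_arr C f" "epi_arr C g" "Dom C g = Cod C f" shows "epi_arr C (g \<cdot> f)"
  by (rule epi_arrI) (use assms in \<open>auto simp: assoc[symmetric] epi_zero_arr\<close>)

lemma mono_comp_right:
  assumes "mono_arr C (g \<cdot> f)" "f \<in> Arr C" "g \<in> Arr C" "Dom C g = Cod C f" shows "mono_arr C f"
proof (rule mono_arrI)
  fix x assume x: "x \<in> Arr C" "Cod C x = Dom C f" "zero_arr (f \<cdot> x)"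
  have "zero_arr (g \<cdot> (f \<cdot> x))" by (rule zero_arr_comp_left) (use x assms in auto)
  then have "zero_arr ((g \<cdot> f) \<cdot> x)" using x assms by (simp add: assoc)
  then show "zero_arr x" using mono_zero_arr[OF assms(1), of x] x assms by simp
qed (use assms in auto)

lemma epi_comp_left:
  assumes "epi_arr C (g \<cdot> f)" "f \<in> Arr C" "g \<in> Arr C" "Dom C g = Cod C f" shows "epi_arr C g"
proof (rule epi_arrI)
  fix x assume x: "x \<in> Arr C" "Dom C x = Cod C g" "zero_arr (x \<cdot> g)"
  have "zero_arr ((x \<cdot> g) \<cdot> f)" by (rule zero_arr_comp_right) (use x assms in auto)
  then have "zero_arr (x \<cdot> (g \<cdot> f))" using x assms by (simp add: assoc)
  then show "zero_arr x" using epi_zero_arr[OF assms(1), of x] x assms by simp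
qed (use assms in auto)

text \<open>A kernel is monic because \<open>h\<close> and the zero arrow are two factorisations of
  the same arrow \<open>k \<cdot> h = 0\<close> through \<open>k\<close>, and factorisations are
  unique.\<close>

lemma kernel_arr:
  assumes "is_kernel C f k"
  shows "f \<in> Arr C" "k \<in> Arr C" "Cod C k = Dom C f" "zero_arr (f \<cdot> k)" "mono_arr C k"
proof -
  show *: "f \<in> Arr C" "k \<in> Arr C" "Cod C k = Dom C f" "zero_arr (f \<cdot> k)"
    using assms by (auto simp: is_kernel_def)
  show "mono_arr C k"
  proof (rule mono_arrI)
    fix h assume h: "h \<in> Arr C" "Cod C h = Dom C k" "zero_arr (k \<cdot> h)"
    let ?z = "ZeroArr C (Dom C h) (Dom C k)"
    have 1: "k \<cdot> h = k \<cdot> ?z" using h * by (simp add: zero_arr_def)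
    have "f \<cdot> (k \<cdot> h) = ZeroArr C (Dom C h) (Cod C f)" using h * 1 by simp
    then have "\<exists>!u. u \<in> Hom C (Dom C h) (Dom C k) \<and> k \<cdot> u = k \<cdot> h"
      using assms h * unfolding is_kernel_def by simp
    moreover have "h \<in> Hom C (Dom C h) (Dom C k) \<and> k \<cdot> h = k \<cdot> h" using h by simp
    moreover have "?z \<in> Hom C (Dom C h) (Dom C k) \<and> k \<cdot> ?z = k \<cdot> h"
      using h * 1 by (simp del: comp_zero)
    ultimately have "h = ?z" by blast
    then show "zero_arr h" using h * by (metis zero_arrI Dom_Obj)
  qed (rule *)
qed

lemma kernel_factor:
  assumes "is_kernel C f k" "h \<in> Arr C" "Cod C h = Dom C f" "zero_arr (f \<cdot> h)"
  obtains u where "u \<in> Arr C" "Dom C u = Dom C h" "Cod C u = Dom C k" "k \<cdot> u = h"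
proof -
  have "f \<cdot> h = ZeroArr C (Dom C h) (Cod C f)"
    using assms kernel_arr[OF assms(1)] by (simp add: zero_arr_def)
  moreover have "h \<in> Hom C (Dom C h) (Dom C f)" using assms by simp
  ultimately have "\<exists>!u. u \<in> Hom C (Dom C h) (Dom C k) \<and> k \<cdot> u = h"
    using assms(1) unfolding is_kernel_def by blast
  then show ?thesis using that by auto
qed

lemma cokernel_arr:
  assumes "is_cokernel C f q"
  shows "f \<in> Arr C" "q \<in> Arr C" "Dom C q = Cod C f" "zero_arr (q \<cdot> f)" "epi_arr C q"
proof -
  show *: "f \<in> Arr C" "q \<in> Arr C" "Dom C q = Cod C f" "zero_arr (q \<cdot> f)"
    using assms by (auto simp: is_cokernel_def)
  show "epi_arr C q"
  proof (rule epi_arrI)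
    fix h assume h: "h \<in> Arr C" "Dom C h = Cod C q" "zero_arr (h \<cdot> q)"
    let ?z = "ZeroArr C (Cod C q) (Cod C h)"
    have 1: "h \<cdot> q = ?z \<cdot> q" using h * by (simp add: zero_arr_def)
    have "(h \<cdot> q) \<cdot> f = ZeroArr C (Dom C f) (Cod C h)" using h * 1 by simp
    then have "\<exists>!u. u \<in> Hom C (Cod C q) (Cod C h) \<and> u \<cdot> q = h \<cdot> q"
      using assms h * unfolding is_cokernel_def by simp
    moreover have "h \<in> Hom C (Cod C q) (Cod C h) \<and> h \<cdot> q = h \<cdot> q" using h by simp
    moreover have "?z \<in> Hom C (Cod C q) (Cod C h) \<and> ?z \<cdot> q = h \<cdot> q"
      using h * 1 by (simp del: zero_comp)
    ultimately have "h = ?z" by blast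
    then show "zero_arr h" using h * by (metis zero_arrI Cod_Obj)
  qed (rule *)
qed

lemma cokernel_factor:
  assumes "is_cokernel C f q" "h \<in> Arr C" "Dom C h = Cod C f" "zero_arr (h \<cdot> f)"
  obtains u where "u \<in> Arr C" "Dom C u = Cod C q" "Cod C u = Cod C h" "u \<cdot> q = h"
proof -
  have "h \<cdot> f = ZeroArr C (Dom C f) (Cod C h)"
    using assms cokernel_arr[OF assms(1)] by (simp add: zero_arr_def)
  moreover have "h \<in> Hom C (Cod C f) (Cod C h)" using assms by simp
  ultimately have "\<exists>!u. u \<in> Hom C (Cod C q) (Cod C h) \<and> u \<cdot> q = h"
    using assms(1) unfolding is_cokernel_def by blast
  then show ?thesis using that by auto
qed

lemma kernelI:
  assumes "mono_arr C k" "f \<in> Arr C" "Cod C k = Dom C f" "zero_arr (f \<cdot> k)"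
    "\<And>h. h \<in> Arr C \<Longrightarrow> Cod C h = Dom C f \<Longrightarrow> zero_arr (f \<cdot> h) \<Longrightarrow> sub_le C h k"
  shows "is_kernel C f k"
  unfolding is_kernel_def
proof (intro conjI allI ballI impI)
  show "f \<cdot> k = ZeroArr C (Dom C k) (Cod C f)" using assms by (simp add: zero_arr_def)
  fix X h assume h: "h \<in> Hom C X (Dom C f)" "f \<cdot> h = ZeroArr C X (Cod C f)"
  then have "zero_arr (f \<cdot> h)" using assms(2) Dom_Obj[of h] by (auto simp del: Dom_Obj)
  then obtain u where "u \<in> Hom C X (Dom C k)" "k \<cdot> u = h"
    using assms(5)[of h] h by (auto simp: sub_le_def)
  then show "\<exists>!u. u \<in> Hom C X (Dom C k) \<and> k \<cdot> u = h"
    using mono_cancel[OF assms(1)] by (intro ex1I[of _ u]) auto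
qed (use assms in auto)

section \<open>Inclusion of subobjects and zero objects\<close>

lemma sub_leI: "u \<in> Arr C \<Longrightarrow> n \<in> Arr C \<Longrightarrow> Cod C u = Dom C n \<Longrightarrow> n \<cdot> u = m \<Longrightarrow> sub_le C m n"
  unfolding sub_le_def by auto

lemma sub_leE:
  assumes "sub_le C m n"
  obtains u where "u \<in> Arr C" "Dom C u = Dom C m" "Cod C u = Dom C n" "n \<cdot> u = m"
  using assms unfolding sub_le_def by auto

lemma sub_le_refl: "m \<in> Arr C \<Longrightarrow> sub_le C m m"
  by (rule sub_leI[of "Ident C (Dom C m)"]) auto

lemma sub_le_trans:
  assumes "sub_le C m n" "sub_le C n k" "k \<in> Arr C"
  shows "sub_le C m k"
proof -
  obtain u where u: "u \<in> Arr C" "Dom C u = Dom C m" "Cod C u = Dom C n" "n \<cdot> u = m"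
    using assms by (rule_tac sub_leE)
  obtain v where v: "v \<in> Arr C" "Dom C v = Dom C n" "Cod C v = Dom C k" "k \<cdot> v = n"
    using assms by (rule_tac sub_leE[of n k])
  show ?thesis by (rule sub_leI[of "v \<cdot> u"]) (use u v assms in \<open>auto simp: assoc[symmetric]\<close>)
qed

lemma sub_le_comp: "f \<in> Arr C \<Longrightarrow> x \<in> Arr C \<Longrightarrow> Dom C f = Cod C x \<Longrightarrow> sub_le C f m \<Longrightarrow> m \<in> Arr C \<Longrightarrow>
    sub_le C (f \<cdot> x) m"
  by (rule sub_le_trans[of _ f]) (auto intro: sub_leI)

lemma sub_le_comp_left:
  assumes "sub_le C f m" "g \<in> Arr C" "m \<in> Arr C" "Dom C g = Cod C m"
  shows "sub_le C (g \<cdot> f) (g \<cdot> m)"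
proof -
  obtain u where u: "u \<in> Arr C" "Dom C u = Dom C f" "Cod C u = Dom C m" "m \<cdot> u = f"
    using assms by (rule_tac sub_leE)
  show ?thesis by (rule sub_leI[of u]) (use u assms in \<open>auto simp: assoc\<close>)
qed

text \<open>Every arrow into or out of \<open>Z\<close> factors through the identity of
  \<open>Z\<close>, so it vanishes as soon as the identity does.\<close>

lemma zero_obj_iff: "zero_obj C Z \<longleftrightarrow> Z \<in> Obj C \<and> zero_arr (Ident C Z)"
proof
  assume "zero_obj C Z"
  then have Z: "Z \<in> Obj C" and u: "\<exists>!f. f \<in> Hom C Z Z" by (auto simp: zero_obj_def)
  have "Ident C Z = ZeroArr C Z Z"
    using u Z by (metis Hom_iff arr_Ident arr_Zero)
  then show "Z \<in> Obj C \<and> zero_arr (Ident C Z)" using Z by simp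
next
  assume Z: "Z \<in> Obj C \<and> zero_arr (Ident C Z)"
  have 1: "zero_arr f" if "f \<in> Hom C X Z" for f X
  proof -
    have "zero_arr (Ident C Z \<cdot> f)" by (rule zero_arr_comp_right) (use that Z in auto)
    then show ?thesis using that by simp
  qed
  have 2: "zero_arr f" if "f \<in> Hom C Z X" for f X
  proof -
    have "zero_arr (f \<cdot> Ident C Z)" by (rule zero_arr_comp_left) (use that Z in auto)
    then show ?thesis using that by simp
  qed
  show "zero_obj C Z" unfolding zero_obj_def
  proof (intro conjI ballI)
    fix X assume X: "X \<in> Obj C"
    show "\<exists>!f. f \<in> Hom C X Z"
      by (rule ex1I[of _ "ZeroArr C X Z"]) (use X Z in \<open>auto intro!: zero_arr_eq 1\<close>)
    show "\<exists>!f. f \<in> Hom C Z X"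
      by (rule ex1I[of _ "ZeroArr C Z X"]) (use X Z in \<open>auto intro!: zero_arr_eq 2\<close>)
  qed (use Z in auto)
qed

lemma zero_obj_Dom: "f \<in> Arr C \<Longrightarrow> zero_obj C (Dom C f) \<Longrightarrow> zero_arr f"
  using zero_arr_comp_left[of "Ident C (Dom C f)" f] by (auto simp: zero_obj_iff)

lemma zero_obj_Cod: "f \<in> Arr C \<Longrightarrow> zero_obj C (Cod C f) \<Longrightarrow> zero_arr f"
  using zero_arr_comp_right[of "Ident C (Cod C f)" f] by (auto simp: zero_obj_iff)

lemma mono_zero_iff:
  assumes "mono_arr C m" shows "zero_arr m \<longleftrightarrow> zero_obj C (Dom C m)"
  using mono_zero_arr[OF assms, of "Ident C (Dom C m)"] assms by (auto simp: zero_obj_iff)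

lemma nonzero_mono_iff:
  assumes "mono_arr C m" shows "nonzero_obj C (Dom C m) \<longleftrightarrow> \<not> zero_arr m"
  using mono_zero_iff[OF assms] assms by (auto simp: nonzero_obj_def)

end

section \<open>Kernels, images, pullbacks and pushouts\<close>

context abelian_category
begin

lemma obtain_kernel:
  assumes "f \<in> Arr C" obtains k where "is_kernel C f k"
  using ex_kernel[OF assms] by blast

lemma obtain_cokernel:
  assumes "f \<in> Arr C" obtains q where "is_cokernel C f q"
  using ex_cokernel[OF assms] by blast

text \<open>\<open>m\<close> is the kernel of some \<open>f\<close>, and \<open>f\<close> factors
  through \<open>q\<close> because it kills \<open>m\<close>. Whatever \<open>q\<close> kills is
  thus killed by \<open>f\<close> and lies in \<open>m\<close>.\<close>

lemma mono_cokernel_factor: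
  assumes "mono_arr C m" "is_cokernel C m q" "h \<in> Arr C" "Cod C h = Cod C m" "zero_arr (q \<cdot> h)"
  shows "sub_le C h m"
proof -
  obtain f where f: "is_kernel C f m" using mono_normal[OF assms(1)] by blast
  note f' = kernel_arr[OF f] and q' = cokernel_arr[OF assms(2)]
  obtain w where w: "w \<in> Arr C" "Dom C w = Cod C q" "Cod C w = Cod C f" "w \<cdot> q = f"
    by (rule cokernel_factor[OF assms(2), of f]) (use f' in auto)
  have "zero_arr (w \<cdot> (q \<cdot> h))" by (rule zero_arr_comp_left) (use w q' assms in auto)
  then have "zero_arr (f \<cdot> h)" using w q' assms by (simp add: reassoc[OF w(4)])
  then obtain u where u: "u \<in> Arr C" "Dom C u = Dom C h" "Cod C u = Dom C m" "m \<cdot> u = h"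
    using kernel_factor[OF f, of h] f' assms by auto
  show ?thesis by (rule sub_leI[of u]) (use u assms in auto)
qed

lemma mono_cokernel_iff:
  assumes "mono_arr C m" "is_cokernel C m q" "h \<in> Arr C" "Cod C h = Cod C m"
  shows "zero_arr (q \<cdot> h) \<longleftrightarrow> sub_le C h m"
proof
  assume "sub_le C h m"
  then obtain u where u: "u \<in> Arr C" "Dom C u = Dom C h" "Cod C u = Dom C m" "m \<cdot> u = h"
    by (rule sub_leE)
  note q = cokernel_arr[OF assms(2)]
  have "zero_arr ((q \<cdot> m) \<cdot> u)" by (rule zero_arr_comp_right) (use u q in auto)
  then show "zero_arr (q \<cdot> h)" using u q assms by (simp add: assoc)
qed (use mono_cokernel_factor[OF assms] in auto)

lemma mono_is_kernel: "mono_arr C m \<Longrightarrow> is_cokernel C m q \<Longrightarrow> is_kernel C q m"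
  by (rule kernelI) (auto simp: cokernel_arr intro: mono_cokernel_factor)

text \<open>The dual of \<open>mono_cokernel_factor\<close>.\<close>

lemma epi_kernel_factor:
  assumes "epi_arr C e" "is_kernel C e k" "h \<in> Arr C" "Dom C h = Dom C e" "zero_arr (h \<cdot> k)"
  obtains u where "u \<in> Arr C" "Dom C u = Cod C e" "Cod C u = Cod C h" "u \<cdot> e = h"
proof -
  obtain f where f: "is_cokernel C f e" using epi_normal[OF assms(1)] by blast
  note f' = cokernel_arr[OF f] and k = kernel_arr[OF assms(2)]
  obtain w where w: "w \<in> Arr C" "Dom C w = Dom C f" "Cod C w = Dom C k" "k \<cdot> w = f"
    by (rule kernel_factor[OF assms(2), of f]) (use f' in auto)
  have "zero_arr ((h \<cdot> k) \<cdot> w)" by (rule zero_arr_comp_right) (use w k assms in auto)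
  then have "zero_arr (h \<cdot> f)" using w k assms by (simp add: assoc)
  then show ?thesis using cokernel_factor[OF f, of h] f' assms that by auto
qed

text \<open>The image is the kernel of the cokernel \<open>q\<close> of \<open>f\<close>. To see
  that \<open>e\<close> is epi, let \<open>g\<close> kill \<open>e\<close>. Then \<open>f\<close>
  factors through the smaller subobject \<open>m \<cdot> k\<close> with \<open>k\<close> the kernel
  of \<open>g\<close>. The cokernel of \<open>m \<cdot> k\<close> kills \<open>f\<close>, so it
  factors through \<open>q\<close> and kills \<open>m\<close>. Hence \<open>m\<close> lies in
  \<open>m \<cdot> k\<close>, so \<open>k\<close> is split epi and \<open>g\<close>
  vanishes.\<close>

lemma image_factorization:
  assumes "f \<in> Arr C"
  obtains m e where "mono_arr C m" "epi_arr C e" "Dom C m = Cod C e" "Cod C m = Cod C f"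
    "Dom C e = Dom C f" "m \<cdot> e = f"
proof -
  obtain q where q: "is_cokernel C f q" using obtain_cokernel[OF assms] .
  note q' = cokernel_arr[OF q]
  obtain m where m: "is_kernel C q m" using obtain_kernel q' by blast
  note m' = kernel_arr[OF m]
  obtain e where e: "e \<in> Arr C" "Dom C e = Dom C f" "Cod C e = Dom C m" "m \<cdot> e = f"
    by (rule kernel_factor[OF m, of f]) (use q' in auto)
  have "epi_arr C e"
  proof (rule epi_arrI)
    fix g assume g: "g \<in> Arr C" "Dom C g = Cod C e" "zero_arr (g \<cdot> e)"
    obtain k where k: "is_kernel C g k" using obtain_kernel g by blast
    note k' = kernel_arr[OF k]
    obtain u where u: "u \<in> Arr C" "Dom C u = Dom C e" "Cod C u = Dom C k" "k \<cdot> u = e"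
      by (rule kernel_factor[OF k, of e]) (use e g in auto)
    have mk: "mono_arr C (m \<cdot> k)" by (rule mono_comp) (use k' m' e g in auto)
    obtain p where p: "is_cokernel C (m \<cdot> k) p" using obtain_cokernel mk by (metis mono_arr_arr)
    note p' = cokernel_arr[OF p]
    have D: "Dom C p = Cod C m" using p' m' k' g e by simp
    have "zero_arr ((p \<cdot> (m \<cdot> k)) \<cdot> u)" by (rule zero_arr_comp_right) (use p' u k' m' g e in auto)
    then have "zero_arr (p \<cdot> f)" using u e p' k' m' g D by (simp add: assoc)
    then obtain p2 where p2: "p2 \<in> Arr C" "Dom C p2 = Cod C q" "Cod C p2 = Cod C p" "p2 \<cdot> q = p"
      using cokernel_factor[OF q, of p] p' D m' q' by auto
    have "zero_arr (p2 \<cdot> (q \<cdot> m))" by (rule zero_arr_comp_left) (use p2 q' m' in auto)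
    then have "zero_arr (p \<cdot> m)" using p2 q' m' by (simp add: reassoc[OF p2(4)])
    then have "sub_le C m (m \<cdot> k)"
      using mono_cokernel_factor[OF mk p, of m] m' k' g e by simp
    then obtain v where v: "v \<in> Arr C" "Dom C v = Dom C m" "Cod C v = Dom C (m \<cdot> k)"
        "(m \<cdot> k) \<cdot> v = m"
      by (rule sub_leE)
    have cv: "Cod C v = Dom C k" using v m' k' g e by simp
    have "k \<cdot> v = Ident C (Dom C m)"
      by (rule mono_cancel[of m]) (use v cv m' k' g e in \<open>auto simp: assoc\<close>)
    then have "g = g \<cdot> (k \<cdot> v)" using g e by simp
    moreover have "zero_arr ((g \<cdot> k) \<cdot> v)" by (rule zero_arr_comp_right) (use v cv k' g e in auto)
    ultimately show "zero_arr g" using v cv k' g e by (simp add: assoc)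
  qed (rule e)
  then show ?thesis using that[of m e] m' e q' by simp
qed

lemma zero_arr_neg [simp]: "f \<in> Arr C \<Longrightarrow> zero_arr (neg_arr f) \<longleftrightarrow> zero_arr f"
proof -
  assume f: "f \<in> Arr C"
  have "neg_arr (neg_arr f) = f"
    by (rule neg_unique) (use f in \<open>auto simp: add_neg add_comm[of "neg_arr f"]\<close>)
  moreover have "zero_arr (neg_arr g)" if "zero_arr g" for g
  proof -
    have "g \<in> Arr C" using that by (simp add: zero_arr_def)
    then have "zero_arr (neg_arr (Ident C (Cod C g)) \<cdot> g)"
      by (intro zero_arr_comp_left that) auto
    then show ?thesis using \<open>g \<in> Arr C\<close> by (simp add: neg_comp)
  qed
  ultimately show ?thesis by metis
qed

lemma zero_arr_add: "zero_arr f \<Longrightarrow> zero_arr g \<Longrightarrow> Dom C g = Dom C f \<Longrightarrow> Cod C g = Cod C f \<Longrightarrow>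
  zero_arr (AddArr C f g)"
  by (metis Cod_Obj Dom_Obj add_zero(1) zero_arr_def)

lemma sub_zero_left [simp]: "g \<in> Arr C \<Longrightarrow> X = Dom C g \<Longrightarrow> Y = Cod C g \<Longrightarrow>
    sub_arr (ZeroArr C X Y) g = neg_arr g"
  by (simp add: sub_arr_def)

lemma neg_zero [simp]: "X \<in> Obj C \<Longrightarrow> Y \<in> Obj C \<Longrightarrow> neg_arr (ZeroArr C X Y) = ZeroArr C X Y"
  by (rule neg_unique) auto

lemma sub_zero_right [simp]: "g \<in> Arr C \<Longrightarrow> X = Dom C g \<Longrightarrow> Y = Cod C g \<Longrightarrow> sub_arr g (ZeroArr C X Y) = g"
  by (simp add: sub_arr_def)

section \<open>Biproducts, pullbacks and pushouts\<close>

lemma biproduct_arr: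
  assumes "is_biproduct C X Y S i j a b"
  shows "S \<in> Obj C" "i \<in> Arr C" "Dom C i = X" "Cod C i = S" "j \<in> Arr C" "Dom C j = Y" "Cod C j = S"
    "a \<in> Arr C" "Dom C a = S" "Cod C a = X" "b \<in> Arr C" "Dom C b = S" "Cod C b = Y"
    "a \<cdot> i = Ident C X" "b \<cdot> j = Ident C Y" "a \<cdot> j = ZeroArr C Y X" "b \<cdot> i = ZeroArr C X Y"
    "AddArr C (i \<cdot> a) (j \<cdot> b) = Ident C S"
  using assms by (auto simp: is_biproduct_def)

lemma biproduct_joint_mono:
  assumes "is_biproduct C X Y S i j a b" "x \<in> Arr C" "Cod C x = S" "zero_arr (a \<cdot> x)"
      "zero_arr (b \<cdot> x)"
  shows "zero_arr x"
proof -
  note B = biproduct_arr[OF assms(1)]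
  have "x = AddArr C (i \<cdot> a) (j \<cdot> b) \<cdot> x" using B assms by simp
  also have "\<dots> = AddArr C (i \<cdot> (a \<cdot> x)) (j \<cdot> (b \<cdot> x))"
    using B(1-13) assms by (simp add: add_comp assoc)
  finally show ?thesis using B assms
    by (metis (no_types, lifting) arr_Comp zero_arr_add zero_arr_comp_left)
qed

lemma biproduct_joint_epi:
  assumes "is_biproduct C X Y S i j a b" "x \<in> Arr C" "Dom C x = S" "zero_arr (x \<cdot> i)"
      "zero_arr (x \<cdot> j)"
  shows "zero_arr x"
proof -
  note B = biproduct_arr[OF assms(1)]
  have "x = x \<cdot> AddArr C (i \<cdot> a) (j \<cdot> b)" using B assms by simp
  also have "\<dots> = AddArr C ((x \<cdot> i) \<cdot> a) ((x \<cdot> j) \<cdot> b)"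
    using B(1-13) assms by (simp add: comp_add assoc)
  finally show ?thesis using B assms
    by (metis (no_types, lifting) arr_Comp zero_arr_add zero_arr_comp_right)
qed

text \<open>The pullback is the kernel of the difference \<open>\<phi>\<close> of \<open>f\<close>
  and \<open>g\<close> on the biproduct. If \<open>g\<close> is epi then so is
  \<open>\<phi>\<close>, which restricts to \<open>- g\<close> on the second summand;
  \<open>\<phi>\<close> is then a cokernel of its kernel. An arrow \<open>w\<close> killing the
  projection \<open>a \<cdot> k\<close> therefore gives
  \<open>w \<cdot> a = v \<cdot> \<phi>\<close>, and restriction to the second summand yields
  \<open>v \<cdot> g = 0\<close>, hence \<open>v = 0\<close> and \<open>w = 0\<close>.\<close>

lemma pullback:
  assumes "f \<in> Arr C" "g \<in> Arr C" "Cod C f = Cod C g"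
  obtains p q where "p \<in> Arr C" "q \<in> Arr C" "Dom C q = Dom C p" "Cod C p = Dom C f"
      "Cod C q = Dom C g"
    "f \<cdot> p = g \<cdot> q"
    "\<forall>x y. x \<in> Arr C \<longrightarrow> y \<in> Arr C \<longrightarrow> Dom C x = Dom C y \<longrightarrow> Cod C x = Dom C f \<longrightarrow> Cod C y = Dom C g \<longrightarrow>
       f \<cdot> x = g \<cdot> y \<longrightarrow> (\<exists>u. u \<in> Arr C \<and> Dom C u = Dom C x \<and> Cod C u = Dom C p \<and> p \<cdot> u = x \<and>
           q \<cdot> u = y)"
    "mono_arr C g \<longrightarrow> mono_arr C p" "mono_arr C f \<longrightarrow> mono_arr C q"
    "epi_arr C g \<longrightarrow> epi_arr C p" "epi_arr C f \<longrightarrow> epi_arr C q"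
proof -
  obtain S i j a b where bp: "is_biproduct C (Dom C f) (Dom C g) S i j a b"
    using ex_biproduct[of "Dom C f" "Dom C g"] assms by auto
  note B = biproduct_arr[OF bp]
  define \<phi> where "\<phi> = sub_arr (f \<cdot> a) (g \<cdot> b)"
  have \<phi>: "\<phi> \<in> Arr C" "Dom C \<phi> = S" "Cod C \<phi> = Cod C f"
    unfolding \<phi>_def using B(1-13) assms by simp_all
  have \<phi>i: "\<phi> \<cdot> i = f" and \<phi>j: "\<phi> \<cdot> j = neg_arr g"
    unfolding \<phi>_def using B assms by (simp_all add: sub_comp assoc)
  obtain k where k: "is_kernel C \<phi> k" using obtain_kernel \<phi> by blast
  note k' = kernel_arr[OF k]
  let ?p = "a \<cdot> k" and ?q = "b \<cdot> k"
  have comp_phi: "\<phi> \<cdot> s = sub_arr (f \<cdot> (a \<cdot> s)) (g \<cdot> (b \<cdot> s))" if "s \<in> Arr C" "Cod C s = S" for s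
    unfolding \<phi>_def using that B(1-13) assms by (simp add: sub_comp assoc)
  have eq: "f \<cdot> ?p = g \<cdot> ?q"
    using zero_arr_sub_iff[of "f \<cdot> ?p" "g \<cdot> ?q"] comp_phi[of k] k' \<phi> B(1-13) assms by simp
  have joint: "zero_arr u"
      if "u \<in> Arr C" "Cod C u = Dom C k" "zero_arr (?p \<cdot> u)" "zero_arr (?q \<cdot> u)" for u
  proof -
    have "zero_arr (k \<cdot> u)"
      by (rule biproduct_joint_mono[OF bp]) (use that B(1-13) k' \<phi> in \<open>auto simp: assoc\<close>)
    then show ?thesis using mono_zero_arr[OF k'(5)] that by simp
  qed
  have univ: "\<exists>u. u \<in> Arr C \<and> Dom C u = Dom C x \<and> Cod C u = Dom C ?p \<and> ?p \<cdot> u = x \<and> ?q \<cdot> u = y"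
    if xy: "x \<in> Arr C" "y \<in> Arr C" "Dom C x = Dom C y" "Cod C x = Dom C f" "Cod C y = Dom C g"
      "f \<cdot> x = g \<cdot> y" for x y
  proof -
    define s where "s = AddArr C (i \<cdot> x) (j \<cdot> y)"
    have s: "s \<in> Arr C" "Cod C s = S" "Dom C s = Dom C x" unfolding s_def using xy B(1-13)
        by simp_all
    have as: "a \<cdot> s = x" and bs: "b \<cdot> s = y"
      unfolding s_def using xy B assms by (simp_all add: comp_add reassoc)
    have "zero_arr (\<phi> \<cdot> s)"
      using comp_phi[OF s(1,2)] as bs xy assms zero_arr_sub_iff[of "f \<cdot> x" "g \<cdot> y"] by simp
    then obtain u where u: "u \<in> Arr C" "Dom C u = Dom C s" "Cod C u = Dom C k" "k \<cdot> u = s"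
      using kernel_factor[OF k, of s] s \<phi> by auto
    show ?thesis
      by (rule exI[of _ u]) (use u s as bs B(1-13) k' \<phi> in \<open>auto simp: assoc\<close>)
  qed
  have sq: "f \<cdot> (?p \<cdot> u) = g \<cdot> (?q \<cdot> u)" if "u \<in> Arr C" "Cod C u = Dom C k" for u
    using that eq B(1-13) k' \<phi> assms assoc[of u ?p f] assoc[of u ?q g] by simp
  have monop: "mono_arr C ?p" if "mono_arr C g"
  proof (rule mono_arrI)
    fix u assume u: "u \<in> Arr C" "Cod C u = Dom C ?p" "zero_arr (?p \<cdot> u)"
    then have u2: "Cod C u = Dom C k" using B(1-13) k' \<phi> by simp
    have "zero_arr (f \<cdot> (?p \<cdot> u))" by (rule zero_arr_comp_left)
        (use u u2 B(1-13) k' \<phi> assms in auto)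
    then have "zero_arr (?q \<cdot> u)"
        using sq[OF u(1) u2] mono_zero_arr[OF that, of "?q \<cdot> u"] u u2 B(1-13) k' \<phi> by simp
    then show "zero_arr u" using joint u u2 by simp
  qed (use B(1-13) k' \<phi> in simp)
  have monoq: "mono_arr C ?q" if "mono_arr C f"
  proof (rule mono_arrI)
    fix u assume u: "u \<in> Arr C" "Cod C u = Dom C ?q" "zero_arr (?q \<cdot> u)"
    then have u2: "Cod C u = Dom C k" using B(1-13) k' \<phi> by simp
    have "zero_arr (g \<cdot> (?q \<cdot> u))" by (rule zero_arr_comp_left)
        (use u u2 B(1-13) k' \<phi> assms in auto)
    then have "zero_arr (?p \<cdot> u)"
        using sq[OF u(1) u2] mono_zero_arr[OF that, of "?p \<cdot> u"] u u2 B(1-13) k' \<phi> by simp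
    then show "zero_arr u" using joint u u2 by simp
  qed (use B(1-13) k' \<phi> in simp)
  have epip: "epi_arr C ?p" if g: "epi_arr C g"
  proof (rule epi_arrI)
    have "epi_arr C (\<phi> \<cdot> j)" unfolding \<phi>j
    proof (rule epi_arrI)
      fix h assume "h \<in> Arr C" "Dom C h = Cod C (neg_arr g)" "zero_arr (h \<cdot> neg_arr g)"
      then show "zero_arr h" using assms epi_zero_arr[OF g, of h] by (simp add: comp_neg)
    qed (use assms in simp)
    then have e\<phi>: "epi_arr C \<phi>" by (rule epi_comp_left) (use B(1-13) \<phi> in auto)
    fix w assume w: "w \<in> Arr C" "Dom C w = Cod C ?p" "zero_arr (w \<cdot> ?p)"
    then have w2: "Dom C w = Dom C f" using B(1-13) k' \<phi> by simp
    have "zero_arr ((w \<cdot> a) \<cdot> k)" using w w2 B(1-13) k' \<phi> by (simp add: assoc)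
    then obtain v where v: "v \<in> Arr C" "Dom C v = Cod C \<phi>" "Cod C v = Cod C w" "v \<cdot> \<phi> = w \<cdot> a"
      using epi_kernel_factor[OF e\<phi> k, of "w \<cdot> a"] w w2 B(1-13) \<phi> by auto
    have "(v \<cdot> \<phi>) \<cdot> j = ZeroArr C (Dom C g) (Cod C w)" unfolding v(4) using w w2 B assms
        by (simp add: assoc)
    then have "neg_arr (v \<cdot> g) = ZeroArr C (Dom C g) (Cod C w)"
      using \<phi>j v(1-3) \<phi> B(1-13) assms assoc[of j \<phi> v] by (simp add: comp_neg)
    then have "zero_arr (neg_arr (v \<cdot> g))" using assms w by simp
    then have "zero_arr (v \<cdot> g)" using v \<phi> assms by simp
    then have "zero_arr v" using epi_zero_arr[OF g, of v] v \<phi> assms by simp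
    then have "zero_arr (v \<cdot> \<phi> \<cdot> i)" using v(1-3) \<phi> B(1-13) by (simp add: zero_arr_comp_right)
    then show "zero_arr w" unfolding v(4) using w w2 B assms by (simp add: assoc)
  qed (use B(1-13) k' \<phi> in simp)
  have epiq: "epi_arr C ?q" if f: "epi_arr C f"
  proof (rule epi_arrI)
    have e\<phi>: "epi_arr C \<phi>" by (rule epi_comp_left[of _ i]) (use B(1-13) \<phi> \<phi>i f in auto)
    fix w assume w: "w \<in> Arr C" "Dom C w = Cod C ?q" "zero_arr (w \<cdot> ?q)"
    then have w2: "Dom C w = Dom C g" using B(1-13) k' \<phi> by simp
    have "zero_arr ((w \<cdot> b) \<cdot> k)" using w w2 B(1-13) k' \<phi> by (simp add: assoc)
    then obtain v where v: "v \<in> Arr C" "Dom C v = Cod C \<phi>" "Cod C v = Cod C w" "v \<cdot> \<phi> = w \<cdot> b"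
      using epi_kernel_factor[OF e\<phi> k, of "w \<cdot> b"] w w2 B(1-13) \<phi> by auto
    have "(v \<cdot> \<phi>) \<cdot> i = ZeroArr C (Dom C f) (Cod C w)" unfolding v(4) using w w2 B assms
        by (simp add: assoc)
    then have "v \<cdot> f = ZeroArr C (Dom C f) (Cod C w)"
      using \<phi>i v(1-3) \<phi> B(1-13) assms assoc[of i \<phi> v] by simp
    then have "zero_arr (v \<cdot> f)" using assms w by simp
    then have "zero_arr v" using epi_zero_arr[OF f, of v] v \<phi> assms by simp
    then have "zero_arr (v \<cdot> \<phi> \<cdot> j)" using v(1-3) \<phi> B(1-13) by (simp add: zero_arr_comp_right)
    then show "zero_arr w" unfolding v(4) using w w2 B assms by (simp add: assoc)
  qed (use B(1-13) k' \<phi> in simp)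
  show ?thesis
    by (rule that[of ?p ?q]) (use B(1-13) k' \<phi> eq univ monop monoq epip epiq in auto)
qed

text \<open>The pushout is the cokernel of \<open>\<psi> = (f, - m)\<close> into the biproduct. If
  \<open>m\<close> is mono then so is \<open>\<psi>\<close>. An arrow \<open>z\<close> killed by
  \<open>c \<cdot> i\<close> has \<open>i \<cdot> z = \<psi> \<cdot> s\<close>; the second
  coordinate gives \<open>m \<cdot> s = 0\<close>, so \<open>s\<close> and then \<open>z\<close>
  vanish.\<close>

lemma pushout:
  assumes "f \<in> Arr C" "m \<in> Arr C" "Dom C f = Dom C m"
  obtains u v where "u \<in> Arr C" "v \<in> Arr C" "Cod C v = Cod C u" "Dom C u = Cod C f"
      "Dom C v = Cod C m"
    "u \<cdot> f = v \<cdot> m" "mono_arr C m \<Longrightarrow> mono_arr C u" "epi_arr C f \<Longrightarrow> epi_arr C v"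
proof -
  obtain S i j a b where bp: "is_biproduct C (Cod C f) (Cod C m) S i j a b"
    using ex_biproduct[of "Cod C f" "Cod C m"] assms by auto
  note B = biproduct_arr[OF bp]
  define \<psi> where "\<psi> = sub_arr (i \<cdot> f) (j \<cdot> m)"
  have \<psi>: "\<psi> \<in> Arr C" "Dom C \<psi> = Dom C f" "Cod C \<psi> = S"
    unfolding \<psi>_def using B(1-13) assms by simp_all
  have a\<psi>: "a \<cdot> \<psi> = f" and b\<psi>: "b \<cdot> \<psi> = neg_arr m"
    unfolding \<psi>_def using B assms by (simp_all add: comp_sub assoc[symmetric])
  obtain c where c: "is_cokernel C \<psi> c" using obtain_cokernel \<psi> by blast
  note c' = cokernel_arr[OF c]
  let ?u = "c \<cdot> i" and ?v = "c \<cdot> j"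
  have c\<psi>: "c \<cdot> \<psi> = sub_arr (?u \<cdot> f) (?v \<cdot> m)"
    unfolding \<psi>_def using c' \<psi> B(1-13) assms by (simp add: comp_sub assoc)
  have eq: "?u \<cdot> f = ?v \<cdot> m"
    using zero_arr_sub_iff[of "?u \<cdot> f" "?v \<cdot> m"] c\<psi> c' \<psi> B(1-13) assms by simp
  have mono: "mono_arr C ?u" if m: "mono_arr C m"
  proof (rule mono_arrI)
    have neg_m: "mono_arr C (neg_arr m)"
    proof (rule mono_arrI)
      fix h assume "h \<in> Arr C" "Cod C h = Dom C (neg_arr m)" "zero_arr (neg_arr m \<cdot> h)"
      then show "zero_arr h" using assms mono_zero_arr[OF m, of h] by (simp add: neg_comp)
    qed (use assms in simp)
    have m\<psi>: "mono_arr C \<psi>" by (rule mono_comp_right[of b]) (use b\<psi> neg_m B(1-13) \<psi> in auto)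
    fix z assume z: "z \<in> Arr C" "Cod C z = Dom C ?u" "zero_arr (?u \<cdot> z)"
    then have z2: "Cod C z = Cod C f" using B(1-13) c' \<psi> by simp
    have "zero_arr (c \<cdot> (i \<cdot> z))" using z z2 B(1-13) c' \<psi> by (simp add: assoc)
    then have "sub_le C (i \<cdot> z) \<psi>" using mono_cokernel_factor[OF m\<psi> c, of "i \<cdot> z"] z z2 B(1-13) \<psi>
        by simp
    then obtain s where s: "s \<in> Arr C" "Dom C s = Dom C (i \<cdot> z)" "Cod C s = Dom C \<psi>" "\<psi> \<cdot> s = i \<cdot> z"
      by (rule sub_leE)
    have "b \<cdot> (\<psi> \<cdot> s) = ZeroArr C (Dom C z) (Cod C m)" unfolding s(4) using z z2 B assms
        by (simp add: reassoc[OF B(17)])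
    then have "neg_arr m \<cdot> s = ZeroArr C (Dom C z) (Cod C m)"
      using assoc[of s \<psi> b] b\<psi> s(1-3) \<psi> B(1-13) by simp
    then have "zero_arr (neg_arr m \<cdot> s)" using z(1) assms by simp
    then have "zero_arr s" using mono_zero_arr[OF neg_m, of s] s \<psi> assms by simp
    then have "zero_arr (a \<cdot> (\<psi> \<cdot> s))" using s(1-3) \<psi> B(1-13) by (simp add: zero_arr_comp_left)
    then show "zero_arr z" unfolding s(4) using z z2 B assms by (simp add: reassoc[OF B(14)])
  qed (use B(1-13) c' \<psi> in simp)
  have epi: "epi_arr C ?v" if f: "epi_arr C f"
  proof (rule epi_arrI)
    fix w assume w: "w \<in> Arr C" "Dom C w = Cod C ?v" "zero_arr (w \<cdot> ?v)"
    then have w2: "Dom C w = Cod C c" using B(1-13) c' \<psi> by simp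
    have "zero_arr (w \<cdot> ?v \<cdot> m)" by (rule zero_arr_comp_right) (use w w2 B(1-13) c' \<psi> assms in auto)
    then have "zero_arr (w \<cdot> ?u \<cdot> f)"
        using eq w w2 B(1-13) c' \<psi> assms assoc[of m ?v w] assoc[of f ?u w] by simp
    then have wu: "zero_arr (w \<cdot> ?u)" using epi_zero_arr[OF f, of "w \<cdot> ?u"] w w2 B(1-13) c' \<psi>
        by simp
    have "zero_arr (w \<cdot> c)"
      by (rule biproduct_joint_epi[OF bp]) (use wu w w2 B(1-13) c' \<psi> in \<open>auto simp: assoc\<close>)
    then show "zero_arr w" using epi_zero_arr[OF c'(5), of w] w w2 by simp
  qed (use B(1-13) c' \<psi> in simp)
  show ?thesis
    by (rule that[of ?u ?v]) (use B(1-13) c' \<psi> eq mono epi in auto)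
qed

text \<open>The substitute for choosing preimages of elements: \<open>x\<close> may fail to lift
  along \<open>q\<close>, but it lifts after restriction along an epimorphism. Vanishing and
  membership in a subobject can be tested after such a restriction, by \<open>epi_zero_arr\<close>
  and \<open>epi_sub_le\<close>.\<close>

lemma epi_lift:
  assumes "epi_arr C q" "x \<in> Arr C" "Cod C x = Cod C q"
  obtains e y where "epi_arr C e" "Cod C e = Dom C x" "y \<in> Arr C" "Dom C y = Dom C e"
      "Cod C y = Dom C q"
    "q \<cdot> y = x \<cdot> e"
  using pullback[of x q] assms by (metis epi_arr_arr)

text \<open>Membership in \<open>m\<close> means being killed by the cokernel of \<open>m\<close>,
  and there an epimorphism can be cancelled.\<close>

lemma epi_sub_le:
  assumes "epi_arr C e" "mono_arr C m" "x \<in> Arr C" "Dom C x = Cod C e" "Cod C x = Cod C m"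
    "sub_le C (x \<cdot> e) m"
  shows "sub_le C x m"
proof -
  obtain q where q: "is_cokernel C m q" using obtain_cokernel assms(2) by (metis mono_arr_arr)
  note q' = cokernel_arr[OF q]
  have "zero_arr (q \<cdot> (x \<cdot> e))" using mono_cokernel_iff[OF assms(2) q, of "x \<cdot> e"] assms by simp
  then have "zero_arr (q \<cdot> x)" using epi_zero_arr[OF assms(1), of "q \<cdot> x"] assms q'
      by (simp add: assoc)
  then show ?thesis using mono_cokernel_factor[OF assms(2) q] assms by simp
qed

lemma mono_epi_inverse:
  assumes "mono_arr C e" "epi_arr C e"
  obtains s where "s \<in> Arr C" "Dom C s = Cod C e" "Cod C s = Dom C e" "e \<cdot> s = Ident C (Cod C e)"
    "s \<cdot> e = Ident C (Dom C e)"
proof -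
  have "sub_le C (Ident C (Cod C e)) e"
    by (rule epi_sub_le[OF assms(2,1)]) (use assms in \<open>auto intro: sub_le_refl\<close>)
  then obtain s where s: "s \<in> Arr C" "Dom C s = Cod C e" "Cod C s = Dom C e"
      "e \<cdot> s = Ident C (Cod C e)"
    using assms by (auto elim!: sub_leE)
  have "s \<cdot> e = Ident C (Dom C e)"
    by (rule mono_cancel[OF assms(1)]) (use s assms in \<open>auto simp: reassoc[OF s(4)]\<close>)
  then show ?thesis using s that by blast
qed

section \<open>Embeddings of objects, quotients and preimages\<close>

lemma embedsI: "mono_arr C m \<Longrightarrow> Dom C m = X \<Longrightarrow> Cod C m = Y \<Longrightarrow> embeds C X Y"
  by (auto simp: embeds_def)

lemma embedsE:
  assumes "embeds C X Y" obtains m where "mono_arr C m" "Dom C m = X" "Cod C m = Y"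
  using assms by (auto simp: embeds_def)

lemma embeds_trans: "embeds C X Y \<Longrightarrow> embeds C Y Z \<Longrightarrow> embeds C X Z"
  by (metis embedsI embedsE mono_comp arr_Comp(2,3) mono_arr_arr)

lemma mono_sub_le_embeds:
  assumes "mono_arr C k" "sub_le C k m" "m \<in> Arr C" shows "embeds C (Dom C k) (Dom C m)"
proof -
  obtain u where u: "u \<in> Arr C" "Dom C u = Dom C k" "Cod C u = Dom C m" "m \<cdot> u = k"
    using assms(2) by (rule sub_leE)
  have "mono_arr C u" by (rule mono_comp_right[of m]) (use u assms in auto)
  then show ?thesis using u by (auto intro: embedsI)
qed

text \<open>A subobject of \<open>Dom C i\<close> may be divided out before or after including it
  into \<open>Cod C i\<close>. If the induced arrow \<open>w\<close> kills \<open>x\<close>, lift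
  \<open>x\<close> to some \<open>y\<close> into \<open>Dom C i\<close>; then
  \<open>i \<cdot> y\<close> lies in \<open>i \<cdot> n\<close>, so \<open>y\<close> lies in
  \<open>n\<close> and \<open>x\<close> is zero.\<close>

lemma embeds_quotient:
  assumes i: "mono_arr C i" and n: "mono_arr C n" and D: "Dom C i = Cod C n"
    and q': "is_cokernel C n q'" and q: "is_cokernel C (i \<cdot> n) q"
  shows "embeds C (Cod C q') (Cod C q)"
proof -
  note Q' = cokernel_arr[OF q'] and Q = cokernel_arr[OF q]
  have mi: "mono_arr C (i \<cdot> n)" by (rule mono_comp[OF n i D])
  have Dq: "Dom C q = Cod C i" using Q i n D by simp
  have "zero_arr ((q \<cdot> i) \<cdot> n)" using Q i n D Dq by (simp add: assoc)
  then obtain w where w: "w \<in> Arr C" "Dom C w = Cod C q'" "Cod C w = Cod C q" "w \<cdot> q' = q \<cdot> i"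
    using cokernel_factor[OF q', of "q \<cdot> i"] Q i D Dq by auto
  have "mono_arr C w"
  proof (rule mono_arrI)
    fix x assume x: "x \<in> Arr C" "Cod C x = Dom C w" "zero_arr (w \<cdot> x)"
    obtain e y where e: "epi_arr C e" "Cod C e = Dom C x" "y \<in> Arr C" "Dom C y = Dom C e"
        "Cod C y = Dom C q'"
        "q' \<cdot> y = x \<cdot> e"
      by (rule epi_lift[of q' x]) (use Q' x w in auto)
    have "zero_arr ((w \<cdot> x) \<cdot> e)" by (rule zero_arr_comp_right) (use x e w in auto)
    then have *: "zero_arr (w \<cdot> (q' \<cdot> y))" using x e w by (simp add: assoc)
    have "zero_arr (q \<cdot> (i \<cdot> y))"
      using * assoc[of y q' w] assoc[of y i q] e(1-5) w Q Q' i D Dq by simp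
    then have "sub_le C (i \<cdot> y) (i \<cdot> n)"
      using mono_cokernel_factor[OF mi q, of "i \<cdot> y"] e Q' i n D by simp
    then obtain z where z: "z \<in> Arr C" "Dom C z = Dom C y" "Cod C z = Dom C n" "(i \<cdot> n) \<cdot> z = i \<cdot> y"
      using e Q' i n D by (auto elim!: sub_leE)
    have "n \<cdot> z = y" by (rule mono_cancel[OF i]) (use z e Q' i n D in \<open>auto simp: assoc\<close>)
    then have "zero_arr (q' \<cdot> y)" using mono_cokernel_iff[OF n q', of y] z e Q' n
        by (auto intro: sub_leI)
    then show "zero_arr x" using epi_zero_arr[OF e(1), of x] e x by simp
  qed (rule w)
  then show ?thesis using w by (auto intro: embedsI)
qed

text \<open>The pullback of a subobject. The last clause says that \<open>a\<close> is the largest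
  subobject that \<open>e\<close> maps into \<open>m\<close>.\<close>

lemma preimage:
  assumes "e \<in> Arr C" "mono_arr C m" "Cod C e = Cod C m"
  obtains a r where "mono_arr C a" "Cod C a = Dom C e" "r \<in> Arr C" "Dom C r = Dom C a"
      "Cod C r = Dom C m"
    "e \<cdot> a = m \<cdot> r" "epi_arr C e \<longrightarrow> epi_arr C r"
    "\<forall>h. h \<in> Arr C \<longrightarrow> Cod C h = Dom C e \<longrightarrow> sub_le C (e \<cdot> h) m \<longrightarrow> sub_le C h a"
proof -
  have m: "m \<in> Arr C" using assms by simp
  obtain a r where *: "a \<in> Arr C" "r \<in> Arr C" "Dom C r = Dom C a" "Cod C a = Dom C e"
      "Cod C r = Dom C m"
    "e \<cdot> a = m \<cdot> r"
    "\<forall>x y. x \<in> Arr C \<longrightarrow> y \<in> Arr C \<longrightarrow> Dom C x = Dom C y \<longrightarrow> Cod C x = Dom C e \<longrightarrow> Cod C y = Dom C m \<longrightarrow>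
       e \<cdot> x = m \<cdot> y \<longrightarrow> (\<exists>u. u \<in> Arr C \<and> Dom C u = Dom C x \<and> Cod C u = Dom C a \<and> a \<cdot> u = x \<and>
           r \<cdot> u = y)"
    "mono_arr C m \<longrightarrow> mono_arr C a" "mono_arr C e \<longrightarrow> mono_arr C r"
    "epi_arr C m \<longrightarrow> epi_arr C a" "epi_arr C e \<longrightarrow> epi_arr C r"
    using pullback[OF assms(1) m assms(3)] .
  have "sub_le C h a" if h: "h \<in> Arr C" "Cod C h = Dom C e" "sub_le C (e \<cdot> h) m" for h
  proof -
    obtain u where u: "u \<in> Arr C" "Dom C u = Dom C h" "Cod C u = Dom C m" "m \<cdot> u = e \<cdot> h"
      using h assms by (auto elim!: sub_leE)
    then obtain v where "v \<in> Arr C" "Cod C v = Dom C a" "a \<cdot> v = h"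
      using *(7)[rule_format, of h u] h by auto
    then show ?thesis using * by (auto intro: sub_leI)
  qed
  then show ?thesis using that[of a r] * assms by auto
qed

lemma zero_sub_le:
  assumes "zero_arr x" "m \<in> Arr C" "Cod C x = Cod C m"
  shows "sub_le C x m"
proof (rule sub_leI)
  have x: "x \<in> Arr C" using assms by (simp add: zero_arr_def)
  show "m \<cdot> ZeroArr C (Dom C x) (Dom C m) = x"
    using assms x by (simp add: zero_arr_def)
  show "ZeroArr C (Dom C x) (Dom C m) \<in> Arr C" "Cod C (ZeroArr C (Dom C x) (Dom C m)) = Dom C m"
    using assms x by simp_all
qed (rule assms)

lemma sub_le_mono_cancel:
  assumes "mono_arr C g" "f \<in> Arr C" "m \<in> Arr C" "Cod C f = Dom C g" "Cod C m = Dom C g"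
      "sub_le C (g \<cdot> f) (g \<cdot> m)"
  shows "sub_le C f m"
proof -
  have g: "g \<in> Arr C" using assms by simp
  obtain u where u: "u \<in> Arr C" "Dom C u = Dom C f" "Cod C u = Dom C m" "(g \<cdot> m) \<cdot> u = g \<cdot> f"
    using assms g by (auto elim!: sub_leE)
  have "m \<cdot> u = f" by (rule mono_cancel[OF assms(1)]) (use u assms g in \<open>auto simp: assoc\<close>)
  then show ?thesis using u assms by (auto intro: sub_leI)
qed

lemma cokernelI:
  assumes "epi_arr C q" "f \<in> Arr C" "Dom C q = Cod C f" "zero_arr (q \<cdot> f)"
    "\<And>h. h \<in> Arr C \<Longrightarrow> Dom C h = Cod C f \<Longrightarrow> zero_arr (h \<cdot> f) \<Longrightarrow>
       \<exists>u. u \<in> Arr C \<and> Dom C u = Cod C q \<and> Cod C u = Cod C h \<and> u \<cdot> q = h"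
  shows "is_cokernel C f q"
  unfolding is_cokernel_def
proof (intro conjI allI ballI impI)
  have q: "q \<in> Arr C" using assms by simp
  show "q \<cdot> f = ZeroArr C (Dom C f) (Cod C q)" using assms q by (simp add: zero_arr_def)
  fix Y h assume h: "h \<in> Hom C (Cod C f) Y" "h \<cdot> f = ZeroArr C (Dom C f) Y"
  then have "zero_arr (h \<cdot> f)" using assms(2) Cod_Obj[of h] by (auto simp del: Cod_Obj)
  then obtain u where u: "u \<in> Hom C (Cod C q) Y" "u \<cdot> q = h"
    using assms(5)[of h] h by auto
  show "\<exists>!u. u \<in> Hom C (Cod C q) Y \<and> u \<cdot> q = h"
    by (rule ex1I[of _ u]) (use u in \<open>auto intro!: epi_cancel[OF assms(1)]\<close>)
qed (use assms in auto)

section \<open>Essential monomorphisms and uniform objects\<close>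

text \<open>Images translate between nonzero subobjects and nonzero arrows. In the arrow form,
  essential means that every nonzero arrow has a nonzero restriction that factors through
  \<open>e\<close>, and no intersection has to be formed.\<close>

lemma essential_mono_iff:
  "essential_mono C e \<longleftrightarrow> mono_arr C e \<and> (\<forall>x. x \<in> Arr C \<longrightarrow> Cod C x = Cod C e \<longrightarrow> \<not> zero_arr x \<longrightarrow>
     (\<exists>y. y \<in> Arr C \<and> Cod C y = Dom C x \<and> \<not> zero_arr (x \<cdot> y) \<and> sub_le C (x \<cdot> y) e))"
  (is "?L \<longleftrightarrow> ?R")
proof
  assume L: ?L
  then have e: "mono_arr C e" by (simp add: essential_mono_def)
  have "\<exists>y. y \<in> Arr C \<and> Cod C y = Dom C x \<and> \<not> zero_arr (x \<cdot> y) \<and> sub_le C (x \<cdot> y) e"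
    if x: "x \<in> Arr C" "Cod C x = Cod C e" "\<not> zero_arr x" for x
  proof -
    obtain m f where m: "mono_arr C m" "epi_arr C f" "Dom C m = Cod C f" "Cod C m = Cod C x"
      "Dom C f = Dom C x" "m \<cdot> f = x"
      using image_factorization[OF x(1)] .
    have "\<not> zero_arr m"
      using zero_arr_comp_right[of m f] m x by (metis epi_arr_arr mono_arr_arr)
    then have "nonzero_obj C (Dom C m)" using nonzero_mono_iff[OF m(1)] by simp
    then obtain k where k: "mono_arr C k" "Cod C k = Cod C e" "nonzero_obj C (Dom C k)"
      "sub_le C k m" "sub_le C k e"
      using L m x unfolding essential_mono_def by (metis (no_types, lifting))
    obtain u where u: "u \<in> Arr C" "Dom C u = Dom C k" "Cod C u = Dom C m" "m \<cdot> u = k"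
      using k(4) by (rule sub_leE)
    obtain g y where g: "epi_arr C g" "Cod C g = Dom C u" "y \<in> Arr C" "Dom C y = Dom C g"
        "Cod C y = Dom C f"
      "f \<cdot> y = u \<cdot> g"
      by (rule epi_lift[of f u]) (use m u in auto)
    have xy: "x \<cdot> y = k \<cdot> g"
    proof -
      have "x \<cdot> y = m \<cdot> (f \<cdot> y)" using m(1-5) g(1-5) assoc[of y f m] m(6) by simp
      also have "\<dots> = k \<cdot> g" unfolding g(6) using reassoc[OF u(4), of g] g u m by simp
      finally show ?thesis .
    qed
    have "\<not> zero_arr k" using nonzero_mono_iff k by simp
    then have "\<not> zero_arr (x \<cdot> y)" unfolding xy using epi_zero_arr[OF g(1), of k] k g u by simp
    moreover have "sub_le C (x \<cdot> y) e" unfolding xy by (rule sub_le_comp) (use k g u e in auto)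
    ultimately show ?thesis using g m x by auto
  qed
  then show ?R using e by blast
next
  assume R: ?R
  show ?L unfolding essential_mono_def
  proof (intro conjI allI impI)
    fix m assume m: "mono_arr C m \<and> Cod C m = Cod C e \<and> nonzero_obj C (Dom C m)"
    then have "\<not> zero_arr m" using nonzero_mono_iff by blast
    then obtain y where y: "y \<in> Arr C" "Cod C y = Dom C m" "\<not> zero_arr (m \<cdot> y)" "sub_le C (m \<cdot> y) e"
      using R m by (meson mono_arr_arr)
    have my: "m \<cdot> y \<in> Arr C" using y m by simp
    obtain k f where k: "mono_arr C k" "epi_arr C f" "Dom C k = Cod C f" "Cod C k = Cod C (m \<cdot> y)"
      "Dom C f = Dom C (m \<cdot> y)" "k \<cdot> f = m \<cdot> y"
      using image_factorization[OF my] .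
    have ck: "Cod C k = Cod C m" using k y m by simp
    have "sub_le C k m"
      by (rule epi_sub_le[of f]) (use k ck m y in \<open>auto intro: sub_leI\<close>)
    moreover have "sub_le C k e"
      by (rule epi_sub_le[of f]) (use k ck m y R in auto)
    moreover have "\<not> zero_arr k"
      using zero_arr_comp_right[of k f] k y(3) by (metis epi_arr_arr mono_arr_arr)
    ultimately show "\<exists>k. mono_arr C k \<and> Cod C k = Cod C e \<and> nonzero_obj C (Dom C k) \<and> sub_le C k m \<and>
        sub_le C k e"
      using k ck m nonzero_mono_iff by metis
  qed (use R in auto)
qed

lemma essential_mono_mono: "essential_mono C e \<Longrightarrow> mono_arr C e"
  by (simp add: essential_mono_def)

lemma essential_monoE:
  assumes "essential_mono C e" "x \<in> Arr C" "Cod C x = Cod C e" "\<not> zero_arr x"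
  obtains y z where "y \<in> Arr C" "Cod C y = Dom C x" "\<not> zero_arr (x \<cdot> y)" "z \<in> Arr C"
      "Dom C z = Dom C y"
    "Cod C z = Dom C e" "e \<cdot> z = x \<cdot> y"
proof -
  obtain y where y: "y \<in> Arr C" "Cod C y = Dom C x" "\<not> zero_arr (x \<cdot> y)" "sub_le C (x \<cdot> y) e"
    using assms unfolding essential_mono_iff by blast
  show ?thesis using y(4) by (rule sub_leE) (use y assms that in auto)
qed

lemma essential_monoI:
  assumes "mono_arr C e" "\<And>x. x \<in> Arr C \<Longrightarrow> Cod C x = Cod C e \<Longrightarrow> \<not> zero_arr x \<Longrightarrow>
    \<exists>y z. y \<in> Arr C \<and> Cod C y = Dom C x \<and> \<not> zero_arr (x \<cdot> y) \<and> z \<in> Arr C \<and> Cod C z = Dom C e \<and>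
        e \<cdot> z = x \<cdot> y"
  shows "essential_mono C e"
  unfolding essential_mono_iff using assms mono_arr_arr[OF assms(1)] by (metis sub_leI)

text \<open>A nonzero \<open>x\<close> killed by \<open>g\<close> would have a nonzero restriction
  through \<open>e\<close>, which \<open>g \<cdot> e\<close> cannot kill.\<close>

lemma essential_extend_mono:
  assumes e: "essential_mono C e" and g: "g \<in> Arr C" "Dom C g = Cod C e" "mono_arr C (g \<cdot> e)"
  shows "mono_arr C g"
proof (rule mono_arrI)
  have e': "e \<in> Arr C" using essential_mono_mono[OF e] by simp
  fix x assume x: "x \<in> Arr C" "Cod C x = Dom C g" "zero_arr (g \<cdot> x)"
  show "zero_arr x"
  proof (rule ccontr)
    assume "\<not> zero_arr x"
    then obtain y z where y: "y \<in> Arr C" "Cod C y = Dom C x" "\<not> zero_arr (x \<cdot> y)" "z \<in> Arr C"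
      "Dom C z = Dom C y" "Cod C z = Dom C e" "e \<cdot> z = x \<cdot> y"
      using essential_monoE[OF e, of x] x g by metis
    have "zero_arr ((g \<cdot> x) \<cdot> y)" by (rule zero_arr_comp_right) (use x y g in auto)
    moreover have "(g \<cdot> x) \<cdot> y = (g \<cdot> e) \<cdot> z"
      using assoc[of y x g] assoc[of z e g] x y g e' by simp
    ultimately have "zero_arr z" using mono_zero_arr[OF g(3), of z] y g e' by simp
    then have "zero_arr (e \<cdot> z)" by (rule zero_arr_comp_left) (use y e' in auto)
    then show False using y by simp
  qed
qed (rule g)

lemma essential_comp:
  assumes e: "essential_mono C e" and f: "essential_mono C f" and D: "Dom C f = Cod C e"
  shows "essential_mono C (f \<cdot> e)"
proof (rule essential_monoI)
  note me = essential_mono_mono[OF e] and mf = essential_mono_mono[OF f]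
  show "mono_arr C (f \<cdot> e)" by (rule mono_comp) (use me mf D in auto)
  fix x assume x: "x \<in> Arr C" "Cod C x = Cod C (f \<cdot> e)" "\<not> zero_arr x"
  then have cx: "Cod C x = Cod C f" using me mf D by simp
  obtain y z where y: "y \<in> Arr C" "Cod C y = Dom C x" "\<not> zero_arr (x \<cdot> y)" "z \<in> Arr C"
      "Dom C z = Dom C y" "Cod C z = Dom C f" "f \<cdot> z = x \<cdot> y"
    using essential_monoE[OF f x(1) cx x(3)] .
  have nz: "\<not> zero_arr z" using y mf mono_zero_arr[OF mf, of z] by simp
  obtain y' z' where y': "y' \<in> Arr C" "Cod C y' = Dom C z" "\<not> zero_arr (z \<cdot> y')" "z' \<in> Arr C"
      "Dom C z' = Dom C y'" "Cod C z' = Dom C e" "e \<cdot> z' = z \<cdot> y'"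
    by (rule essential_monoE[OF e, of z]) (use y D nz in auto)
  have 1: "x \<cdot> (y \<cdot> y') = f \<cdot> (z \<cdot> y')"
    using assoc[of y' y x] assoc[of y' z f] x y y' mf by simp
  have "\<not> zero_arr (x \<cdot> (y \<cdot> y'))"
    unfolding 1 using mono_zero_arr[OF mf, of "z \<cdot> y'"] y y' by simp
  moreover have "(f \<cdot> e) \<cdot> z' = x \<cdot> (y \<cdot> y')"
    unfolding 1 y'(7)[symmetric] by (rule assoc) (use y' me mf D in auto)
  ultimately show "\<exists>y z. y \<in> Arr C \<and> Cod C y = Dom C x \<and> \<not> zero_arr (x \<cdot> y) \<and> z \<in> Arr C \<and>
      Cod C z = Dom C (f \<cdot> e) \<and> (f \<cdot> e) \<cdot> z = x \<cdot> y"
    using y y' me mf D by (intro exI[of _ "y \<cdot> y'"] exI[of _ z']) simp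
qed

lemma essential_comp_left:
  assumes "essential_mono C (g \<cdot> f)" "mono_arr C g" "f \<in> Arr C" "Dom C g = Cod C f"
  shows "essential_mono C g"
proof (rule essential_monoI)
  have g: "g \<in> Arr C" using assms by simp
  fix x assume x: "x \<in> Arr C" "Cod C x = Cod C g" "\<not> zero_arr x"
  have c: "Cod C x = Cod C (g \<cdot> f)" using x g assms by simp
  obtain y z where y: "y \<in> Arr C" "Cod C y = Dom C x" "\<not> zero_arr (x \<cdot> y)" "z \<in> Arr C"
      "Dom C z = Dom C y"
        "Cod C z = Dom C (g \<cdot> f)" "(g \<cdot> f) \<cdot> z = x \<cdot> y"
    using essential_monoE[OF assms(1) x(1) c x(3)] .
  have "g \<cdot> (f \<cdot> z) = x \<cdot> y" using assoc[of z f g] y(4,6,7) assms(3,4) g by simp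
  then show "\<exists>y z. y \<in> Arr C \<and> Cod C y = Dom C x \<and> \<not> zero_arr (x \<cdot> y) \<and> z \<in> Arr C \<and>
      Cod C z = Dom C g \<and> g \<cdot> z = x \<cdot> y"
    using y(1-4,6) assms(3,4) g by (intro exI[of _ y] exI[of _ "f \<cdot> z"]) simp
qed (rule assms)

lemma essential_Ident [simp]: "X \<in> Obj C \<Longrightarrow> essential_mono C (Ident C X)"
proof (rule essential_monoI)
  fix x assume "X \<in> Obj C" "x \<in> Arr C" "Cod C x = Cod C (Ident C X)" "\<not> zero_arr x"
  then show "\<exists>y z. y \<in> Arr C \<and> Cod C y = Dom C x \<and> \<not> zero_arr (x \<cdot> y) \<and> z \<in> Arr C \<and>
      Cod C z = Dom C (Ident C X) \<and> Ident C X \<cdot> z = x \<cdot> y"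
    by (intro exI[of _ "Ident C (Dom C x)"] exI[of _ x]) simp
qed auto

text \<open>Uniformity says that any two nonzero subobjects meet nontrivially. It is phrased with
  arbitrary nonzero arrows, which can be used without passing to images.\<close>

definition uniform_obj :: "'a \<Rightarrow> bool" where
  "uniform_obj X \<longleftrightarrow> nonzero_obj C X \<and> (\<forall>x y. x \<in> Arr C \<longrightarrow> y \<in> Arr C \<longrightarrow> Cod C x = X \<longrightarrow> Cod C y = X \<longrightarrow>
     \<not> zero_arr x \<longrightarrow> \<not> zero_arr y \<longrightarrow>
     (\<exists>u v. u \<in> Arr C \<and> v \<in> Arr C \<and> Dom C v = Dom C u \<and> Cod C u = Dom C x \<and> Cod C v = Dom C y \<and>
        x \<cdot> u = y \<cdot> v \<and> \<not> zero_arr (x \<cdot> u)))"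

lemma uniformE:
  assumes "uniform_obj X" "x \<in> Arr C" "y \<in> Arr C" "Cod C x = X" "Cod C y = X" "\<not> zero_arr x"
      "\<not> zero_arr y"
  obtains u v where "u \<in> Arr C" "v \<in> Arr C" "Dom C v = Dom C u" "Cod C u = Dom C x"
      "Cod C v = Dom C y"
        "x \<cdot> u = y \<cdot> v" "\<not> zero_arr (x \<cdot> u)"
  using assms unfolding uniform_obj_def by blast

lemma uniform_essential:
  assumes "uniform_obj X" "mono_arr C e" "Cod C e = X" "\<not> zero_arr e"
  shows "essential_mono C e"
proof (rule essential_monoI)
  fix x assume x: "x \<in> Arr C" "Cod C x = Cod C e" "\<not> zero_arr x"
  show "\<exists>y z. y \<in> Arr C \<and> Cod C y = Dom C x \<and> \<not> zero_arr (x \<cdot> y) \<and> z \<in> Arr C \<and> Cod C z = Dom C e \<and>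
      e \<cdot> z = x \<cdot> y"
    using uniformE[OF assms(1), of x e] x assms by (metis mono_arr_arr)
qed (rule assms)

text \<open>Two nonzero arrows into the extension have nonzero restrictions that come from
  \<open>Dom C e\<close>, where uniformity applies.\<close>

lemma essential_uniform:
  assumes e: "essential_mono C e" and u: "uniform_obj (Dom C e)"
  shows "uniform_obj (Cod C e)"
  unfolding uniform_obj_def
proof (intro conjI allI impI)
  note me = essential_mono_mono[OF e]
  have nz: "\<not> zero_arr e" using u nonzero_mono_iff[OF me] by (simp add: uniform_obj_def)
  have "\<not> zero_obj C (Cod C e)" using nz zero_obj_Cod[of e] me by auto
  then show "nonzero_obj C (Cod C e)" using me by (simp add: nonzero_obj_def)
  fix x y assume x: "x \<in> Arr C" "Cod C x = Cod C e" "\<not> zero_arr x"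
      and y: "y \<in> Arr C" "Cod C y = Cod C e" "\<not> zero_arr y"
  obtain a b where a: "a \<in> Arr C" "Cod C a = Dom C x" "\<not> zero_arr (x \<cdot> a)" "b \<in> Arr C"
      "Dom C b = Dom C a" "Cod C b = Dom C e" "e \<cdot> b = x \<cdot> a"
    using essential_monoE[OF e x] .
  obtain c d where c: "c \<in> Arr C" "Cod C c = Dom C y" "\<not> zero_arr (y \<cdot> c)" "d \<in> Arr C"
      "Dom C d = Dom C c" "Cod C d = Dom C e" "e \<cdot> d = y \<cdot> c"
    using essential_monoE[OF e y] .
  have "\<not> zero_arr b" "\<not> zero_arr d" using mono_zero_arr[OF me, of b] mono_zero_arr[OF me, of d] a c
      by auto
  then obtain s t where s: "s \<in> Arr C" "t \<in> Arr C" "Dom C t = Dom C s" "Cod C s = Dom C b"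
      "Cod C t = Dom C d"
        "b \<cdot> s = d \<cdot> t" "\<not> zero_arr (b \<cdot> s)"
    using uniformE[OF u a(4) c(4) a(6) c(6)] by blast
  have 1: "x \<cdot> (a \<cdot> s) = e \<cdot> (b \<cdot> s)"
    using assoc[of s a x] assoc[of s b e] a s x me by simp
  have 2: "y \<cdot> (c \<cdot> t) = e \<cdot> (d \<cdot> t)"
    using assoc[of t c y] assoc[of t d e] c s y me by simp
  have 3: "\<not> zero_arr (x \<cdot> (a \<cdot> s))"
    unfolding 1 using mono_zero_arr[OF me, of "b \<cdot> s"] a(1-6) s(1-5,7) by simp
  show "\<exists>u v. u \<in> Arr C \<and> v \<in> Arr C \<and> Dom C v = Dom C u \<and> Cod C u = Dom C x \<and> Cod C v = Dom C y \<and>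
        x \<cdot> u = y \<cdot> v \<and> \<not> zero_arr (x \<cdot> u)"
    using 1 2 3 a c s by (intro exI[of _ "a \<cdot> s"] exI[of _ "c \<cdot> t"]) simp
qed

text \<open>If the images \<open>m\<close> of \<open>x\<close> and \<open>n\<close> of
  \<open>y\<close> met in zero, then \<open>Dom C n\<close> would embed both in \<open>H\<close> and
  in the quotient of \<open>H\<close> by \<open>m\<close>, which monoformness forbids.\<close>

lemma monoform_uniform:
  assumes H: "monoform C H"
  shows "uniform_obj H"
  unfolding uniform_obj_def
proof (intro conjI allI impI)
  show "nonzero_obj C H" using H by (simp add: monoform_def)
  fix x y assume x: "x \<in> Arr C" "Cod C x = H" "\<not> zero_arr x"
      and y: "y \<in> Arr C" "Cod C y = H" "\<not> zero_arr y"
  obtain m e where m: "mono_arr C m" "epi_arr C e" "Dom C m = Cod C e" "Cod C m = Cod C x"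
      "Dom C e = Dom C x" "m \<cdot> e = x"
    using image_factorization[OF x(1)] .
  obtain n f where n: "mono_arr C n" "epi_arr C f" "Dom C n = Cod C f" "Cod C n = Cod C y"
      "Dom C f = Dom C y" "n \<cdot> f = y"
    using image_factorization[OF y(1)] .
  have arr: "m \<in> Arr C" "n \<in> Arr C" "e \<in> Arr C" "f \<in> Arr C" using m n by simp_all
  have nm: "\<not> zero_arr m" using zero_arr_comp_right[of m e] m x by (metis epi_arr_arr mono_arr_arr)
  have nn: "\<not> zero_arr n" using zero_arr_comp_right[of n f] n y by (metis epi_arr_arr mono_arr_arr)
  obtain q where q: "is_cokernel C m q" using obtain_cokernel m by (metis mono_arr_arr)
  note q' = cokernel_arr[OF q]
  have qn: "q \<cdot> n \<in> Arr C" "Dom C (q \<cdot> n) = Dom C n"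
    using q' arr m(4) n(4) x(2) y(2) by simp_all
  have "\<not> mono_arr C (q \<cdot> n)"
  proof
    assume "mono_arr C (q \<cdot> n)"
    then have "embeds C (Dom C n) (Cod C q)" using q' m n x y by (auto intro: embedsI)
    moreover have "embeds C (Dom C n) H" using n y by (auto intro: embedsI)
    ultimately show False using H m q x y n nm nn nonzero_mono_iff unfolding monoform_def by metis
  qed
  then obtain z where z: "z \<in> Arr C" "Cod C z = Dom C n" "zero_arr ((q \<cdot> n) \<cdot> z)" "\<not> zero_arr z"
    using mono_arrI[OF qn(1)] qn(2) by metis
  have "zero_arr (q \<cdot> (n \<cdot> z))" using z q' m n x y by (simp add: assoc)
  then have "sub_le C (n \<cdot> z) m" using mono_cokernel_factor[OF m(1) q, of "n \<cdot> z"] z n m x y by simp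
  then obtain w where w: "w \<in> Arr C" "Dom C w = Dom C z" "Cod C w = Dom C m" "m \<cdot> w = n \<cdot> z"
    using z n by (auto elim!: sub_leE)
  \<comment> \<open>The arrow into both images does not come with lifts to \<open>Dom C x\<close>
    and \<open>Dom C y\<close>. It gets them after restriction along \<open>g\<close> and then along
    \<open>h\<close>.\<close>
  obtain g a where g: "epi_arr C g" "Cod C g = Dom C w" "a \<in> Arr C" "Dom C a = Dom C g"
      "Cod C a = Dom C e" "e \<cdot> a = w \<cdot> g"
    by (rule epi_lift[of e w]) (use m w in auto)
  have zg: "z \<cdot> g \<in> Arr C" "Cod C (z \<cdot> g) = Cod C f" "Dom C (z \<cdot> g) = Dom C g" using z g w n by auto
  obtain h b where h: "epi_arr C h" "Cod C h = Dom C (z \<cdot> g)" "b \<in> Arr C" "Dom C b = Dom C h"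
      "Cod C b = Dom C f" "f \<cdot> b = (z \<cdot> g) \<cdot> h"
    using epi_lift[OF n(2) zg(1,2)] .
  have ch: "Cod C h = Dom C g" using h zg by simp
  have arr2: "g \<in> Arr C" "h \<in> Arr C" using g h by simp_all
  have "x \<cdot> (a \<cdot> h) = m \<cdot> (e \<cdot> a) \<cdot> h"
    unfolding m(6)[symmetric] using g(1-5) ch h(1) m(1-5) arr arr2 by (simp add: assoc)
  also have "\<dots> = (m \<cdot> w) \<cdot> g \<cdot> h" unfolding g(6) using g(1-5) ch h(1) m(1-5) w(1-3) arr arr2
      by (simp add: assoc)
  also have "\<dots> = n \<cdot> (f \<cdot> b)" unfolding w(4) h(6) using z(1,2) g(1-5) ch h(1) w(1-3) n(1-5) arr arr2
      by (simp add: assoc)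
  also have "\<dots> = y \<cdot> b" unfolding n(6)[symmetric] using n(1-5) h(1-5) arr arr2 by (simp add: assoc)
  finally have xy: "x \<cdot> (a \<cdot> h) = y \<cdot> b" .
  have "y \<cdot> b = n \<cdot> (z \<cdot> (g \<cdot> h))"
    unfolding n(6)[symmetric]
        using assoc[of b f n] h(6) n(1-5) h(1-5) zg z(1,2) g(1-5) w(1-3) ch arr arr2
        by (simp add: assoc)
  moreover have "\<not> zero_arr (z \<cdot> (g \<cdot> h))"
    using epi_zero_arr[OF epi_comp[OF h(1) g(1)], of z] z g ch w arr2 by simp
  ultimately have nz: "\<not> zero_arr (y \<cdot> b)"
    using mono_zero_arr[OF n(1), of "z \<cdot> (g \<cdot> h)"] z g ch w arr2 by simp
  show "\<exists>u v. u \<in> Arr C \<and> v \<in> Arr C \<and> Dom C v = Dom C u \<and> Cod C u = Dom C x \<and> Cod C v = Dom C y \<and>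
        x \<cdot> u = y \<cdot> v \<and> \<not> zero_arr (x \<cdot> u)"
    using xy nz g h ch m n arr2 by (intro exI[of _ "a \<cdot> h"] exI[of _ b]) simp
qed

text \<open>A quotient of the subobject embeds in a quotient of \<open>H\<close> by
  \<open>embeds_quotient\<close>, so an object violating the condition for the subobject violates it
  for \<open>H\<close>.\<close>

lemma monoform_sub:
  assumes H: "monoform C H" and i: "mono_arr C i" "Cod C i = H" "\<not> zero_arr i"
  shows "monoform C (Dom C i)"
  unfolding monoform_def
proof (intro conjI allI impI notI)
  show "nonzero_obj C (Dom C i)" using nonzero_mono_iff i by simp
  fix m q assume mq: "mono_arr C m \<and> Cod C m = Dom C i \<and> nonzero_obj C (Dom C m) \<and>
      is_cokernel C m q"
    and "\<exists>L. nonzero_obj C L \<and> embeds C L (Dom C i) \<and> embeds C L (Cod C q)"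
  then obtain L where L: "nonzero_obj C L" "embeds C L (Dom C i)" "embeds C L (Cod C q)" by blast
  have im: "mono_arr C (i \<cdot> m)" using mq i by (simp add: mono_comp)
  obtain q' where q': "is_cokernel C (i \<cdot> m) q'" using obtain_cokernel im by (metis mono_arr_arr)
  have "embeds C L (Cod C q')"
    by (rule embeds_trans[OF L(3)], rule embeds_quotient[of i m]) (use mq q' i in auto)
  moreover have "embeds C L H" using L(2) embedsI[OF i(1)] i by (meson embeds_trans)
  moreover have "Cod C (i \<cdot> m) = H" "Dom C (i \<cdot> m) = Dom C m" using mq i by auto
  ultimately show False using H L im q' mq unfolding monoform_def by metis
qed

section \<open>Noetherian objects\<close>

lemma noetherian_maximal:
  assumes X: "noetherian_obj C X" and S: "\<And>m. m \<in> S \<Longrightarrow> mono_arr C m \<and> Cod C m = X" "S \<noteq> {}"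
  obtains m where "m \<in> S" "\<And>n. n \<in> S \<Longrightarrow> sub_le C m n \<Longrightarrow> sub_le C n m"
proof (rule ccontr)
  assume "\<not> thesis"
  then have "\<forall>m\<in>S. \<exists>n\<in>S. sub_le C m n \<and> \<not> sub_le C n m" using that by blast
  then obtain f where f: "\<And>m. m \<in> S \<Longrightarrow> f m \<in> S \<and> sub_le C m (f m) \<and> \<not> sub_le C (f m) m" by metis
  obtain m0 where m0: "m0 \<in> S" using S by blast
  define s where "s n = (f ^^ n) m0" for n
  have s: "s n \<in> S" for n by (induction n) (use m0 f in \<open>auto simp: s_def\<close>)
  have "sub_le C (s n) (s (Suc n)) \<and> \<not> sub_le C (s (Suc n)) (s n)" for n
    using f[OF s[of n]] by (simp add: s_def)
  moreover have "mono_arr C (s n) \<and> Cod C (s n) = X" for n using S s by blast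
  ultimately show False using X unfolding noetherian_obj_def by blast
qed

lemma noetherian_sub:
  assumes X: "noetherian_obj C (Cod C i)" and i: "mono_arr C i"
  shows "noetherian_obj C (Dom C i)"
  unfolding noetherian_obj_def
proof (intro conjI allI impI)
  fix m :: "nat \<Rightarrow> 'b"
  assume *: "\<forall>n. mono_arr C (m n) \<and> Cod C (m n) = Dom C i \<and> sub_le C (m n) (m (Suc n))"
  have "\<forall>n. mono_arr C (i \<cdot> m n) \<and> Cod C (i \<cdot> m n) = Cod C i \<and> sub_le C (i \<cdot> m n) (i \<cdot> m (Suc n))"
    using * i by (auto intro: mono_comp sub_le_comp_left)
  then obtain N where "\<forall>n\<ge>N. sub_le C (i \<cdot> m (Suc n)) (i \<cdot> m n)"
    using X[unfolded noetherian_obj_def, THEN conjunct2, rule_format, of "\<lambda>n. i \<cdot> m n"] by blast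
  then show "\<exists>N. \<forall>n\<ge>N. sub_le C (m (Suc n)) (m n)"
    using sub_le_mono_cancel[OF i] * by (intro exI[of _ N]) auto
qed (use i in auto)

text \<open>Preimages along \<open>e\<close> turn an ascending chain into one of subobjects of
  \<open>Dom C e\<close>. Each preimage covers its subobject, since \<open>e\<close> is epi, so
  stationarity descends by \<open>epi_sub_le\<close>.\<close>

lemma noetherian_quotient:
  assumes X: "noetherian_obj C (Dom C e)" and e: "epi_arr C e"
  shows "noetherian_obj C (Cod C e)"
  unfolding noetherian_obj_def
proof (intro conjI allI impI)
  fix m :: "nat \<Rightarrow> 'b"
  assume *: "\<forall>n. mono_arr C (m n) \<and> Cod C (m n) = Cod C e \<and> sub_le C (m n) (m (Suc n))"
  have "\<exists>a r. mono_arr C a \<and> Cod C a = Dom C e \<and> epi_arr C r \<and> Dom C r = Dom C a \<and>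
      Cod C r = Dom C (m n) \<and>
    e \<cdot> a = m n \<cdot> r \<and> (\<forall>h. h \<in> Arr C \<longrightarrow> Cod C h = Dom C e \<longrightarrow> sub_le C (e \<cdot> h) (m n) \<longrightarrow> sub_le C h a)"
        for n
    using preimage[of e "m n"] e * by (metis epi_arr_arr)
  then obtain a r where a: "\<And>n. mono_arr C (a n)" "\<And>n. Cod C (a n) = Dom C e" "\<And>n. epi_arr C (r n)"
    "\<And>n. Dom C (r n) = Dom C (a n)" "\<And>n. Cod C (r n) = Dom C (m n)" "\<And>n. e \<cdot> a n = m n \<cdot> r n"
    "\<And>n h. h \<in> Arr C \<Longrightarrow> Cod C h = Dom C e \<Longrightarrow> sub_le C (e \<cdot> h) (m n) \<Longrightarrow> sub_le C h (a n)"
    by metis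
  have "sub_le C (a n) (a (Suc n))" for n
  proof (rule a(7))
    show "sub_le C (e \<cdot> a n) (m (Suc n))" unfolding a(6)
      by (rule sub_le_comp) (use a * in auto)
  qed (use a in auto)
  then obtain N where N: "\<forall>n\<ge>N. sub_le C (a (Suc n)) (a n)"
    using X[unfolded noetherian_obj_def, THEN conjunct2, rule_format, of a] a by blast
  have "sub_le C (m (Suc n)) (m n)" if "n \<ge> N" for n
  proof (rule epi_sub_le[OF a(3)[of "Suc n"]])
    have "sub_le C (e \<cdot> a (Suc n)) (e \<cdot> a n)" by (rule sub_le_comp_left) (use N that a e in auto)
    then show "sub_le C (m (Suc n) \<cdot> r (Suc n)) (m n)"
      unfolding a(6) by (rule sub_le_trans) (use a(1-5) * in \<open>auto intro: sub_leI[of "r n"]\<close>)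
  qed (use a * in auto)
  then show "\<exists>N. \<forall>n\<ge>N. sub_le C (m (Suc n)) (m n)" by blast
qed (use e in auto)

text \<open>Take \<open>N\<close> maximal among the subobjects of \<open>X\<close> such that some nonzero \<open>L\<close> embeds both in \<open>X\<close>
  and in \<open>X / N\<close>; such an \<open>L\<close> is monoform.\<close>

lemma noetherian_monoform:
  assumes X: "noetherian_obj C X" "nonzero_obj C X"
  obtains L where "monoform C L" "embeds C L X"
proof -
  define S where "S = {n. mono_arr C n \<and> Cod C n = X \<and> (\<exists>q L. is_cokernel C n q \<and> nonzero_obj C L \<and>
     embeds C L X \<and> embeds C L (Cod C q))}"
  have XO: "X \<in> Obj C" using X by (simp add: nonzero_obj_def)
  obtain Z where Z: "zero_obj C Z" using ex_zero_obj by blast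
  have ZO: "Z \<in> Obj C" using Z by (simp add: zero_obj_def)
  \<comment> \<open>The zero subobject belongs to \<open>S\<close>, with \<open>L = X\<close>,
    because dividing by it leaves \<open>X\<close> unchanged.\<close>
  let ?z = "ZeroArr C Z X"
  have "is_cokernel C ?z (Ident C X)"
    by (rule cokernelI) (use XO ZO in auto)
  moreover have "mono_arr C ?z"
    by (rule mono_arrI) (use XO ZO Z zero_obj_Cod in auto)
  moreover have "embeds C X X" using XO embedsI[OF mono_Ident[OF XO]] by simp
  ultimately have "?z \<in> S" unfolding S_def using X XO ZO
    by (auto intro!: exI[of _ "Ident C X"] exI[of _ X])
  then obtain n where n: "n \<in> S" and max: "\<And>k. k \<in> S \<Longrightarrow> sub_le C n k \<Longrightarrow> sub_le C k n"
    using noetherian_maximal[OF X(1), of S] unfolding S_def by blast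
  from n obtain q L where nq: "mono_arr C n" "Cod C n = X" "is_cokernel C n q" "nonzero_obj C L"
    "embeds C L X" "embeds C L (Cod C q)" unfolding S_def by blast
  note q' = cokernel_arr[OF nq(3)]
  obtain l where l: "mono_arr C l" "Dom C l = L" "Cod C l = Cod C q" using nq(6) by (rule embedsE)
  have "monoform C L"
    unfolding monoform_def
  proof (intro conjI allI impI notI)
    fix m p assume mp: "mono_arr C m \<and> Cod C m = L \<and> nonzero_obj C (Dom C m) \<and> is_cokernel C m p"
      and "\<exists>M. nonzero_obj C M \<and> embeds C M L \<and> embeds C M (Cod C p)"
    then obtain M where M: "nonzero_obj C M" "embeds C M L" "embeds C M (Cod C p)" by blast
    have lm: "mono_arr C (l \<cdot> m)" "Cod C (l \<cdot> m) = Cod C q" "Dom C (l \<cdot> m) = Dom C m"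
      using l mp by (auto intro: mono_comp)
    obtain q3 where q3: "is_cokernel C (l \<cdot> m) q3" using obtain_cokernel lm by (metis mono_arr_arr)
    note q3' = cokernel_arr[OF q3]
    \<comment> \<open>\<open>a\<close> is the preimage in \<open>X\<close> of the subobject
      \<open>l \<cdot> m\<close> of \<open>X / N\<close>. It contains \<open>n\<close>, and the
      quotient of \<open>X\<close> by \<open>a\<close> is that of \<open>X / N\<close> by
      \<open>l \<cdot> m\<close>, in which \<open>Cod C p\<close> and hence \<open>M\<close> embeds.
      So \<open>a\<close> is in \<open>S\<close>, and maximality of \<open>n\<close> forces
      \<open>l \<cdot> m\<close> to be zero.\<close>
    obtain a r where a: "mono_arr C a" "Cod C a = Dom C q" "r \<in> Arr C" "Dom C r = Dom C a"
        "Cod C r = Dom C (l \<cdot> m)"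
      "q \<cdot> a = (l \<cdot> m) \<cdot> r" "epi_arr C q \<longrightarrow> epi_arr C r"
      "\<forall>h. h \<in> Arr C \<longrightarrow> Cod C h = Dom C q \<longrightarrow> sub_le C (q \<cdot> h) (l \<cdot> m) \<longrightarrow> sub_le C h a"
      using preimage[OF q'(2) lm(1) lm(2)[symmetric]] .
    have r: "epi_arr C r" using a q' by simp
    have na: "sub_le C n a"
      by (rule a(8)[rule_format]) (use nq q' lm in \<open>auto intro: zero_sub_le\<close>)
    have "is_cokernel C a (q3 \<cdot> q)"
    proof (rule cokernelI)
      show "epi_arr C (q3 \<cdot> q)" using q' q3' lm by (simp add: epi_comp)
      have "zero_arr ((q3 \<cdot> (l \<cdot> m)) \<cdot> r)" by (rule zero_arr_comp_right) (use q3' lm a in auto)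
      then show "zero_arr ((q3 \<cdot> q) \<cdot> a)" using a q' q3' lm assoc[of r "l \<cdot> m" q3]
          by (simp add: assoc)
      fix h assume h: "h \<in> Arr C" "Dom C h = Cod C a" "zero_arr (h \<cdot> a)"
      obtain u where u: "u \<in> Arr C" "Dom C u = Dom C n" "Cod C u = Dom C a" "a \<cdot> u = n"
        using na by (rule sub_leE)
      have "zero_arr ((h \<cdot> a) \<cdot> u)" by (rule zero_arr_comp_right) (use h u a in auto)
      then have "zero_arr (h \<cdot> n)" using h u a by (simp add: assoc)
      then obtain h' where h': "h' \<in> Arr C" "Dom C h' = Cod C q" "Cod C h' = Cod C h" "h' \<cdot> q = h"
        using cokernel_factor[OF nq(3), of h] h a nq q' by auto
      have "(h' \<cdot> (l \<cdot> m)) \<cdot> r = h' \<cdot> (q \<cdot> a)"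
        unfolding a(6) by (rule assoc) (use h' lm a in auto)
      also have "\<dots> = h \<cdot> a" by (rule reassoc[OF h'(4)]) (use h' a q' in auto)
      finally have "zero_arr (h' \<cdot> (l \<cdot> m))"
        using epi_zero_arr[OF r, of "h' \<cdot> (l \<cdot> m)"] h h' lm a by simp
      then obtain h'' where h'': "h'' \<in> Arr C" "Dom C h'' = Cod C q3" "Cod C h'' = Cod C h'"
          "h'' \<cdot> q3 = h'"
        using cokernel_factor[OF q3, of h'] h' lm by auto
      show "\<exists>u. u \<in> Arr C \<and> Dom C u = Cod C (q3 \<cdot> q) \<and> Cod C u = Cod C h \<and> u \<cdot> (q3 \<cdot> q) = h"
        using h'' h' q3' q' lm by (intro exI[of _ h'']) (simp add: reassoc[OF h''(4)])
    qed (use a q' q3' lm in auto)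
    moreover have "embeds C M (Cod C (q3 \<cdot> q))"
    proof -
      have "embeds C (Cod C p) (Cod C q3)" by (rule embeds_quotient[of l m]) (use l mp q3 in auto)
      then show ?thesis using M(3) q3' q' lm by (auto intro: embeds_trans)
    qed
    moreover have "embeds C M X" using M(2) nq(5) by (rule embeds_trans)
    ultimately have "a \<in> S" unfolding S_def using a M nq q' by auto
    then have "sub_le C a n" using max na by blast
    then have "zero_arr (q \<cdot> a)" using mono_cokernel_iff[OF nq(1,3), of a] a nq q' by simp
    then have "zero_arr (l \<cdot> m)" using epi_zero_arr[OF r, of "l \<cdot> m"] a lm by simp
    then show False using nonzero_mono_iff[OF lm(1)] lm mp by simp
  qed (rule nq)
  then show ?thesis using that nq by blast
qed

end

section \<open>Small sets\<close>

lemma universe_infinite: "universe U \<Longrightarrow> infinite U"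
  unfolding universe_def by (meson infinite_le_lepoll lesspoll_imp_lepoll)

text \<open>Coproducts and limits are indexed by sets in the type of \<open>U\<close>; this moves a
  small set of any type there.\<close>

lemma small_index:
  fixes U :: "'u set"
  assumes "A \<prec> U"
  obtains \<psi> :: "'a \<Rightarrow> 'u" where "inj_on \<psi> A" "\<psi> ` A \<prec> U"
proof -
  obtain \<psi> :: "'a \<Rightarrow> 'u" where "inj_on \<psi> A" "\<psi> ` A \<subseteq> U"
    using lesspoll_imp_lepoll[OF assms] by (auto simp: lepoll_def)
  then show ?thesis using that assms by simp
qed

lemma small_Pow:
  assumes "universe (U :: 'u set)" "A \<prec> U" shows "Pow A \<prec> U"
proof -
  obtain \<psi> :: "'a \<Rightarrow> 'u" where \<psi>: "inj_on \<psi> A" "\<psi> ` A \<prec> U"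
    using small_index[OF assms(2)] .
  have "inj_on (image \<psi>) (Pow A)" using \<psi>(1) by (rule inj_on_image_Pow)
  moreover have "image \<psi> ` Pow A = Pow (\<psi> ` A)" by (rule image_Pow_surj) simp
  moreover have "Pow (\<psi> ` A) \<prec> U" using assms(1) \<psi>(2) unfolding universe_def by blast
  ultimately show ?thesis by (metis inj_on_image_lesspoll_1)
qed

lemma small_insert:
  assumes "infinite U" "A \<prec> U" shows "insert x A \<prec> U"
proof (cases "finite A")
  case True
  then show ?thesis using assms(1) by (simp add: finite_lesspoll_infinite)
next
  case False
  show ?thesis by (rule eq_lesspoll_trans[OF infinite_insert_eqpoll[OF False] assms(2)])
qed

text \<open>The sum injects into \<open>U \<times> U\<close>, which is equipollent to
  \<open>U\<close>. If it were as large as \<open>U\<close>, a bijection would present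
  \<open>U\<close> as a small union of small sets, against the closure of the universe under such
  unions.\<close>

lemma small_Sigma:
  assumes U: "universe (U :: 'u set)" and A: "A \<prec> U" and B: "\<And>a. a \<in> A \<Longrightarrow> B a \<prec> U"
  shows "Sigma A B \<prec> U"
proof -
  have "U \<times> U \<approx> U"
    using card_of_Times_same_infinite[OF universe_infinite[OF U]]
        by (simp add: eqpoll_iff_card_of_ordIso)
  moreover have "Sigma A B \<lesssim> U \<times> U"
  proof -
    obtain f where f: "inj_on f A" "f ` A \<subseteq> U" using lesspoll_imp_lepoll[OF A]
        by (auto simp: lepoll_def)
    have "\<forall>a\<in>A. \<exists>g. inj_on g (B a) \<and> g ` B a \<subseteq> U" using B lesspoll_imp_lepoll by (metis lepoll_def)
    then obtain g where g: "\<forall>a\<in>A. inj_on (g a) (B a) \<and> g a ` B a \<subseteq> U" by metis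
    have "inj_on (\<lambda>(a, b). (f a, g a b)) (Sigma A B)"
      using f g by (auto simp: inj_on_def)
    moreover have "(\<lambda>(a, b). (f a, g a b)) ` Sigma A B \<subseteq> U \<times> U" using f g by auto
    ultimately show ?thesis by (auto simp: lepoll_def)
  qed
  ultimately have le: "Sigma A B \<lesssim> U" by (rule lepoll_trans2[rotated])
  moreover have "\<not> U \<lesssim> Sigma A B"
  proof
    assume "U \<lesssim> Sigma A B"
    then have "Sigma A B \<approx> U" using le by (simp add: lepoll_antisym)
    then obtain \<psi> where \<psi>: "bij_betw \<psi> (Sigma A B) U" by (auto simp: eqpoll_def)
    obtain \<phi> :: "'a \<Rightarrow> 'u" where \<phi>: "inj_on \<phi> A" "\<phi> ` A \<prec> U" using small_index[OF A] .
    let ?F = "\<lambda>i. \<psi> ` ({inv_into A \<phi> i} \<times> B (inv_into A \<phi> i))"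
    have "?F i \<prec> U" if "i \<in> \<phi> ` A" for i
    proof -
      have i: "inv_into A \<phi> i \<in> A" using that by (simp add: inv_into_into)
      have "?F i \<lesssim> {inv_into A \<phi> i} \<times> B (inv_into A \<phi> i)" by (rule image_lepoll)
      also have "\<dots> \<approx> B (inv_into A \<phi> i)" by (rule times_singleton_eqpoll)
      also have "\<dots> \<prec> U" using B i by blast
      finally show ?thesis .
    qed
    then have "(\<Union>i\<in>\<phi> ` A. ?F i) \<prec> U"
      using U[unfolded universe_def, THEN conjunct2, THEN conjunct2, rule_format, of "\<phi> ` A" ?F] \<phi>(2)
      by metis
    moreover have "(\<Union>i\<in>\<phi> ` A. ?F i) = \<psi> ` Sigma A B"
      using \<phi>(1) by (auto simp: inv_into_f_f)
    ultimately show False using \<psi> by (simp add: bij_betw_def)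
  qed
  ultimately show ?thesis using lepoll_iff_leqpoll[of "Sigma A B" U] eqpoll_imp_lepoll eqpoll_sym
      by blast
qed

lemma small_image: "A \<prec> U \<Longrightarrow> f ` A \<prec> U"
  by (rule lesspoll_trans1[OF image_lepoll])

lemma small_subset: "A \<subseteq> B \<Longrightarrow> B \<prec> U \<Longrightarrow> A \<prec> U"
  by (rule lesspoll_trans1[OF subset_imp_lepoll])

section \<open>Coproducts and direct limits\<close>

context preadditive_category
begin

lemma coproduct_arr:
  assumes "is_coproduct C I X S c"
  shows "S \<in> Obj C" "\<And>i. i \<in> I \<Longrightarrow> c i \<in> Arr C" "\<And>i. i \<in> I \<Longrightarrow> Dom C (c i) = X i"
    "\<And>i. i \<in> I \<Longrightarrow> Cod C (c i) = S"
  using assms by (auto simp: is_coproduct_def)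

lemma coproduct_ex1:
  "is_coproduct C I X S c \<Longrightarrow> Y \<in> Obj C \<Longrightarrow> \<forall>i\<in>I. g i \<in> Hom C (X i) Y \<Longrightarrow>
   \<exists>!u. u \<in> Hom C S Y \<and> (\<forall>i \<in> I. u \<cdot> c i = g i)"
  unfolding is_coproduct_def by (elim conjE, drule (1) bspec, drule spec, erule (1) mp)

lemma coproduct_factor:
  assumes "is_coproduct C I X S c" "Y \<in> Obj C"
    "\<And>i. i \<in> I \<Longrightarrow> g i \<in> Arr C" "\<And>i. i \<in> I \<Longrightarrow> Dom C (g i) = X i" "\<And>i. i \<in> I \<Longrightarrow> Cod C (g i) = Y"
  obtains u where "u \<in> Arr C" "Dom C u = S" "Cod C u = Y" "\<forall>i\<in>I. u \<cdot> c i = g i"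
proof -
  have "\<forall>i\<in>I. g i \<in> Hom C (X i) Y" using assms by auto
  then have "\<exists>!u. u \<in> Hom C S Y \<and> (\<forall>i \<in> I. u \<cdot> c i = g i)"
    by (rule coproduct_ex1[OF assms(1,2)])
  then show ?thesis using that by (auto dest!: ex1_implies_ex)
qed

lemma coproduct_joint_epi:
  assumes "is_coproduct C I X S c" "f \<in> Arr C" "g \<in> Arr C" "Dom C f = S" "Dom C g = S"
      "Cod C f = Cod C g"
    "\<And>i. i \<in> I \<Longrightarrow> f \<cdot> c i = g \<cdot> c i"
  shows "f = g"
proof -
  note A = coproduct_arr[OF assms(1)]
  have "\<forall>i\<in>I. g \<cdot> c i \<in> Hom C (X i) (Cod C g)" using assms A by auto
  moreover have "Cod C g \<in> Obj C" using assms by simp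
  ultimately have "\<exists>!u. u \<in> Hom C S (Cod C g) \<and> (\<forall>i \<in> I. u \<cdot> c i = g \<cdot> c i)"
    by (intro coproduct_ex1[OF assms(1)])
  moreover have "f \<in> Hom C S (Cod C g) \<and> (\<forall>i \<in> I. f \<cdot> c i = g \<cdot> c i)"
    "g \<in> Hom C S (Cod C g) \<and> (\<forall>i \<in> I. g \<cdot> c i = g \<cdot> c i)" using assms by auto
  ultimately show ?thesis by blast
qed

lemma cocone_arr:
  assumes "is_cocone C I r X t L l"
  shows "L \<in> Obj C" "\<And>i. i \<in> I \<Longrightarrow> l i \<in> Arr C" "\<And>i. i \<in> I \<Longrightarrow> Dom C (l i) = X i"
    "\<And>i. i \<in> I \<Longrightarrow> Cod C (l i) = L" "\<And>i j. (i, j) \<in> r \<Longrightarrow> l j \<cdot> t i j = l i"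
  using assms by (auto simp: is_cocone_def)

lemma limit_cocone: "is_direct_limit C I r X t L l \<Longrightarrow> is_cocone C I r X t L l"
  by (simp add: is_direct_limit_def)

lemmas limit_arr = cocone_arr[OF limit_cocone]

lemma cocone_comp:
  assumes "is_cocone C I r X t L l" "h \<in> Arr C" "Dom C h = L" "direct_system C I r X t"
  shows "is_cocone C I r X t (Cod C h) (\<lambda>i. h \<cdot> l i)"
proof -
  note A = cocone_arr[OF assms(1)]
  have "(h \<cdot> l j) \<cdot> t i j = h \<cdot> l i" if ij: "(i, j) \<in> r" for i j
  proof -
    have "i \<in> I" "j \<in> I" "t i j \<in> Hom C (X i) (X j)"
      using ij assms(4) by (auto simp: direct_system_def directed_set_def preorder_on_def)
    then show ?thesis using A(1-4) A(5)[OF ij] assms(2,3) by (simp add: assoc)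
  qed
  then show ?thesis using A(1-4) assms(2,3) unfolding is_cocone_def by simp
qed

lemma limit_ex1:
  "is_direct_limit C I r X t L l \<Longrightarrow> is_cocone C I r X t Y g \<Longrightarrow>
   \<exists>!u. u \<in> Hom C L Y \<and> (\<forall>i \<in> I. u \<cdot> l i = g i)"
  unfolding is_direct_limit_def by (drule conjunct2, drule spec, drule spec, erule (1) mp)

lemma limit_factor:
  assumes "is_direct_limit C I r X t L l" "is_cocone C I r X t Y g"
  obtains u where "u \<in> Arr C" "Dom C u = L" "Cod C u = Y" "\<forall>i\<in>I. u \<cdot> l i = g i"
proof -
  have "\<exists>!u. u \<in> Hom C L Y \<and> (\<forall>i \<in> I. u \<cdot> l i = g i)"
    using assms by (rule limit_ex1)
  then show ?thesis using that by (auto dest!: ex1_implies_ex)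
qed

lemma limit_joint_epi:
  assumes L: "is_direct_limit C I r X t L l" and s: "direct_system C I r X t"
    and "f \<in> Arr C" "g \<in> Arr C" "Dom C f = L" "Dom C g = L" "Cod C f = Cod C g"
    "\<And>i. i \<in> I \<Longrightarrow> f \<cdot> l i = g \<cdot> l i"
  shows "f = g"
proof -
  have "is_cocone C I r X t (Cod C g) (\<lambda>i. g \<cdot> l i)"
    by (rule cocone_comp[OF limit_cocone[OF L]]) (use assms in auto)
  then have "\<exists>!u. u \<in> Hom C L (Cod C g) \<and> (\<forall>i \<in> I. u \<cdot> l i = g \<cdot> l i)"
    by (rule limit_ex1[OF L])
  moreover have "f \<in> Hom C L (Cod C g) \<and> (\<forall>i \<in> I. f \<cdot> l i = g \<cdot> l i)"
    "g \<in> Hom C L (Cod C g) \<and> (\<forall>i \<in> I. g \<cdot> l i = g \<cdot> l i)" using assms by auto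
  ultimately show ?thesis by blast
qed

lemma limitI:
  assumes "is_cocone C I r X t L l"
    "\<And>Y g. is_cocone C I r X t Y g \<Longrightarrow> \<exists>u. u \<in> Arr C \<and> Dom C u = L \<and> Cod C u = Y \<and>
        (\<forall>i\<in>I. u \<cdot> l i = g i)"
    "\<And>f g. f \<in> Arr C \<Longrightarrow> g \<in> Arr C \<Longrightarrow> Dom C f = L \<Longrightarrow> Dom C g = L \<Longrightarrow> Cod C f = Cod C g \<Longrightarrow>
       (\<forall>i\<in>I. f \<cdot> l i = g \<cdot> l i) \<Longrightarrow> f = g"
  shows "is_direct_limit C I r X t L l"
  unfolding is_direct_limit_def
proof (intro conjI allI impI)
  fix Y g assume g: "is_cocone C I r X t Y g"
  obtain u where u: "u \<in> Hom C L Y" "\<forall>i\<in>I. u \<cdot> l i = g i" using assms(2)[OF g] by auto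
  show "\<exists>!u. u \<in> Hom C L Y \<and> (\<forall>i\<in>I. u \<cdot> l i = g i)"
  proof (rule ex1I[of _ u])
    fix f assume f: "f \<in> Hom C L Y \<and> (\<forall>i\<in>I. f \<cdot> l i = g i)"
    have "\<forall>i\<in>I. f \<cdot> l i = u \<cdot> l i" using f u(2) by metis
    then show "f = u" using assms(3)[of f u] f u(1) by simp
  qed (use u in blast)
qed (rule assms)

lemma system_arr:
  assumes "direct_system C I r X t"
  shows "\<And>i j. (i, j) \<in> r \<Longrightarrow> i \<in> I \<and> j \<in> I" "\<And>i. i \<in> I \<Longrightarrow> (i, i) \<in> r"
    "\<And>i j k. (i, j) \<in> r \<Longrightarrow> (j, k) \<in> r \<Longrightarrow> (i, k) \<in> r"
    "\<And>i. i \<in> I \<Longrightarrow> X i \<in> Obj C" "\<And>i. i \<in> I \<Longrightarrow> t i i = Ident C (X i)"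
    "\<And>i j. (i, j) \<in> r \<Longrightarrow> t i j \<in> Arr C" "\<And>i j. (i, j) \<in> r \<Longrightarrow> Dom C (t i j) = X i"
    "\<And>i j. (i, j) \<in> r \<Longrightarrow> Cod C (t i j) = X j"
    "\<And>i j k. (i, j) \<in> r \<Longrightarrow> (j, k) \<in> r \<Longrightarrow> t j k \<cdot> t i j = t i k"
    "\<And>i j. i \<in> I \<Longrightarrow> j \<in> I \<Longrightarrow> \<exists>k\<in>I. (i, k) \<in> r \<and> (j, k) \<in> r" "I \<noteq> {}"
proof -
  show "\<And>i j k. (i, j) \<in> r \<Longrightarrow> (j, k) \<in> r \<Longrightarrow> (i, k) \<in> r"
    using assms unfolding direct_system_def directed_set_def preorder_on_def by (metis transD)
qed (use assms in \<open>auto simp: direct_system_def directed_set_def preorder_on_def refl_on_def\<close>)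

end

context grothendieck_category
begin

text \<open>The limit is the cokernel of the arrow \<open>b\<close> between coproducts whose
  components are the relations \<open>c i - c j \<cdot> t i j\<close>. An arrow out of the coproduct
  \<open>S\<close> kills \<open>b\<close> exactly when its components form a cocone.\<close>

lemma ex_direct_limit:
  assumes I: "(I :: 'u set) \<prec> U" and s: "direct_system C I r X t"
  obtains L l where "is_direct_limit C I r X t L l"
proof -
  note S = system_arr[OF s]
  obtain S c where S_c: "is_coproduct C I X S c" using ex_coproduct[OF I, of X] S(4) by blast
  note c = coproduct_arr[OF S_c]
  \<comment> \<open>The pairs in \<open>r\<close> are not a set in the type of \<open>U\<close>. The
    relations are therefore collected in two layers: first over all \<open>j\<close> above a fixed
    \<open>i\<close>, then over \<open>i\<close>.\<close>
  define R where "R i = {j. (i, j) \<in> r}" for i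
  have "\<exists>W d. is_coproduct C (R i) (\<lambda>j. X i) W d" if "i \<in> I" for i
  proof (rule ex_coproduct)
    have "R i \<subseteq> I" using S(1) by (auto simp: R_def)
    then show "R i \<prec> U" using I by (rule small_subset)
  qed (use that S(4) in auto)
  then obtain W d where W_d: "\<And>i. i \<in> I \<Longrightarrow> is_coproduct C (R i) (\<lambda>j. X i) (W i) (d i)" by metis
  note d = coproduct_arr[OF W_d]
  have "\<exists>a. a \<in> Arr C \<and> Dom C a = W i \<and> Cod C a = S \<and>
      (\<forall>j\<in>R i. a \<cdot> d i j = sub_arr (c i) (c j \<cdot> t i j))" if i: "i \<in> I" for i
  proof -
    have "j \<in> I \<and> sub_arr (c i) (c j \<cdot> t i j) \<in> Arr C \<and> Dom C (sub_arr (c i) (c j \<cdot> t i j)) = X i \<and>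
        Cod C (sub_arr (c i) (c j \<cdot> t i j)) = S" if "j \<in> R i" for j
    proof -
      have "(i, j) \<in> r" using that by (simp add: R_def)
      then show ?thesis using S(1)[of i j] i c S(4)[OF i] S(6-8)[of i j] by simp
    qed
    then obtain a where "a \<in> Arr C" "Dom C a = W i" "Cod C a = S"
        "\<forall>j\<in>R i. a \<cdot> d i j = sub_arr (c i) (c j \<cdot> t i j)"
      using coproduct_factor[OF W_d[OF i] c(1), of "\<lambda>j. sub_arr (c i) (c j \<cdot> t i j)"] by blast
    then show ?thesis by blast
  qed
  then obtain a where a: "\<And>i. i \<in> I \<Longrightarrow> a i \<in> Arr C" "\<And>i. i \<in> I \<Longrightarrow> Dom C (a i) = W i"
      "\<And>i. i \<in> I \<Longrightarrow> Cod C (a i) = S"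
    "\<And>i j. (i, j) \<in> r \<Longrightarrow> a i \<cdot> d i j = sub_arr (c i) (c j \<cdot> t i j)"
    using S(1) unfolding R_def by (metis mem_Collect_eq)
  obtain V e where V_e: "is_coproduct C I W V e" using ex_coproduct[OF I, of W] d(1) by blast
  note e = coproduct_arr[OF V_e]
  obtain b where b: "b \<in> Arr C" "Dom C b = V" "Cod C b = S" "\<And>i. i \<in> I \<Longrightarrow> b \<cdot> e i = a i"
    using coproduct_factor[OF V_e c(1), of a] a by blast
  obtain q where q: "is_cokernel C b q" using obtain_cokernel b by blast
  note q' = cokernel_arr[OF q]
  have key: "h \<cdot> b = g \<cdot> b"
    if "h \<in> Arr C" "g \<in> Arr C" "Dom C h = S" "Dom C g = S" "Cod C h = Cod C g"
      "\<And>i j. (i, j) \<in> r \<Longrightarrow> h \<cdot> sub_arr (c i) (c j \<cdot> t i j) = g \<cdot> sub_arr (c i) (c j \<cdot> t i j)" for h g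
  proof (rule coproduct_joint_epi[OF V_e])
    fix i assume i: "i \<in> I"
    have "h \<cdot> a i = g \<cdot> a i"
    proof (rule coproduct_joint_epi[OF W_d[OF i]])
      fix j assume "j \<in> R i"
      then have ij: "(i, j) \<in> r" by (simp add: R_def)
      then have dj: "d i j \<in> Arr C" "Cod C (d i j) = W i" using d(2-4)[OF i, of j]
          by (auto simp: R_def)
      show "(h \<cdot> a i) \<cdot> d i j = (g \<cdot> a i) \<cdot> d i j"
        using that(1-5) that(6)[OF ij] a(1-3)[OF i] a(4)[OF ij] dj by (simp add: assoc)
    qed (use that a i in auto)
    then show "(h \<cdot> b) \<cdot> e i = (g \<cdot> b) \<cdot> e i"
      using that(1-5) b e i by (simp add: assoc)
  qed (use that b in auto)
  have "is_direct_limit C I r X t (Cod C q) (\<lambda>i. q \<cdot> c i)"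
  proof (rule limitI)
    show "is_cocone C I r X t (Cod C q) (\<lambda>i. q \<cdot> c i)"
      unfolding is_cocone_def
    proof (intro conjI ballI allI impI)
      fix i j assume ij: "(i, j) \<in> r"
      then have i: "i \<in> I" and j: "j \<in> I" using S(1) by auto
      have dj: "d i j \<in> Arr C" "Cod C (d i j) = W i" "Dom C (d i j) = X i"
          using d(2-4)[OF i, of j] ij by (auto simp: R_def)
      have "zero_arr ((q \<cdot> b) \<cdot> (e i \<cdot> d i j))"
        by (rule zero_arr_comp_right) (use q' b e i dj in auto)
      then have "zero_arr (q \<cdot> sub_arr (c i) (c j \<cdot> t i j))"
        using q' b(1-3) e i dj reassoc[OF b(4)[OF i], of "d i j"] a(4)[OF ij] by (simp add: assoc)
      then have "zero_arr (sub_arr (q \<cdot> c i) (q \<cdot> (c j \<cdot> t i j)))"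
        using q' b c i j S(4-8) ij by (simp add: comp_sub)
      then have "q \<cdot> c i = q \<cdot> (c j \<cdot> t i j)"
        using zero_arr_sub_iff[of "q \<cdot> c i" "q \<cdot> (c j \<cdot> t i j)"] q' b(1-3) c i j S(4-8) ij by simp
      then show "(q \<cdot> c j) \<cdot> t i j = q \<cdot> c i" using q' b c i j S(4-8) ij by (simp add: assoc)
    qed (use q' b c S(4) in auto)
  next
    fix Y g assume g: "is_cocone C I r X t Y g"
    note g' = cocone_arr[OF g]
    obtain h where h: "h \<in> Arr C" "Dom C h = S" "Cod C h = Y" "\<And>i. i \<in> I \<Longrightarrow> h \<cdot> c i = g i"
      using coproduct_factor[OF S_c g'(1), of g] g' by blast
    have "h \<cdot> b = ZeroArr C S Y \<cdot> b"
    proof (rule key)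
      fix i j assume ij: "(i, j) \<in> r"
      then have i: "i \<in> I" and j: "j \<in> I" using S(1) by auto
      have "h \<cdot> (c j \<cdot> t i j) = h \<cdot> c i"
        using reassoc[OF h(4)[OF j], of "t i j"] h i j c S(4-8) ij g'(5)[OF ij] by simp
      then have "zero_arr (h \<cdot> sub_arr (c i) (c j \<cdot> t i j))"
        using h(1-3) c i j S(4-8) ij by (simp add: comp_sub zero_arr_sub_iff)
      then show "h \<cdot> sub_arr (c i) (c j \<cdot> t i j) = ZeroArr C S Y \<cdot> sub_arr (c i) (c j \<cdot> t i j)"
        using h(1-3) c i j S(4-8) ij g'(1) by (simp add: zero_arr_def)
    qed (use h g' c in auto)
    then have "zero_arr (h \<cdot> b)" using b(1-3) e(1) g'(1) c(1) by simp
    then obtain u where u: "u \<in> Arr C" "Dom C u = Cod C q" "Cod C u = Cod C h" "u \<cdot> q = h"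
      using cokernel_factor[OF q, of h] h b by auto
    show "\<exists>u. u \<in> Arr C \<and> Dom C u = Cod C q \<and> Cod C u = Y \<and> (\<forall>i\<in>I. u \<cdot> (q \<cdot> c i) = g i)"
      by (rule exI[of _ u]) (use u(1-3) h c q' b(1-3) in \<open>auto simp: reassoc[OF u(4)]\<close>)
  next
    fix f g assume fg: "f \<in> Arr C" "g \<in> Arr C" "Dom C f = Cod C q" "Dom C g = Cod C q"
        "Cod C f = Cod C g"
       "\<forall>i\<in>I. f \<cdot> (q \<cdot> c i) = g \<cdot> (q \<cdot> c i)"
    have "f \<cdot> q = g \<cdot> q"
      by (rule coproduct_joint_epi[OF S_c]) (use fg q' b c in \<open>auto simp: assoc\<close>)
    then show "f = g" using epi_cancel[OF q'(5)] fg by blast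
  qed
  then show ?thesis using that by blast
qed

text \<open>Exactness of the direct limit of \<open>0 \<rightarrow> D \<rightarrow> Y\<^sub>i \<rightarrow> Y\<^sub>i / D \<rightarrow> 0\<close>.\<close>

lemma constant_mono_limit:
  assumes I: "(I :: 'u set) \<prec> U" and s: "direct_system C I r Y t"
      and M: "is_direct_limit C I r Y t M m"
    and d: "\<And>i. i \<in> I \<Longrightarrow> mono_arr C (d i)" "\<And>i. i \<in> I \<Longrightarrow> Dom C (d i) = D"
        "\<And>i. i \<in> I \<Longrightarrow> Cod C (d i) = Y i"
      "\<And>i j. (i, j) \<in> r \<Longrightarrow> t i j \<cdot> d i = d j"
    and i: "i \<in> I"
  shows "mono_arr C (m i \<cdot> d i)"
proof -
  note S = system_arr[OF s] and m = limit_arr[OF M]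
  have d': "\<And>i. i \<in> I \<Longrightarrow> d i \<in> Arr C" using d by simp
  have D: "D \<in> Obj C" using d(2)[OF i] d'[OF i] by auto
  define a where "a = m i \<cdot> d i"
  have a_eq: "m j \<cdot> d j = a" if j: "j \<in> I" for j
  proof -
    obtain k where k: "k \<in> I" "(i, k) \<in> r" "(j, k) \<in> r" using S(10)[OF i j] by blast
    have 1: "m k \<cdot> d k = m x \<cdot> d x" if "(x, k) \<in> r" "x \<in> I" for x
      unfolding d(4)[OF that(1), symmetric]
          using reassoc[OF m(5)[OF that(1)], of "d x"] that d' d(1-3) S(4-8) k m(1-4) by simp
    show ?thesis unfolding a_def using 1[OF k(2) i] 1[OF k(3) j] by simp
  qed
  have a: "a \<in> Arr C" "Dom C a = D" "Cod C a = M" unfolding a_def using i d' d m by auto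
  have "\<exists>q. is_cokernel C (d j) q" if "j \<in> I" for j using obtain_cokernel d'[OF that] by blast
  then obtain q where q: "\<And>j. j \<in> I \<Longrightarrow> is_cokernel C (d j) (q j)" by metis
  note q' = cokernel_arr[OF q]
  define Z where "Z j = Cod C (q j)" for j
  have "\<exists>w. w \<in> Arr C \<and> Dom C w = Z j \<and> Cod C w = Z k \<and> w \<cdot> q j = q k \<cdot> t j k" if jk: "(j, k) \<in> r"
      for j k
  proof -
    have j: "j \<in> I" and k: "k \<in> I" using S(1)[OF jk] by auto
    have "zero_arr ((q k \<cdot> t j k) \<cdot> d j)" using q'[OF k] d(3) d' S(6-8)[OF jk] d(4)[OF jk] j k
        by (simp add: assoc)
    then show ?thesis using cokernel_factor[OF q[OF j], of "q k \<cdot> t j k"] q'[OF k] d(3) d' S(6-8)[OF jk] j k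
      unfolding Z_def by (metis arr_Comp)
  qed
  then obtain w where w: "\<And>j k. (j, k) \<in> r \<Longrightarrow> w j k \<in> Arr C" "\<And>j k. (j, k) \<in> r \<Longrightarrow> Dom C (w j k) = Z j"
    "\<And>j k. (j, k) \<in> r \<Longrightarrow> Cod C (w j k) = Z k" "\<And>j k. (j, k) \<in> r \<Longrightarrow> w j k \<cdot> q j = q k \<cdot> t j k"
    by metis
  have ZO: "Z j \<in> Obj C" if "j \<in> I" for j unfolding Z_def using q'[OF that] by simp
  have DI: "directed_set I r" using s by (simp add: direct_system_def)
  have sZ: "direct_system C I r Z w"
    unfolding direct_system_def
  proof (intro conjI ballI allI impI)
    fix j assume j: "j \<in> I"
    show "w j j = Ident C (Z j)"
      by (rule epi_cancel[OF q'(5)[OF j]])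
          (use w[OF S(2)[OF j]] S(5)[OF j] q'[OF j] d(3) j S(4) in \<open>auto simp: Z_def\<close>)
  next
    fix j k l assume jk: "(j, k) \<in> r" and kl: "(k, l) \<in> r"
    have j: "j \<in> I" and k: "k \<in> I" and l: "l \<in> I" using S(1)[OF jk] S(1)[OF kl] by auto
    have jl: "(j, l) \<in> r" using S(3)[OF jk kl] .
    have arrs: "q j \<in> Arr C" "Dom C (q j) = Y j" "Cod C (q j) = Z j" "q k \<in> Arr C"
        "Dom C (q k) = Y k" "Cod C (q k) = Z k"
      "q l \<in> Arr C" "Dom C (q l) = Y l" "Cod C (q l) = Z l"
      using q' d(3) j k l by (auto simp: Z_def)
    have "(w k l \<cdot> w j k) \<cdot> q j = w k l \<cdot> (q k \<cdot> t j k)"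
      using w(1-3)[OF jk] w(1-3)[OF kl] arrs w(4)[OF jk] by (simp add: assoc)
    also have "\<dots> = q l \<cdot> (t k l \<cdot> t j k)"
      using reassoc[OF w(4)[OF kl], of "t j k"] S(6-8)[OF jk] S(6-8)[OF kl] w(1-3)[OF kl] arrs
          by (simp add: assoc)
    also have "\<dots> = w j l \<cdot> q j" using S(9)[OF jk kl] w(4)[OF jl] by simp
    finally have *: "(w k l \<cdot> w j k) \<cdot> q j = w j l \<cdot> q j" .
    show "w k l \<cdot> w j k = w j l"
      by (rule epi_cancel[OF q'(5)[OF j] *])
          (use w(1-3)[OF jk] w(1-3)[OF kl] w(1-3)[OF jl] arrs in auto)
  qed (use DI ZO w in auto)
  have sD: "direct_system C I r (\<lambda>_. D) (\<lambda>_ _. Ident C D)"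
    unfolding direct_system_def using DI D by simp
  \<comment> \<open>A cocone on the constant system is constant, because any two indices have a
    common upper bound.\<close>
  have LD: "is_direct_limit C I r (\<lambda>_. D) (\<lambda>_ _. Ident C D) D (\<lambda>_. Ident C D)"
  proof (rule limitI)
    show "is_cocone C I r (\<lambda>_. D) (\<lambda>_ _. Ident C D) D (\<lambda>_. Ident C D)"
      unfolding is_cocone_def using D by simp
  next
    fix Y' g assume g: "is_cocone C I r (\<lambda>_. D) (\<lambda>_ _. Ident C D) Y' g"
    note g' = cocone_arr[OF g]
    have "g j = g i" if j: "j \<in> I" for j
    proof -
      obtain k where k: "k \<in> I" "(i, k) \<in> r" "(j, k) \<in> r" using S(10)[OF i j] by blast
      show ?thesis using g'(5)[OF k(2)] g'(5)[OF k(3)] g'(2,3)[OF k(1)] by simp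
    qed
    then show "\<exists>u. u \<in> Arr C \<and> Dom C u = D \<and> Cod C u = Y' \<and> (\<forall>j\<in>I. u \<cdot> Ident C D = g j)"
      using g'(2-4)[OF i] by (intro exI[of _ "g i"]) simp
  qed (use i in auto)
  obtain p where p: "is_cokernel C a p" using obtain_cokernel a by blast
  note p' = cokernel_arr[OF p]
  have "\<exists>n. n \<in> Arr C \<and> Dom C n = Z j \<and> Cod C n = Cod C p \<and> n \<cdot> q j = p \<cdot> m j" if j: "j \<in> I" for j
  proof -
    have "zero_arr ((p \<cdot> m j) \<cdot> d j)" using p' a m j d' d a_eq[OF j] by (simp add: assoc)
    then show ?thesis using cokernel_factor[OF q[OF j], of "p \<cdot> m j"] p' a m j d
      unfolding Z_def by (metis arr_Comp)
  qed
  then obtain n where n: "\<And>j. j \<in> I \<Longrightarrow> n j \<in> Arr C" "\<And>j. j \<in> I \<Longrightarrow> Dom C (n j) = Z j"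
    "\<And>j. j \<in> I \<Longrightarrow> Cod C (n j) = Cod C p" "\<And>j. j \<in> I \<Longrightarrow> n j \<cdot> q j = p \<cdot> m j" by metis
  \<comment> \<open>The cokernel of \<open>a\<close> and the limit of the quotients have the same
    universal property. With this identification, exactness contributes exactly what is wanted:
    \<open>a\<close> is a kernel, hence monic.\<close>
  have LZ: "is_direct_limit C I r Z w (Cod C p) n"
  proof (rule limitI)
    show "is_cocone C I r Z w (Cod C p) n" unfolding is_cocone_def
    proof (intro conjI ballI allI impI)
      fix j k assume jk: "(j, k) \<in> r"
      have j: "j \<in> I" and k: "k \<in> I" using S(1)[OF jk] by auto
      have arrs: "q j \<in> Arr C" "Dom C (q j) = Y j" "Cod C (q j) = Z j" "q k \<in> Arr C"
          "Dom C (q k) = Y k" "Cod C (q k) = Z k"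
        using q' d(3) j k by (auto simp: Z_def)
      have "(n k \<cdot> w j k) \<cdot> q j = n k \<cdot> (q k \<cdot> t j k)"
        using w(1-3)[OF jk] n[OF k] arrs w(4)[OF jk] by (simp add: assoc)
      also have "\<dots> = p \<cdot> (m k \<cdot> t j k)"
        using reassoc[OF n(4)[OF k], of "t j k"] S(6-8)[OF jk] n(1-3)[OF k] arrs p' a m k
            by (simp add: assoc)
      also have "\<dots> = n j \<cdot> q j" using m(5)[OF jk] n(4)[OF j] by simp
      finally have *: "(n k \<cdot> w j k) \<cdot> q j = n j \<cdot> q j" .
      show "n k \<cdot> w j k = n j"
        by (rule epi_cancel[OF q'(5)[OF j] *])
            (use w(1-3)[OF jk] n(1-3)[OF k] n(1-3)[OF j] arrs in auto)
    qed (use n p' in auto)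
  next
    fix V h assume h: "is_cocone C I r Z w V h"
    note h' = cocone_arr[OF h]
    have cc: "is_cocone C I r Y t V (\<lambda>j. h j \<cdot> q j)" unfolding is_cocone_def
    proof (intro conjI ballI allI impI)
      fix j k assume jk: "(j, k) \<in> r"
      have j: "j \<in> I" and k: "k \<in> I" using S(1)[OF jk] by auto
      have arrs: "q j \<in> Arr C" "Dom C (q j) = Y j" "Cod C (q j) = Z j" "q k \<in> Arr C"
          "Dom C (q k) = Y k" "Cod C (q k) = Z k"
        using q' d(3) j k by (auto simp: Z_def)
      have "(h k \<cdot> q k) \<cdot> t j k = h k \<cdot> (w j k \<cdot> q j)"
        using w(4)[OF jk] S(6-8)[OF jk] arrs h' k by (simp add: assoc)
      also have "\<dots> = h j \<cdot> q j"
        by (rule reassoc[OF h'(5)[OF jk]]) (use w(1-3)[OF jk] arrs h' k in auto)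
      finally show "(h k \<cdot> q k) \<cdot> t j k = h j \<cdot> q j" .
    qed (use h' q' d(3) in \<open>auto simp: Z_def\<close>)
    obtain v where v: "v \<in> Arr C" "Dom C v = M" "Cod C v = V" "\<forall>j\<in>I. v \<cdot> m j = h j \<cdot> q j"
      using limit_factor[OF M cc] .
    have "v \<cdot> a = h i \<cdot> (q i \<cdot> d i)"
      unfolding a_def using reassoc[OF v(4)[rule_format, OF i], of "d i"] v m i d' d q'[OF i] h'
          by (simp add: assoc Z_def)
    moreover have "zero_arr (h i \<cdot> (q i \<cdot> d i))"
      by (rule zero_arr_comp_left) (use q'[OF i] h' i in \<open>auto simp: Z_def\<close>)
    ultimately obtain v' where v': "v' \<in> Arr C" "Dom C v' = Cod C p" "Cod C v' = V" "v' \<cdot> p = v"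
      using cokernel_factor[OF p, of v] v a by auto
    have "v' \<cdot> n j = h j" if j: "j \<in> I" for j
    proof -
      have "(v' \<cdot> n j) \<cdot> q j = v' \<cdot> (p \<cdot> m j)"
        using n[OF j] v'(1-3) q'[OF j] by (simp add: assoc Z_def)
      also have "\<dots> = h j \<cdot> q j" using reassoc[OF v'(4), of "m j"] v v' p' a m j by simp
      finally have *: "(v' \<cdot> n j) \<cdot> q j = h j \<cdot> q j" .
      show ?thesis by (rule epi_cancel[OF q'(5)[OF j] *])
          (use n[OF j] v' q'[OF j] h' j in \<open>auto simp: Z_def\<close>)
    qed
    then show "\<exists>u. u \<in> Arr C \<and> Dom C u = Cod C p \<and> Cod C u = V \<and> (\<forall>j\<in>I. u \<cdot> n j = h j)" using v'
        by blast
  next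
    fix f g assume fg: "f \<in> Arr C" "g \<in> Arr C" "Dom C f = Cod C p" "Dom C g = Cod C p"
        "Cod C f = Cod C g"
       "\<forall>i\<in>I. f \<cdot> n i = g \<cdot> n i"
    have "f \<cdot> p = g \<cdot> p"
    proof (rule limit_joint_epi[OF M s])
      fix j assume j: "j \<in> I"
      have "(f \<cdot> n j) \<cdot> q j = (g \<cdot> n j) \<cdot> q j" using fg j by simp
      then show "(f \<cdot> p) \<cdot> m j = (g \<cdot> p) \<cdot> m j"
        using fg(1-5) n[OF j] q'[OF j] p' a m j by (simp add: assoc Z_def)
    qed (use fg p' a in auto)
    then show "f = g" using epi_cancel[OF p'(5)] fg by blast
  qed
  have "short_exact C a p"
  proof (rule direct_limit_exact[OF I sD s sZ _ _ _ LD M LZ])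
    show "system_morphism C I r (\<lambda>_. D) (\<lambda>_ _. Ident C D) Y t d"
      unfolding system_morphism_def
    proof (intro conjI ballI allI impI)
      fix j k assume jk: "(j, k) \<in> r"
      show "d k \<cdot> Ident C D = t j k \<cdot> d j" using d(4)[OF jk] S(1)[OF jk] d' d(2) by simp
    qed (use d d' in auto)
    show "system_morphism C I r Y t Z w q"
      unfolding system_morphism_def using q' d(3) w(4) by (auto simp: Z_def)
    show "\<And>j. j \<in> I \<Longrightarrow> short_exact C (d j) (q j)"
      unfolding short_exact_def using q mono_is_kernel d by blast
    show "a \<in> Hom C D M" using a by simp
    show "p \<in> Hom C M (Cod C p)" using p' a by simp
    show "\<And>j. j \<in> I \<Longrightarrow> a \<cdot> Ident C D = m j \<cdot> d j" using a a_eq by simp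
    show "\<And>j. j \<in> I \<Longrightarrow> p \<cdot> m j = n j \<cdot> q j" using n by simp
  qed
  then show ?thesis unfolding short_exact_def a_def[symmetric] using kernel_arr(5) by blast
qed

end

section \<open>Chains of monomorphisms and their limits\<close>

context preadditive_category
begin

definition mono_chain :: "'i set \<Rightarrow> ('i \<times> 'i) set \<Rightarrow> ('i \<Rightarrow> 'o) \<Rightarrow> ('i \<Rightarrow> 'i \<Rightarrow> 'm) \<Rightarrow> bool" where
  "mono_chain I r X t \<longleftrightarrow> direct_system C I r X t \<and> (\<forall>i\<in>I. \<forall>j\<in>I. (i, j) \<in> r \<or> (j, i) \<in> r) \<and>
     (\<forall>i j. (i, j) \<in> r \<longrightarrow> mono_arr C (t i j))"

lemma upset_system:
  assumes s: "direct_system C I r X t" and lin: "\<forall>i\<in>I. \<forall>j\<in>I. (i, j) \<in> r \<or> (j, i) \<in> r" and k: "k \<in> I"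
  shows "direct_system C {i. (k, i) \<in> r} (r \<inter> {i. (k, i) \<in> r} \<times> {i. (k, i) \<in> r}) X t"
proof -
  note S = system_arr[OF s]
  let ?J = "{i. (k, i) \<in> r}"
  have "directed_set ?J (r \<inter> ?J \<times> ?J)"
    unfolding directed_set_def preorder_on_def
  proof (intro conjI ballI)
    show "?J \<noteq> {}" using S(2)[OF k] by blast
    show "refl_on ?J (r \<inter> ?J \<times> ?J)" using S(1,2) by (fastforce simp: refl_on_def)
    show "trans (r \<inter> ?J \<times> ?J)" by (rule transI) (use S(3) in blast)
    fix i j assume ij: "i \<in> ?J" "j \<in> ?J"
    then have "i \<in> I" "j \<in> I" using S(1) by auto
    then show "\<exists>k\<in>?J. (i, k) \<in> r \<inter> ?J \<times> ?J \<and> (j, k) \<in> r \<inter> ?J \<times> ?J"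
      using ij lin S(2) by blast
  qed blast
  then show ?thesis using s S(1) unfolding direct_system_def by (simp; blast)
qed

text \<open>The indices above \<open>k\<close> are cofinal, so they determine the same limit. A
  cocone given only above \<open>k\<close> is extended to the indices below by composing with the
  transition arrows to \<open>k\<close>.\<close>

lemma upset_limit:
  assumes s: "direct_system C I r X t" and lin: "\<forall>i\<in>I. \<forall>j\<in>I. (i, j) \<in> r \<or> (j, i) \<in> r" and k: "k \<in> I"
    and L: "is_direct_limit C I r X t L l"
  shows "is_direct_limit C {i. (k, i) \<in> r} (r \<inter> {i. (k, i) \<in> r} \<times> {i. (k, i) \<in> r}) X t L l"
proof -
  note S = system_arr[OF s] and l = limit_arr[OF L]
  let ?J = "{i. (k, i) \<in> r}" let ?r = "r \<inter> ?J \<times> ?J"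
  have JI: "?J \<subseteq> I" using S(1) by blast
  show ?thesis
  proof (rule limitI)
    show "is_cocone C ?J ?r X t L l"
      using limit_cocone[OF L] JI unfolding is_cocone_def by blast
  next
    fix Y g assume g: "is_cocone C ?J ?r X t Y g"
    note g' = cocone_arr[OF g]
    define h where "h i = (if (k, i) \<in> r then g i else g k \<cdot> t i k)" for i
    have kk: "(k, k) \<in> r" using S(2)[OF k] .
    have ik: "(i, k) \<in> r" if "i \<in> I" "(k, i) \<notin> r" for i using lin that k by blast
    have h: "h i \<in> Arr C \<and> Dom C (h i) = X i \<and> Cod C (h i) = Y" if i: "i \<in> I" for i
    proof (cases "(k, i) \<in> r")
      case True
      then show ?thesis using g'(2-4)[of i] by (simp add: h_def)
    next
      case False
      show ?thesis using g'(2-4)[of k] kk S(6-8)[OF ik[OF i False]] False by (simp add: h_def)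
    qed
    have hc: "h j \<cdot> t i j = h i" if ij: "(i, j) \<in> r" for i j
    proof (cases "(k, i) \<in> r")
      case True
      then have kj: "(k, j) \<in> r" using S(3) ij by blast
      then show ?thesis using True g'(5)[of i j] ij by (simp add: h_def)
    next
      case False
      have i: "i \<in> I" and j: "j \<in> I" using S(1)[OF ij] by auto
      note ik' = ik[OF i False]
      show ?thesis
      proof (cases "(k, j) \<in> r")
        case True
        have "g j \<cdot> (t k j \<cdot> t i k) = g k \<cdot> t i k"
          by (rule reassoc[OF g'(5)])
              (use True kk g'(2-4)[of j] S(6-8)[OF ik'] S(6-8)[OF True] in auto)
        then show ?thesis using False True S(9)[OF ik' True] by (simp add: h_def)
      next
        case F: False
        note jk = ik[OF j F]
        show ?thesis using False F S(9)[OF ij jk] S(6-8)[OF ij] S(6-8)[OF jk] g'(2-4)[of k] kk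
          by (simp add: h_def assoc)
      qed
    qed
    have "is_cocone C I r X t Y h" unfolding is_cocone_def using h hc g'(1) by simp
    then obtain u where u: "u \<in> Arr C" "Dom C u = L" "Cod C u = Y" "\<forall>i\<in>I. u \<cdot> l i = h i"
      by (rule limit_factor[OF L])
    have "u \<cdot> l i = g i" if "i \<in> ?J" for i using u(4) that JI by (auto simp: h_def)
    then show "\<exists>u. u \<in> Arr C \<and> Dom C u = L \<and> Cod C u = Y \<and> (\<forall>i\<in>?J. u \<cdot> l i = g i)"
      using u by blast
  next
    fix f g assume fg: "f \<in> Arr C" "g \<in> Arr C" "Dom C f = L" "Dom C g = L" "Cod C f = Cod C g"
       "\<forall>i\<in>?J. f \<cdot> l i = g \<cdot> l i"
    show "f = g"
    proof (rule limit_joint_epi[OF L s fg(1-5)])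
      fix i assume i: "i \<in> I"
      obtain j where j: "j \<in> ?J" "(i, j) \<in> r" using lin i k S(2)[OF k] S(2)[OF i] by blast
      have jI: "j \<in> I" using j JI by blast
      have "(f \<cdot> l j) \<cdot> t i j = (g \<cdot> l j) \<cdot> t i j" using fg(6) j(1) by metis
      then show "f \<cdot> l i = g \<cdot> l i"
        using l(5)[OF j(2)] l(2-4)[OF jI] S(6-8)[OF j(2)] fg(1-5) by (simp add: assoc)
    qed
  qed
qed

end

context grothendieck_category
begin

text \<open>Above \<open>k\<close>, the arrows \<open>t k\<close> embed the fixed object
  \<open>X k\<close> compatibly in all objects of the system, so \<open>constant_mono_limit\<close>
  applies to that part.\<close>

lemma limit_mono:
  assumes I: "(I :: 'u set) \<prec> U" and s: "mono_chain I r X t" and L: "is_direct_limit C I r X t L l"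
      and k: "k \<in> I"
  shows "mono_arr C (l k)"
proof -
  have s': "direct_system C I r X t" and lin: "\<forall>i\<in>I. \<forall>j\<in>I. (i, j) \<in> r \<or> (j, i) \<in> r"
    and mono: "\<forall>i j. (i, j) \<in> r \<longrightarrow> mono_arr C (t i j)" using s by (simp_all add: mono_chain_def)
  note S = system_arr[OF s'] and l = limit_arr[OF L]
  let ?J = "{i. (k, i) \<in> r}"
  have J: "?J \<prec> U" by (rule small_subset[OF _ I]) (use S(1) in auto)
  have kk: "(k, k) \<in> r" using S(2)[OF k] .
  have "mono_arr C (l k \<cdot> t k k)"
    by (rule constant_mono_limit[OF J upset_system[OF s' lin k] upset_limit[OF s' lin k L], of "t k"
        "X k"])
      (use mono kk S(7,8,9) in auto)
  then show ?thesis using S(5)[OF k] l(2,3)[OF k] by simp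
qed

text \<open>Let \<open>A\<^sub>i \<subseteq> K\<close> be the preimage of \<open>X\<^sub>i\<close>. These subobjects become stationary at some \<open>A\<^sub>N\<close>,
  so for \<open>j \<ge> N\<close> the object \<open>K / A\<^sub>N\<close> embeds in \<open>L / X\<^sub>j\<close>. As the direct limit of the latter
  is zero, exactness gives \<open>K = A\<^sub>N\<close>.\<close>

lemma noetherian_factor:
  assumes I: "(I :: 'u set) \<prec> U" and s: "mono_chain I r X t" and L: "is_direct_limit C I r X t L l"
    and f: "f \<in> Arr C" "Cod C f = L" and K: "noetherian_obj C (Dom C f)"
  obtains i where "i \<in> I" "sub_le C f (l i)"
proof -
  have s': "direct_system C I r X t" and lin: "\<forall>i\<in>I. \<forall>j\<in>I. (i, j) \<in> r \<or> (j, i) \<in> r"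
    and mono: "\<forall>i j. (i, j) \<in> r \<longrightarrow> mono_arr C (t i j)" using s by (simp_all add: mono_chain_def)
  note S = system_arr[OF s'] and l = limit_arr[OF L]
  have lm: "mono_arr C (l i)" if "i \<in> I" for i using limit_mono[OF I s L that] .
  have "\<forall>i\<in>I. \<exists>a b. mono_arr C a \<and> Cod C a = Dom C f \<and> b \<in> Arr C \<and> Dom C b = Dom C a \<and>
      Cod C b = X i \<and> f \<cdot> a = l i \<cdot> b
     \<and> (\<forall>h. h \<in> Arr C \<longrightarrow> Cod C h = Dom C f \<longrightarrow> sub_le C (f \<cdot> h) (l i) \<longrightarrow> sub_le C h a)"
  proof
    fix i assume i: "i \<in> I"
    have c: "Cod C f = Cod C (l i)" using f(2) l(4)[OF i] by simp
    obtain a b where "mono_arr C a" "Cod C a = Dom C f" "b \<in> Arr C" "Dom C b = Dom C a"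
        "Cod C b = Dom C (l i)" "f \<cdot> a = l i \<cdot> b"
      "epi_arr C f \<longrightarrow> epi_arr C b"
      "\<forall>h. h \<in> Arr C \<longrightarrow> Cod C h = Dom C f \<longrightarrow> sub_le C (f \<cdot> h) (l i) \<longrightarrow> sub_le C h a"
      using preimage[OF f(1) lm[OF i] c] .
    then show "\<exists>a b. mono_arr C a \<and> Cod C a = Dom C f \<and> b \<in> Arr C \<and> Dom C b = Dom C a \<and>
        Cod C b = X i \<and> f \<cdot> a = l i \<cdot> b
     \<and> (\<forall>h. h \<in> Arr C \<longrightarrow> Cod C h = Dom C f \<longrightarrow> sub_le C (f \<cdot> h) (l i) \<longrightarrow> sub_le C h a)"
      using l(3)[OF i] by (intro exI[of _ a] exI[of _ b]) simp
  qed
  then obtain a b where ab: "\<forall>i\<in>I. mono_arr C (a i) \<and> Cod C (a i) = Dom C f \<and> b i \<in> Arr C \<and>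
      Dom C (b i) = Dom C (a i) \<and>
     Cod C (b i) = X i \<and> f \<cdot> a i = l i \<cdot> b i
     \<and> (\<forall>h. h \<in> Arr C \<longrightarrow> Cod C h = Dom C f \<longrightarrow> sub_le C (f \<cdot> h) (l i) \<longrightarrow> sub_le C h (a i))"
    unfolding bchoice_iff by blast
  then have a: "\<And>i. i \<in> I \<Longrightarrow> mono_arr C (a i)" "\<And>i. i \<in> I \<Longrightarrow> Cod C (a i) = Dom C f"
     "\<And>i. i \<in> I \<Longrightarrow> b i \<in> Arr C" "\<And>i. i \<in> I \<Longrightarrow> Dom C (b i) = Dom C (a i)"
         "\<And>i. i \<in> I \<Longrightarrow> Cod C (b i) = X i"
     "\<And>i. i \<in> I \<Longrightarrow> f \<cdot> a i = l i \<cdot> b i"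
     "\<And>i h. i \<in> I \<Longrightarrow> h \<in> Arr C \<Longrightarrow> Cod C h = Dom C f \<Longrightarrow> sub_le C (f \<cdot> h) (l i) \<Longrightarrow> sub_le C h (a i)"
    by blast+
  have a_mono: "sub_le C (a i) (a j)" if ij: "(i, j) \<in> r" for i j
  proof (rule a(7))
    have i: "i \<in> I" and j: "j \<in> I" using S(1)[OF ij] by auto
    show "j \<in> I" by (rule j)
    have "f \<cdot> a i = l j \<cdot> (t i j \<cdot> b i)"
      unfolding a(6)[OF i] using reassoc[OF l(5)[OF ij], of "b i"] a(3-5)[OF i] S(6-8)[OF ij] l(2-4)[OF j] by simp
    then show "sub_le C (f \<cdot> a i) (l j)"
      using a(3-5)[OF i] S(6-8)[OF ij] l(2-4)[OF j] by (intro sub_leI[of "t i j \<cdot> b i"]) simp_all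
    show "a i \<in> Arr C" "Cod C (a i) = Dom C f" using a(1,2)[OF i] by simp_all
  qed
  have "\<And>m. m \<in> a ` I \<Longrightarrow> mono_arr C m \<and> Cod C m = Dom C f" using a(1,2) by auto
  moreover have "a ` I \<noteq> {}" using S(11) by simp
  ultimately obtain m where m: "m \<in> a ` I" "\<And>n. n \<in> a ` I \<Longrightarrow> sub_le C m n \<Longrightarrow> sub_le C n m"
    using noetherian_maximal[OF K] by metis
  obtain N where N: "N \<in> I" "m = a N" using m(1) by blast
  have aN: "mono_arr C (a N)" "Cod C (a N) = Dom C f" using a N by auto
  let ?J = "{i. (N, i) \<in> r}" let ?r = "r \<inter> ?J \<times> ?J"
  have JI: "j \<in> I" if "j \<in> ?J" for j using S(1) that by blast
  have J: "?J \<prec> U" by (rule small_subset[OF _ I]) (use S(1) in auto)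
  \<comment> \<open>The preimages grow with the index, so by maximality of \<open>a N\<close> all
    later ones are contained in it.\<close>
  have stat: "sub_le C (a j) (a N)" if j: "j \<in> ?J" for j
    using m(2)[of "a j"] a_mono[of N j] that JI[OF j] unfolding N(2) by blast
  obtain d where d: "is_cokernel C (a N) d" using obtain_cokernel aN(1) by (metis mono_arr_arr)
  note d' = cokernel_arr[OF d]
  have "\<exists>q. is_cokernel C (l j) q" if "j \<in> I" for j using obtain_cokernel l(2)[OF that] by blast
  then obtain q where q: "\<And>j. j \<in> I \<Longrightarrow> is_cokernel C (l j) (q j)" by metis
  note q' = cokernel_arr[OF q]
  have qa: "q j \<in> Arr C" "Dom C (q j) = L" "epi_arr C (q j)" if "j \<in> I" for j
    using q'[OF that] l(4)[OF that] by auto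
  have ql: "zero_arr (q k \<cdot> l j)" if jk: "(j, k) \<in> r" for j k
  proof -
    have j: "j \<in> I" and k: "k \<in> I" using S(1)[OF jk] by auto
    have "sub_le C (l j) (l k)" using S(6-8)[OF jk] l(2-4)[OF k] l(5)[OF jk]
        by (intro sub_leI[of "t j k"]) simp_all
    then show ?thesis using mono_cokernel_iff[OF lm[OF k] q[OF k], of "l j"] l(2-4)[OF j] l(4)[OF k]
        by simp
  qed
  define Y where "Y j = Cod C (q j)" for j
  have "\<exists>w. w \<in> Arr C \<and> Dom C w = Y j \<and> Cod C w = Y k \<and> w \<cdot> q j = q k" if jk: "(j, k) \<in> r" for j k
  proof -
    have j: "j \<in> I" and k: "k \<in> I" using S(1)[OF jk] by auto
    have "Dom C (q k) = Cod C (l j)" using qa[OF k] l(4)[OF j] by simp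
    then show ?thesis using cokernel_factor[OF q[OF j] qa(1)[OF k] _ ql[OF jk]] unfolding Y_def
        by metis
  qed
  then obtain w where w: "\<And>j k. (j, k) \<in> r \<Longrightarrow> w j k \<in> Arr C" "\<And>j k. (j, k) \<in> r \<Longrightarrow> Dom C (w j k) = Y j"
    "\<And>j k. (j, k) \<in> r \<Longrightarrow> Cod C (w j k) = Y k" "\<And>j k. (j, k) \<in> r \<Longrightarrow> w j k \<cdot> q j = q k"
    by metis
  have sY: "direct_system C I r Y w"
    unfolding direct_system_def
  proof (intro conjI ballI allI impI)
    show "directed_set I r" using s' by (simp add: direct_system_def)
    fix j assume j: "j \<in> I"
    show "Y j \<in> Obj C" unfolding Y_def using qa[OF j] by simp
    show "w j j = Ident C (Y j)"
      by (rule epi_cancel[OF qa(3)[OF j]]) (use w[OF S(2)[OF j]] qa[OF j] in \<open>auto simp: Y_def\<close>)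
  next
    fix j k i assume jk: "(j, k) \<in> r" and ki: "(k, i) \<in> r"
    have j: "j \<in> I" and k: "k \<in> I" using S(1)[OF jk] by auto
    have ji: "(j, i) \<in> r" using S(3)[OF jk ki] .
    have *: "(w k i \<cdot> w j k) \<cdot> q j = w j i \<cdot> q j"
      using w[OF jk] w[OF ki] w[OF ji] qa[OF j] by (simp add: assoc Y_def)
    show "w k i \<cdot> w j k = w j i"
      by (rule epi_cancel[OF qa(3)[OF j] *])
          (use w(1-3)[OF jk] w(1-3)[OF ki] w(1-3)[OF ji] in \<open>auto simp: Y_def\<close>)
  qed (use w in auto)
  obtain Z where Z: "zero_obj C Z" using ex_zero_obj by blast
  have ZO: "Z \<in> Obj C" using Z by (simp add: zero_obj_def)
  have YO: "Y j \<in> Obj C" if "j \<in> I" for j unfolding Y_def using qa[OF that] by simp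
  \<comment> \<open>For a cocone \<open>g\<close>, the arrows \<open>g j \<cdot> q j\<close> on
    \<open>L\<close> all agree and kill every \<open>l i\<close>. They vanish since \<open>L\<close>
    is the limit of the \<open>X i\<close>, and then so does \<open>g\<close>.\<close>
  have LZ: "is_direct_limit C I r Y w Z (\<lambda>j. ZeroArr C (Y j) Z)"
  proof (rule limitI)
    show "is_cocone C I r Y w Z (\<lambda>j. ZeroArr C (Y j) Z)"
      unfolding is_cocone_def using ZO YO w S(1) by auto
  next
    fix V g assume g: "is_cocone C I r Y w V g"
    note g' = cocone_arr[OF g]
    have gq: "g j \<cdot> q j = g k \<cdot> q k" if jk: "(j, k) \<in> r" for j k
    proof -
      have j: "j \<in> I" and k: "k \<in> I" using S(1)[OF jk] by auto
      have "g k \<cdot> (w j k \<cdot> q j) = g j \<cdot> q j"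
        by (rule reassoc[OF g'(5)[OF jk]])
            (use w(1-3)[OF jk] qa[OF j] g'(2-4)[OF k] in \<open>auto simp: Y_def\<close>)
      then show ?thesis using w(4)[OF jk] by simp
    qed
    have z: "zero_arr (g j)" if j: "j \<in> I" for j
    proof -
      have "g j \<cdot> q j = ZeroArr C L V"
      proof (rule limit_joint_epi[OF L s'])
        fix i assume i: "i \<in> I"
        obtain k where k: "k \<in> I" "(i, k) \<in> r" "(j, k) \<in> r" using S(10)[OF i j] by blast
        have "zero_arr (g k \<cdot> (q k \<cdot> l i))"
          by (rule zero_arr_comp_left[OF ql[OF k(2)]])
              (use qa[OF k(1)] l(2-4)[OF i] g'(2-4)[OF k(1)] in \<open>auto simp: Y_def\<close>)
        then have "zero_arr ((g j \<cdot> q j) \<cdot> l i)"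
          unfolding gq[OF k(3)] using qa[OF k(1)] l(2-4)[OF i] g'(2-4)[OF k(1)]
              by (simp add: assoc Y_def)
        then show "(g j \<cdot> q j) \<cdot> l i = ZeroArr C L V \<cdot> l i"
          using qa[OF j] l(2-4)[OF i] l(1) g'(1) g'(2-4)[OF j] by (simp add: zero_arr_def Y_def)
      qed (use qa[OF j] l(1) g'(1) g'(2-4)[OF j] in \<open>auto simp: Y_def\<close>)
      then have "zero_arr (g j \<cdot> q j)" using l(1) g'(1) by simp
      then show ?thesis using epi_zero_arr[OF qa(3)[OF j], of "g j"] g'(2-4)[OF j]
          by (simp add: Y_def)
    qed
    have "ZeroArr C Z V \<cdot> ZeroArr C (Y j) Z = g j" if j: "j \<in> I" for j
      using z[OF j] g'(1) g'(2-4)[OF j] ZO YO[OF j] by (simp add: zero_arr_def)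
    then show "\<exists>u. u \<in> Arr C \<and> Dom C u = Z \<and> Cod C u = V \<and> (\<forall>i\<in>I. u \<cdot> ZeroArr C (Y i) Z = g i)"
      using ZO g'(1) by (intro exI[of _ "ZeroArr C Z V"]) simp
  next
    fix f g assume fg: "f \<in> Arr C" "g \<in> Arr C" "Dom C f = Z" "Dom C g = Z" "Cod C f = Cod C g"
    show "f = g"
      by (rule zero_arr_eq) (use fg Z zero_obj_Dom[of f] zero_obj_Dom[of g] in auto)
  qed
  \<comment> \<open>The kernel of \<open>q j \<cdot> f\<close> is the preimage \<open>a j\<close>,
    which is contained in \<open>a N\<close>; so the induced arrow on the cokernel of
    \<open>a N\<close> is monic.\<close>
  have "\<exists>e. mono_arr C e \<and> Dom C e = Cod C d \<and> Cod C e = Y j \<and> e \<cdot> d = q j \<cdot> f" if j: "j \<in> ?J" for j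
  proof -
    note jI = JI[OF j]
    have Nj: "(N, j) \<in> r" using j by simp
    have qf: "q j \<cdot> f \<in> Arr C" "Dom C (q j \<cdot> f) = Dom C f" "Cod C (q j \<cdot> f) = Y j" using qa[OF jI] f
        by (auto simp: Y_def)
    have "(q j \<cdot> f) \<cdot> a N = (q j \<cdot> l N) \<cdot> b N"
      using a(6)[OF N(1)] a(3-5)[OF N(1)] aN qa[OF jI] f l(2-4)[OF N(1)] by (simp add: assoc)
    moreover have "zero_arr ((q j \<cdot> l N) \<cdot> b N)"
      by (rule zero_arr_comp_right[OF ql[OF Nj]])
          (use a(3-5)[OF N(1)] l(2-4)[OF N(1)] qa[OF jI] in auto)
    ultimately obtain e where e: "e \<in> Arr C" "Dom C e = Cod C d" "Cod C e = Y j" "e \<cdot> d = q j \<cdot> f"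
      using cokernel_factor[OF d qf(1)] aN qf by metis
    have "mono_arr C e"
    proof (rule mono_arrI)
      fix x assume x: "x \<in> Arr C" "Cod C x = Dom C e" "zero_arr (e \<cdot> x)"
      obtain p y where p: "epi_arr C p" "Cod C p = Dom C x" "y \<in> Arr C" "Dom C y = Dom C p"
          "Cod C y = Dom C d" "d \<cdot> y = x \<cdot> p"
        by (rule epi_lift[of d x]) (use d' x e in auto)
      have dd: "Dom C d = Dom C f" using d' aN by simp
      have "zero_arr ((e \<cdot> x) \<cdot> p)" by (rule zero_arr_comp_right) (use x p e in auto)
      then have "zero_arr (e \<cdot> (d \<cdot> y))" using x p e by (simp add: assoc)
      moreover have "e \<cdot> (d \<cdot> y) = (q j \<cdot> f) \<cdot> y" by (rule reassoc[OF e(4)]) (use p d' e in auto)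
      ultimately have "zero_arr (q j \<cdot> (f \<cdot> y))" using p dd f qa[OF jI] by (simp add: assoc)
      then have "sub_le C (f \<cdot> y) (l j)"
        using mono_cokernel_factor[OF lm[OF jI] q[OF jI], of "f \<cdot> y"] p dd f l(4)[OF jI] by simp
      then have "sub_le C y (a j)" using a(7)[OF jI p(3)] p dd by simp
      then have "sub_le C y (a N)" using stat[OF j] aN by (metis sub_le_trans mono_arr_arr)
      then have "zero_arr (d \<cdot> y)" using mono_cokernel_iff[OF aN(1) d, of y] p dd aN by simp
      then show "zero_arr x" using epi_zero_arr[OF p(1), of x] p x by simp
    qed (rule e)
    then show ?thesis using e by blast
  qed
  then obtain e where e: "\<And>j. j \<in> ?J \<Longrightarrow> mono_arr C (e j)" "\<And>j. j \<in> ?J \<Longrightarrow> Dom C (e j) = Cod C d"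
    "\<And>j. j \<in> ?J \<Longrightarrow> Cod C (e j) = Y j" "\<And>j. j \<in> ?J \<Longrightarrow> e j \<cdot> d = q j \<cdot> f" by metis
  have NJ: "N \<in> ?J" using S(2)[OF N(1)] by simp
  \<comment> \<open>The cokernel of \<open>a N\<close> is a constant subobject of the system of
    quotients, hence embeds in the limit, which is the zero object.\<close>
  have "mono_arr C (ZeroArr C (Y N) Z \<cdot> e N)"
  proof (rule constant_mono_limit[OF J upset_system[OF sY lin N(1)] upset_limit[OF sY lin N(1) LZ] e(1-3) _ NJ])
    fix i j assume "(i, j) \<in> ?r"
    then have i: "i \<in> ?J" and j: "j \<in> ?J" and ij: "(i, j) \<in> r" by auto
    note iI = JI[OF i] and jI = JI[OF j]
    have ei: "e i \<in> Arr C" "e j \<in> Arr C" using e(1) i j by auto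
    have "(w i j \<cdot> e i) \<cdot> d = w i j \<cdot> (q i \<cdot> f)"
      using e(2-4)[OF i] ei w(1-3)[OF ij] d' by (simp add: assoc)
    also have "\<dots> = q j \<cdot> f"
      by (rule reassoc[OF w(4)[OF ij]]) (use f w(1-3)[OF ij] qa[OF iI] in \<open>auto simp: Y_def\<close>)
    also have "\<dots> = e j \<cdot> d" using e(4)[OF j] by simp
    finally have *: "(w i j \<cdot> e i) \<cdot> d = e j \<cdot> d" .
    show "w i j \<cdot> e i = e j"
      by (rule epi_cancel[OF d'(5) *]) (use e(2-3)[OF i] e(2-3)[OF j] ei w(1-3)[OF ij] in auto)
  qed
  moreover have eN: "e N \<in> Arr C" "Dom C (e N) = Cod C d" "Cod C (e N) = Y N" using e[OF NJ] by auto
  ultimately have "zero_obj C (Cod C d)"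
    using mono_zero_iff[of "ZeroArr C (Cod C d) Z"] ZO YO[OF N(1)] d' by simp
  then have "zero_arr d" using zero_obj_Cod d' by simp
  then have "zero_arr (d \<cdot> Ident C (Dom C f))" using d' aN by simp
  then have "sub_le C (Ident C (Dom C f)) (a N)"
    using mono_cokernel_factor[OF aN(1) d, of "Ident C (Dom C f)"] aN f by simp
  then obtain u where u: "u \<in> Arr C" "Dom C u = Dom C f" "Cod C u = Dom C (a N)"
      "a N \<cdot> u = Ident C (Dom C f)"
    using f by (auto elim!: sub_leE)
  have aN': "a N \<in> Arr C" using aN by simp
  have "(f \<cdot> a N) \<cdot> u = f" using assoc[of u "a N" f] u aN' aN(2) f by simp
  then have "l N \<cdot> (b N \<cdot> u) = f"
    unfolding a(6)[OF N(1)] using u(1-3) a(3-5)[OF N(1)] l(2-4)[OF N(1)] by (simp add: assoc)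
  then have "sub_le C f (l N)"
    using u(1-3) a(3-5)[OF N(1)] l(2-4)[OF N(1)] by (intro sub_leI[of "b N \<cdot> u"]) simp_all
  then show ?thesis using that N(1) by blast
qed

end

section \<open>Noetherian generators\<close>

text \<open>Fixes one of the sets of generators that are known to exist, so that the definitions
  below can refer to it.\<close>

locale noetherian_generators = grothendieck_category C U
  for C :: "('o, 'm) category" (structure) and U :: "'u set" +
  fixes \<G> :: "'o set"
  assumes small_gen: "\<G> \<prec> U"
    and generating_gen: "generating_set C \<G>"
    and noetherian_gen: "G \<in> \<G> \<Longrightarrow> noetherian_obj C G"
begin

text \<open>Generalised elements. There is only a small set of them, yet they detect nonzero arrows
  and inclusions of subobjects.\<close>

definition elements :: "'o \<Rightarrow> 'm set" where
  "elements X = {h \<in> Arr C. Dom C h \<in> \<G> \<and> Cod C h = X}"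

lemma elements_arr: "h \<in> elements X \<Longrightarrow> h \<in> Arr C \<and> Dom C h \<in> \<G> \<and> Cod C h = X"
  by (simp add: elements_def)

lemma small_elements:
  assumes "X \<in> Obj C" shows "elements X \<prec> U"
proof (rule small_subset)
  have G: "\<G> \<subseteq> Obj C" using generating_gen by (simp add: generating_set_def)
  show "elements X \<subseteq> snd ` (SIGMA G:\<G>. Hom C G X)" by (force simp: elements_def)
  show "snd ` (SIGMA G:\<G>. Hom C G X) \<prec> U"
    by (rule small_image, rule small_Sigma[OF universe small_gen]) (use G small_Hom assms in blast)
qed

lemma gen_test:
  assumes "x \<in> Arr C" "\<not> zero_arr x"
  obtains h where "h \<in> elements (Dom C x)" "\<not> zero_arr (x \<cdot> h)"
proof -
  let ?z = "ZeroArr C (Dom C x) (Cod C x)"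
  have "x \<noteq> ?z" using assms by (simp add: zero_arr_def)
  moreover have "x \<in> Hom C (Dom C x) (Cod C x)" "?z \<in> Hom C (Dom C x) (Cod C x)" using assms
      by simp_all
  ultimately obtain G h where h: "G \<in> \<G>" "h \<in> Hom C G (Dom C x)" "x \<cdot> h \<noteq> ?z \<cdot> h"
    using generating_gen unfolding generating_set_def by meson
  have "h \<in> elements (Dom C x)" using h by (simp add: elements_def)
  moreover have "\<not> zero_arr (x \<cdot> h)" using h assms by (simp add: zero_arr_def)
  ultimately show ?thesis by (rule that)
qed

text \<open>If \<open>m\<close> did not lie in \<open>n\<close>, its composite with the cokernel of
  \<open>n\<close> would be nonzero, and some element of \<open>Dom C m\<close> would detect
  this.\<close>

lemma sub_le_test:
  assumes "mono_arr C n" "m \<in> Arr C" "Cod C m = Cod C n"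
    "\<And>h. h \<in> elements (Cod C n) \<Longrightarrow> sub_le C h m \<Longrightarrow> sub_le C h n"
  shows "sub_le C m n"
proof (rule ccontr)
  assume *: "\<not> sub_le C m n"
  obtain q where q: "is_cokernel C n q" using obtain_cokernel assms(1) by (metis mono_arr_arr)
  note q' = cokernel_arr[OF q]
  have "\<not> zero_arr (q \<cdot> m)" using mono_cokernel_factor[OF assms(1) q assms(2,3)] * by blast
  then obtain h where h: "h \<in> elements (Dom C (q \<cdot> m))" "\<not> zero_arr ((q \<cdot> m) \<cdot> h)"
    using gen_test[of "q \<cdot> m"] q' assms by auto
  then have h': "h \<in> Arr C" "Dom C h \<in> \<G>" "Cod C h = Dom C m" using q' assms
      by (auto dest: elements_arr)
  have "m \<cdot> h \<in> elements (Cod C n)" using h' assms by (simp add: elements_def)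
  moreover have "sub_le C (m \<cdot> h) m" using h' assms by (auto intro: sub_leI)
  ultimately have "sub_le C (m \<cdot> h) n" using assms(4) by blast
  then have "zero_arr (q \<cdot> (m \<cdot> h))" using mono_cokernel_iff[OF assms(1) q, of "m \<cdot> h"] h' assms
      by simp
  then show False using h(2) h' q' assms by (simp add: assoc)
qed

text \<open>The union of a small chain of subobjects, obtained as the direct limit. It is again a
  subobject: an element of the kernel of \<open>v\<close> comes from some stage, where
  \<open>c i\<close> is monic. By the last clause the elements of the union are the elements of the
  stages.\<close>

lemma sub_chain_limit:
  fixes c :: "'u \<Rightarrow> 'm"
  assumes I: "I \<prec> U" "I \<noteq> {}" and c: "\<And>i. i \<in> I \<Longrightarrow> mono_arr C (c i)" "\<And>i. i \<in> I \<Longrightarrow> Cod C (c i) = P"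
    and lin: "\<And>i j. i \<in> I \<Longrightarrow> j \<in> I \<Longrightarrow> sub_le C (c i) (c j) \<or> sub_le C (c j) (c i)"
  obtains v where "mono_arr C v" "Cod C v = P" "\<forall>i\<in>I. sub_le C (c i) v"
    "\<forall>h. h \<in> Arr C \<longrightarrow> noetherian_obj C (Dom C h) \<longrightarrow> sub_le C h v \<longrightarrow> (\<exists>i\<in>I. sub_le C h (c i))"
proof -
  define r where "r = {(i, j). i \<in> I \<and> j \<in> I \<and> sub_le C (c i) (c j)}"
  define X where "X i = Dom C (c i)" for i
  have ca: "c i \<in> Arr C" if "i \<in> I" for i using c(1)[OF that] by simp
  have rI: "i \<in> I \<and> j \<in> I" if "(i, j) \<in> r" for i j using that by (simp add: r_def)
  have "\<exists>u. u \<in> Arr C \<and> Dom C u = X i \<and> Cod C u = X j \<and> c j \<cdot> u = c i" if "(i, j) \<in> r" for i j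
  proof -
    have "sub_le C (c i) (c j)" using that by (simp add: r_def)
    then show ?thesis unfolding X_def by (rule sub_leE) blast
  qed
  then obtain t where t: "\<And>i j. (i, j) \<in> r \<Longrightarrow> t i j \<in> Arr C" "\<And>i j. (i, j) \<in> r \<Longrightarrow> Dom C (t i j) = X i"
    "\<And>i j. (i, j) \<in> r \<Longrightarrow> Cod C (t i j) = X j" "\<And>i j. (i, j) \<in> r \<Longrightarrow> c j \<cdot> t i j = c i" by metis
  have refl: "(i, i) \<in> r" if "i \<in> I" for i using that sub_le_refl[OF ca[OF that]]
      by (simp add: r_def)
  have tr: "(i, k) \<in> r" if "(i, j) \<in> r" "(j, k) \<in> r" for i j k
    using that sub_le_trans[of "c i" "c j" "c k"] ca by (auto simp: r_def)
  have lin': "(i, j) \<in> r \<or> (j, i) \<in> r" if "i \<in> I" "j \<in> I" for i j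
    using lin[OF that] that by (auto simp: r_def)
  have s: "direct_system C I r X t"
    unfolding direct_system_def directed_set_def preorder_on_def
  proof (intro conjI ballI allI impI)
    show "I \<noteq> {}" by (rule I)
    show "r \<subseteq> I \<times> I" using rI by auto
    show "refl_on I r" using refl by (simp add: refl_on_def)
    show "trans r" by (rule transI) (rule tr)
    show "\<exists>k\<in>I. (i, k) \<in> r \<and> (j, k) \<in> r" if "i \<in> I" "j \<in> I" for i j
      using lin' refl that by blast
    fix i assume i: "i \<in> I"
    show "X i \<in> Obj C" unfolding X_def using ca[OF i] by simp
    show "t i i = Ident C (X i)"
      by (rule mono_cancel[OF c(1)[OF i]]) (use t[OF refl[OF i]] ca[OF i] in \<open>auto simp: X_def\<close>)
  next
    fix i j k assume ij: "(i, j) \<in> r" and jk: "(j, k) \<in> r"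
    have ik: "(i, k) \<in> r" using tr[OF ij jk] .
    have k: "k \<in> I" and j: "j \<in> I" using rI[OF jk] by auto
    have "c k \<cdot> (t j k \<cdot> t i j) = c j \<cdot> t i j"
      by (rule reassoc[OF t(4)[OF jk]])
          (use t(1-3)[OF ij] t(1-3)[OF jk] ca[OF k] in \<open>auto simp: X_def\<close>)
    then have *: "c k \<cdot> (t j k \<cdot> t i j) = c k \<cdot> t i k" using t(4)[OF ij] t(4)[OF ik] by simp
    show "t j k \<cdot> t i j = t i k"
      by (rule mono_cancel[OF c(1)[OF k] *])
          (use t(1-3)[OF ij] t(1-3)[OF jk] t(1-3)[OF ik] in \<open>auto simp: X_def\<close>)
  qed (use t in auto)
  have tm: "mono_arr C (t i j)" if ij: "(i, j) \<in> r" for i j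
    by (rule mono_comp_right[of "c j"]) (use t[OF ij] c(1) ca rI[OF ij] in \<open>auto simp: X_def\<close>)
  have mc: "mono_chain I r X t" unfolding mono_chain_def using s lin' tm by blast
  obtain L l where L: "is_direct_limit C I r X t L l" by (rule ex_direct_limit[OF I(1) s])
  note l = limit_arr[OF L]
  obtain i0 where i0: "i0 \<in> I" using I by blast
  have "P \<in> Obj C" using c(2)[OF i0] ca[OF i0] by auto
  then have "is_cocone C I r X t P c" unfolding is_cocone_def using ca c(2) t(4)
      by (simp add: X_def)
  then obtain v where v: "v \<in> Arr C" "Dom C v = L" "Cod C v = P" "\<forall>i\<in>I. v \<cdot> l i = c i"
    by (rule limit_factor[OF L])
  have fac: "\<exists>i\<in>I. \<exists>y. y \<in> Arr C \<and> Dom C y = Dom C x \<and> Cod C y = X i \<and> l i \<cdot> y = x \<and>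
      c i \<cdot> y = v \<cdot> x"
    if x: "x \<in> Arr C" "Cod C x = L" "noetherian_obj C (Dom C x)" for x
  proof -
    obtain i where i: "i \<in> I" "sub_le C x (l i)" by (rule noetherian_factor[OF I(1) mc L x])
    obtain y where y: "y \<in> Arr C" "Dom C y = Dom C x" "Cod C y = Dom C (l i)" "l i \<cdot> y = x"
      using i(2) by (rule sub_leE)
    have "v \<cdot> (l i \<cdot> y) = c i \<cdot> y"
      by (rule reassoc[OF v(4)[rule_format, OF i(1)]]) (use y(1-3) v(1-3) l(2-4)[OF i(1)] in auto)
    then show ?thesis using i(1) y l(3)[OF i(1)] by (intro bexI[of _ i] exI[of _ y]) auto
  qed
  have "mono_arr C v"
  proof (rule mono_arrI)
    fix x assume x: "x \<in> Arr C" "Cod C x = Dom C v" "zero_arr (v \<cdot> x)"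
    show "zero_arr x"
    proof (rule ccontr)
      assume "\<not> zero_arr x"
      then obtain h where h: "h \<in> elements (Dom C x)" "\<not> zero_arr (x \<cdot> h)" using gen_test x(1)
          by blast
      have h': "h \<in> Arr C" "Dom C h \<in> \<G>" "Cod C h = Dom C x" using elements_arr[OF h(1)] by auto
      have xh: "x \<cdot> h \<in> Arr C" "Cod C (x \<cdot> h) = L" "noetherian_obj C (Dom C (x \<cdot> h))"
        using h' x v noetherian_gen by auto
      obtain i y where i: "i \<in> I"
          and y: "y \<in> Arr C" "Dom C y = Dom C (x \<cdot> h)" "Cod C y = X i" "l i \<cdot> y = x \<cdot> h"
        "c i \<cdot> y = v \<cdot> (x \<cdot> h)" using fac[OF xh] by blast
      have "zero_arr ((v \<cdot> x) \<cdot> h)" by (rule zero_arr_comp_right) (use x h' v in auto)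
      then have "zero_arr (c i \<cdot> y)" using y(5) assoc[of h x v] x h' v(1-3) by simp
      then have "zero_arr y" using mono_zero_arr[OF c(1)[OF i], of y] y by (simp add: X_def)
      then have "zero_arr (l i \<cdot> y)" by (rule zero_arr_comp_left) (use y(1-3) l(2-4)[OF i] in auto)
      then show False using y(4) h(2) by simp
    qed
  qed (rule v)
  moreover have "\<forall>i\<in>I. sub_le C (c i) v"
  proof
    fix i assume i: "i \<in> I"
    show "sub_le C (c i) v" by (rule sub_leI[of "l i"]) (use v i l(2-4)[OF i] in auto)
  qed
  moreover have "\<exists>i\<in>I. sub_le C h (c i)"
      if h: "h \<in> Arr C" "noetherian_obj C (Dom C h)" "sub_le C h v" for h
  proof -
    obtain x where x: "x \<in> Arr C" "Dom C x = Dom C h" "Cod C x = Dom C v" "v \<cdot> x = h" using h(3)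
        by (rule sub_leE)
    obtain i y where i: "i \<in> I" and y: "y \<in> Arr C" "Cod C y = X i" "c i \<cdot> y = v \<cdot> x"
      using fac[of x] x h v by auto
    have "sub_le C h (c i)" by (rule sub_leI[of y]) (use y x ca[OF i] in \<open>auto simp: X_def\<close>)
    then show ?thesis using i by blast
  qed
  ultimately show ?thesis using that v(3) by blast
qed

text \<open>Divide by a subobject of the codomain that is maximal among those meeting \<open>i\<close> in zero.
  Zorn's lemma is applied to the sets of elements of these subobjects.\<close>

lemma essential_quotient:
  assumes i: "mono_arr C i"
  obtains p where "epi_arr C p" "Dom C p = Cod C i" "essential_mono C (p \<cdot> i)"
proof -
  let ?P = "Cod C i"
  have i': "i \<in> Arr C" using i by simp
  \<comment> \<open>The subobjects that meet \<open>i\<close> in zero, expressed by commuting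
    squares instead of an intersection.\<close>
  define K where "K = {c. mono_arr C c \<and> Cod C c = ?P \<and> (\<forall>x y. x \<in> Arr C \<longrightarrow> y \<in> Arr C \<longrightarrow>
      Cod C x = Dom C c \<longrightarrow>
     Cod C y = Dom C i \<longrightarrow> c \<cdot> x = i \<cdot> y \<longrightarrow> zero_arr (c \<cdot> x))}"
  define el where "el c = {h \<in> elements ?P. sub_le C h c}" for c
  have el_le: "sub_le C c c'" if "c \<in> K" "c' \<in> K" "el c \<subseteq> el c'" for c c'
    by (rule sub_le_test) (use that in \<open>auto simp: K_def el_def\<close>)
  have le_el: "el c \<subseteq> el c'" if "c' \<in> K" "sub_le C c c'" for c c'
    using that sub_le_trans[of _ c c'] by (auto simp: K_def el_def)
  have "\<exists>M\<in>el ` K. \<forall>X\<in>el ` K. M \<subseteq> X \<longrightarrow> X = M"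
  proof (rule subset_Zorn_nonempty)
    obtain Z where Z: "zero_obj C Z" using ex_zero_obj by blast
    have ZO: "Z \<in> Obj C" using Z by (simp add: zero_obj_def)
    have m: "mono_arr C (ZeroArr C Z ?P)"
      by (rule mono_arrI) (use i' ZO Z zero_obj_Cod in auto)
    have "ZeroArr C Z ?P \<in> K" unfolding K_def
    proof (intro CollectI conjI allI impI)
      fix x assume "x \<in> Arr C" "Cod C x = Dom C (ZeroArr C Z ?P)"
      then show "zero_arr (ZeroArr C Z ?P \<cdot> x)" using i' ZO by simp
    qed (use m i' ZO in auto)
    then show "el ` K \<noteq> {}" by blast
  next
    fix \<C> assume ne: "\<C> \<noteq> {}" and ch: "subset.chain (el ` K) \<C>"
    have CK: "\<C> \<subseteq> el ` K" and lin: "\<And>A B. A \<in> \<C> \<Longrightarrow> B \<in> \<C> \<Longrightarrow> A \<subseteq> B \<or> B \<subseteq> A"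
      using ch by (auto simp: subset_chain_def)
    have "\<forall>S\<in>\<C>. \<exists>c\<in>K. el c = S" using CK by blast
    then obtain cc where cc: "\<And>S. S \<in> \<C> \<Longrightarrow> cc S \<in> K" "\<And>S. S \<in> \<C> \<Longrightarrow> el (cc S) = S" by metis
    have "\<C> \<subseteq> Pow (elements ?P)" using CK by (auto simp: el_def)
    \<comment> \<open>A chain of monomorphisms could be too large to index a limit. A chain of sets
      of elements consists of subsets of a small set and is therefore small.\<close>
    then have "\<C> \<prec> U" by (rule small_subset) (use small_Pow[OF universe small_elements] i' in simp)
    then obtain \<psi> :: "'m set \<Rightarrow> 'u" where \<psi>: "inj_on \<psi> \<C>" "\<psi> ` \<C> \<prec> U" using small_index by metis
    define c where "c j = cc (inv_into \<C> \<psi> j)" for j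
    have c\<psi>: "c (\<psi> S) = cc S" if "S \<in> \<C>" for S using \<psi>(1) that by (simp add: c_def)
    obtain v where v: "mono_arr C v" "Cod C v = ?P" "\<forall>j\<in>\<psi> ` \<C>. sub_le C (c j) v"
      "\<forall>h. h \<in> Arr C \<longrightarrow> noetherian_obj C (Dom C h) \<longrightarrow> sub_le C h v \<longrightarrow> (\<exists>j\<in>\<psi> ` \<C>. sub_le C h (c j))"
    proof (rule sub_chain_limit[OF \<psi>(2), of c ?P])
      show "\<psi> ` \<C> \<noteq> {}" using ne by simp
      show "\<And>j. j \<in> \<psi> ` \<C> \<Longrightarrow> mono_arr C (c j)" "\<And>j. j \<in> \<psi> ` \<C> \<Longrightarrow> Cod C (c j) = ?P"
        using c\<psi> cc(1) by (auto simp: K_def)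
      show "sub_le C (c j) (c k) \<or> sub_le C (c k) (c j)" if jk: "j \<in> \<psi> ` \<C>" "k \<in> \<psi> ` \<C>" for j k
      proof -
        obtain A B where AB: "A \<in> \<C>" "B \<in> \<C>" "j = \<psi> A" "k = \<psi> B" using jk by blast
        show ?thesis using lin[OF AB(1,2)] el_le[of "cc A" "cc B"] el_le[of "cc B"
            "cc A"] cc[OF AB(1)] cc[OF AB(2)]
          unfolding AB(3,4) c\<psi>[OF AB(1)] c\<psi>[OF AB(2)] by metis
      qed
    qed
    have v': "v \<in> Arr C" using v(1) by simp
    have "el v = \<Union>\<C>"
    proof
      show "el v \<subseteq> \<Union>\<C>"
      proof
        fix h assume h: "h \<in> el v"
        then have h': "h \<in> elements ?P" "sub_le C h v" by (auto simp: el_def)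
        then obtain j where "j \<in> \<psi> ` \<C>" "sub_le C h (c j)"
          using v(4) elements_arr[OF h'(1)] noetherian_gen by blast
        then obtain S where S: "S \<in> \<C>" "sub_le C h (cc S)" using c\<psi> by auto
        then have "h \<in> el (cc S)" using h' by (simp add: el_def)
        then show "h \<in> \<Union>\<C>" using cc(2)[OF S(1)] S(1) by blast
      qed
      show "\<Union>\<C> \<subseteq> el v"
      proof
        fix h assume "h \<in> \<Union>\<C>"
        then obtain S where S: "S \<in> \<C>" "h \<in> S" by blast
        then have "h \<in> el (cc S)" using cc(2) by blast
        moreover have "sub_le C (cc S) v" using v(3) S(1) c\<psi>[OF S(1)] by auto
        ultimately show "h \<in> el v" using v' sub_le_trans[of h "cc S" v] by (simp add: el_def)
      qed
    qed
    \<comment> \<open>If the union met \<open>i\<close> nontrivially, this would be visible on an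
      element, which lies in some \<open>cc S\<close>; but \<open>cc S\<close> meets
      \<open>i\<close> in zero.\<close>
    moreover have "v \<in> K" unfolding K_def
    proof (intro CollectI conjI allI impI)
      fix x y assume xy: "x \<in> Arr C" "y \<in> Arr C" "Cod C x = Dom C v" "Cod C y = Dom C i"
          "v \<cdot> x = i \<cdot> y"
      show "zero_arr (v \<cdot> x)"
      proof (rule ccontr)
        assume nz: "\<not> zero_arr (v \<cdot> x)"
        have vx: "v \<cdot> x \<in> Arr C" "Dom C (v \<cdot> x) = Dom C x" using xy(1-4) v' by auto
        obtain h where h: "h \<in> elements (Dom C (v \<cdot> x))" "\<not> zero_arr ((v \<cdot> x) \<cdot> h)"
          using gen_test[OF vx(1) nz] .
        have h': "h \<in> Arr C" "Dom C h \<in> \<G>" "Cod C h = Dom C x" using elements_arr[OF h(1)] vx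
            by auto
        have 1: "(v \<cdot> x) \<cdot> h = v \<cdot> (x \<cdot> h)" using assoc[of h x v] h' xy(1-4) v' by simp
        have "Dom C (v \<cdot> x) = Dom C (i \<cdot> y)" by (simp only: xy(5))
        then have yD: "Dom C y = Dom C x" using xy(1-4) i' v' by simp
        have 2: "(v \<cdot> x) \<cdot> h = i \<cdot> (y \<cdot> h)"
          unfolding xy(5) by (rule assoc) (use h' xy(1-4) yD i' v' in auto)
        have "sub_le C ((v \<cdot> x) \<cdot> h) v" unfolding 1 by (rule sub_leI[of "x \<cdot> h"])
            (use h' xy(1-4) v' in auto)
        moreover have "(v \<cdot> x) \<cdot> h \<in> Arr C" "Dom C ((v \<cdot> x) \<cdot> h) = Dom C h" using h' vx by simp_all
        ultimately obtain j where "j \<in> \<psi> ` \<C>" "sub_le C ((v \<cdot> x) \<cdot> h) (c j)"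
          using v(4) noetherian_gen h'(2) by metis
        then obtain S where S: "S \<in> \<C>" "sub_le C ((v \<cdot> x) \<cdot> h) (cc S)" using c\<psi> by auto
        then obtain z where z: "z \<in> Arr C" "Cod C z = Dom C (cc S)" "cc S \<cdot> z = (v \<cdot> x) \<cdot> h"
          by (auto elim: sub_leE)
        have "cc S \<cdot> z = i \<cdot> (y \<cdot> h)" using z(3) 2 by simp
        moreover have "y \<cdot> h \<in> Arr C" "Cod C (y \<cdot> h) = Dom C i" using h' xy(1-4) yD by auto
        ultimately have "zero_arr (cc S \<cdot> z)" using cc(1)[OF S(1)] z(1,2) unfolding K_def by blast
        then show False using z(3) h(2) by simp
      qed
    qed (use v in auto)
    ultimately show "\<Union>\<C> \<in> el ` K" by blast
  qed
  then obtain c where c: "c \<in> K" and max: "\<And>c'. c' \<in> K \<Longrightarrow> el c \<subseteq> el c' \<Longrightarrow> el c' = el c" by blast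
  have cm: "mono_arr C c" "Cod C c = ?P" and cK: "\<And>x y. x \<in> Arr C \<Longrightarrow> y \<in> Arr C \<Longrightarrow> Cod C x = Dom C c \<Longrightarrow>
     Cod C y = Dom C i \<Longrightarrow> c \<cdot> x = i \<cdot> y \<Longrightarrow> zero_arr (c \<cdot> x)"
    using c unfolding K_def by blast+
  have max': "sub_le C c' c" if "c' \<in> K" "sub_le C c c'" for c'
    using max[OF that(1)] le_el[OF that] el_le[OF that(1) c] by simp
  obtain p where p: "is_cokernel C c p" using obtain_cokernel cm(1) by (metis mono_arr_arr)
  note p' = cokernel_arr[OF p]
  have pD: "Dom C p = ?P" using p' cm by simp
  have pim: "mono_arr C (p \<cdot> i)"
  proof (rule mono_arrI)
    show "p \<cdot> i \<in> Arr C" using p' pD i' by simp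
    fix y assume y: "y \<in> Arr C" "Cod C y = Dom C (p \<cdot> i)" "zero_arr ((p \<cdot> i) \<cdot> y)"
    then have y2: "Cod C y = Dom C i" using p' pD i' by simp
    have "zero_arr (p \<cdot> (i \<cdot> y))" using y(1,3) y2 p' pD i' by (simp add: assoc)
    then have "sub_le C (i \<cdot> y) c" using mono_cokernel_factor[OF cm(1) p, of "i \<cdot> y"] y(1) y2 i' cm
        by simp
    then obtain x where x: "x \<in> Arr C" "Cod C x = Dom C c" "c \<cdot> x = i \<cdot> y" by (auto elim: sub_leE)
    then have "zero_arr (i \<cdot> y)" using cK[of x y] y(1) y2 by simp
    then show "zero_arr y" using mono_zero_arr[OF i, of y] y(1) y2 by simp
  qed
  have "essential_mono C (p \<cdot> i)"
  proof (rule essential_monoI[OF pim])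
    fix x assume x: "x \<in> Arr C" "Cod C x = Cod C (p \<cdot> i)" "\<not> zero_arr x"
    have x2: "Cod C x = Cod C p" using x p' pD i' by simp
    show "\<exists>y z. y \<in> Arr C \<and> Cod C y = Dom C x \<and> \<not> zero_arr (x \<cdot> y) \<and> z \<in> Arr C \<and>
        Cod C z = Dom C (p \<cdot> i) \<and> (p \<cdot> i) \<cdot> z = x \<cdot> y"
    proof (rule ccontr)
      \<comment> \<open>Now the image \<open>m\<close> of \<open>x\<close> meets
        \<open>p \<cdot> i\<close> in zero. Its preimage \<open>c'\<close> under \<open>p\<close>
        contains \<open>c\<close> and still meets \<open>i\<close> in zero, so \<open>c'\<close> is
        no larger than \<open>c\<close> by maximality, and \<open>m\<close> vanishes.\<close>
      assume no: "\<not> ?thesis"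
      obtain m e where m: "mono_arr C m" "epi_arr C e" "Dom C m = Cod C e" "Cod C m = Cod C x"
        "Dom C e = Dom C x" "m \<cdot> e = x"
        using image_factorization[OF x(1)] .
      have arr: "m \<in> Arr C" "e \<in> Arr C" using m by simp_all
      have nm: "\<not> zero_arr m" using zero_arr_comp_right[of m e] m(3,6) x(3) arr by metis
      have c: "Cod C p = Cod C m" using m(4) x2 by simp
      obtain c' r where c': "mono_arr C c'" "Cod C c' = Dom C p" "r \<in> Arr C" "Dom C r = Dom C c'"
          "Cod C r = Dom C m"
        "p \<cdot> c' = m \<cdot> r" "epi_arr C p \<longrightarrow> epi_arr C r"
        "\<forall>h. h \<in> Arr C \<longrightarrow> Cod C h = Dom C p \<longrightarrow> sub_le C (p \<cdot> h) m \<longrightarrow> sub_le C h c'"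
        using preimage[OF p'(2) m(1) c] .
      have r: "epi_arr C r" using c'(7) p' by blast
      have ca: "c' \<in> Arr C" using c' by simp
      have "sub_le C (p \<cdot> c) m" by (rule zero_sub_le) (use p' cm arr c in auto)
      then have cc': "sub_le C c c'" using c'(8) cm pD by simp
      have "c' \<in> K" unfolding K_def
      proof (intro CollectI conjI allI impI)
        fix s y assume sy: "s \<in> Arr C" "y \<in> Arr C" "Cod C s = Dom C c'" "Cod C y = Dom C i"
            "c' \<cdot> s = i \<cdot> y"
        have "Dom C (c' \<cdot> s) = Dom C (i \<cdot> y)" by (simp only: sy(5))
        then have yD: "Dom C y = Dom C s" using sy(1-4) i' ca by simp
        have rs: "r \<cdot> s \<in> Arr C" "Cod C (r \<cdot> s) = Cod C e" "Dom C (r \<cdot> s) = Dom C s"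
            using c' sy m(3) by auto
        obtain g z where g: "epi_arr C g" "Cod C g = Dom C (r \<cdot> s)" "z \<in> Arr C" "Dom C z = Dom C g"
            "Cod C z = Dom C e"
          "e \<cdot> z = (r \<cdot> s) \<cdot> g"
          using epi_lift[OF m(2) rs(1,2)] .
        have ga: "g \<in> Arr C" "Cod C g = Dom C s" using g rs by auto
        have "x \<cdot> z = m \<cdot> ((r \<cdot> s) \<cdot> g)"
          unfolding m(6)[symmetric] g(6)[symmetric] by (rule assoc) (use g arr m(3) in auto)
        also have "\<dots> = ((m \<cdot> r) \<cdot> s) \<cdot> g" using c'(3-5) sy(1-3) ga arr by (simp add: assoc)
        also have "\<dots> = (p \<cdot> (c' \<cdot> s)) \<cdot> g" unfolding c'(6)[symmetric] using c'(2) ca sy(1-3) p'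
            by (simp add: assoc)
        also have "\<dots> = (p \<cdot> i) \<cdot> (y \<cdot> g)" unfolding sy(5) using sy(2,4) yD ga i' p' pD
            by (simp add: assoc)
        finally have xz: "x \<cdot> z = (p \<cdot> i) \<cdot> (y \<cdot> g)" .
        have yg: "y \<cdot> g \<in> Arr C" "Cod C (y \<cdot> g) = Dom C (p \<cdot> i)" using sy yD ga i' p' pD by auto
        have zc: "z \<in> Arr C" "Cod C z = Dom C x" using g m(5) by auto
        have "zero_arr (x \<cdot> z)" using no zc yg xz by metis
        then have "zero_arr (y \<cdot> g)" unfolding xz using mono_zero_arr[OF pim yg] by simp
        then have "zero_arr y" using epi_zero_arr[OF g(1), of y] sy(2) yD ga by simp
        then show "zero_arr (c' \<cdot> s)" unfolding sy(5) by (rule zero_arr_comp_left)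
            (use sy i' in auto)
      qed (use c' pD in auto)
      then have "sub_le C c' c" using max' cc' by blast
      then have "zero_arr (p \<cdot> c')" using mono_cokernel_iff[OF cm(1) p ca] c'(2) pD cm by simp
      then have "zero_arr m" unfolding c'(6) using epi_zero_arr[OF r arr(1)] c'(5) by simp
      then show False using nm by simp
    qed
  qed
  then show ?thesis using that p' pD by blast
qed

section \<open>Baer's criterion\<close>

definition baer :: "'o \<Rightarrow> bool" where
  "baer E \<longleftrightarrow> E \<in> Obj C \<and> (\<forall>k f. mono_arr C k \<longrightarrow> Cod C k \<in> \<G> \<longrightarrow> f \<in> Arr C \<longrightarrow> Dom C f = Dom C k \<longrightarrow>
      Cod C f = E \<longrightarrow>
     (\<exists>h. h \<in> Arr C \<and> Dom C h = Cod C k \<and> Cod C h = E \<and> h \<cdot> k = f))"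

text \<open>In the pushout of \<open>k\<close> and \<open>f\<close> the arrow \<open>f\<close>
  extends along \<open>k\<close>. Dividing by a suitable subobject makes the inclusion of
  \<open>Cod C f\<close> essential while the extension survives.\<close>

lemma essential_extension:
  assumes k: "mono_arr C k" and f: "f \<in> Arr C" "Dom C f = Dom C k"
  obtains e h where "essential_mono C e" "Dom C e = Cod C f" "h \<in> Arr C" "Dom C h = Cod C k"
      "Cod C h = Cod C e"
    "h \<cdot> k = e \<cdot> f"
proof -
  have k': "k \<in> Arr C" using k by simp
  obtain u v where u: "u \<in> Arr C" "v \<in> Arr C" "Cod C v = Cod C u" "Dom C u = Cod C f"
      "Dom C v = Cod C k"
    "u \<cdot> f = v \<cdot> k" "mono_arr C k \<Longrightarrow> mono_arr C u" "epi_arr C f \<Longrightarrow> epi_arr C v"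
    using pushout[OF f(1) k' f(2)] by blast
  obtain p where p: "epi_arr C p" "Dom C p = Cod C u" "essential_mono C (p \<cdot> u)"
    using essential_quotient[OF u(7)[OF k]] .
  have p': "p \<in> Arr C" using p by simp
  have "(p \<cdot> v) \<cdot> k = (p \<cdot> u) \<cdot> f"
    using assoc[of k v p] assoc[of f u p] u(1-6) p' p(2) k' f by simp
  then show ?thesis using that[of "p \<cdot> u" "p \<cdot> v"] p(3) u(1-5) p' p(2) by simp
qed

text \<open>Let \<open>h\<close> be an element of an essential extension of \<open>E\<close> and extend its restriction to the
  preimage of \<open>E\<close> to some \<open>w\<close>. The image of \<open>h - w\<close> meets \<open>E\<close> in zero, so \<open>h = w\<close>.\<close>

lemma baer_essential_iso:
  assumes E: "baer E" and e: "essential_mono C e" "Dom C e = E"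
  shows "epi_arr C e"
proof (rule epi_arrI)
  have em: "mono_arr C e" "e \<in> Arr C" using essential_mono_mono[OF e(1)] by auto
  show "e \<in> Arr C" by (rule em)
  have fac: "sub_le C h e" if h: "h \<in> elements (Cod C e)" for h
  proof -
    have h': "h \<in> Arr C" "Dom C h \<in> \<G>" "Cod C h = Cod C e" using elements_arr[OF h] by auto
    obtain k k' where k: "mono_arr C k" "Cod C k = Dom C h" "k' \<in> Arr C" "Dom C k' = Dom C k"
        "Cod C k' = Dom C e"
        "h \<cdot> k = e \<cdot> k'" "epi_arr C h \<longrightarrow> epi_arr C k'"
        "\<forall>x. x \<in> Arr C \<longrightarrow> Cod C x = Dom C h \<longrightarrow> sub_le C (h \<cdot> x) e \<longrightarrow> sub_le C x k"
      using preimage[OF h'(1) em(1) h'(3)] .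
    have ka: "k \<in> Arr C" using k by simp
    obtain w where w: "w \<in> Arr C" "Dom C w = Cod C k" "Cod C w = E" "w \<cdot> k = k'"
      using E k(1-5) h'(2) e(2) unfolding baer_def by metis
    let ?x = "sub_arr h (e \<cdot> w)"
    have ew: "e \<cdot> w \<in> Arr C" "Dom C (e \<cdot> w) = Dom C h" "Cod C (e \<cdot> w) = Cod C h"
        using w k(2) h' em e(2) by auto
    have x: "?x \<in> Arr C" "Dom C ?x = Dom C h" "Cod C ?x = Cod C e" using ew h' by auto
    have "zero_arr ?x"
    proof (rule ccontr)
      assume "\<not> zero_arr ?x"
      then obtain y z where y: "y \<in> Arr C" "Cod C y = Dom C ?x" "\<not> zero_arr (?x \<cdot> y)" "z \<in> Arr C"
          "Dom C z = Dom C y"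
        "Cod C z = Dom C e" "e \<cdot> z = ?x \<cdot> y"
        using essential_monoE[OF e(1) x(1,3)] by blast
      have y2: "Cod C y = Dom C h" using y(2) x(2) by simp
      have xy: "?x \<cdot> y = sub_arr (h \<cdot> y) ((e \<cdot> w) \<cdot> y)" by (rule sub_comp)
          (use y(1) y2 ew h' in auto)
      have wy: "w \<cdot> y \<in> Arr C" "Dom C (w \<cdot> y) = Dom C y" "Cod C (w \<cdot> y) = E"
          using w(1-3) y(1) y2 k(2) by auto
      \<comment> \<open>Suppose \<open>h - e \<cdot> w\<close> maps \<open>y\<close> into
        \<open>E\<close>. Adding \<open>e \<cdot> w\<close> back shows that \<open>h\<close> maps
        \<open>y\<close> into \<open>E\<close> as well, so \<open>y\<close> factors through the
        preimage \<open>k\<close>, where \<open>h\<close> and \<open>e \<cdot> w\<close>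
        agree.\<close>
      have "e \<cdot> AddArr C z (w \<cdot> y) = AddArr C (e \<cdot> z) (e \<cdot> (w \<cdot> y))"
        by (rule comp_add) (use y(4-6) wy em e(2) in auto)
      also have "e \<cdot> (w \<cdot> y) = (e \<cdot> w) \<cdot> y" using assoc[of y w e] w(1-3) y(1) y2 k(2) em e(2)
          by simp
      also have "AddArr C (e \<cdot> z) ((e \<cdot> w) \<cdot> y) = h \<cdot> y"
        unfolding y(7) xy by (rule sub_add_cancel) (use y(1) y2 ew h' in auto)
      finally have "e \<cdot> AddArr C z (w \<cdot> y) = h \<cdot> y" .
      then have "sub_le C (h \<cdot> y) e"
        using y(4-6) wy em e(2) by (intro sub_leI[of "AddArr C z (w \<cdot> y)"]) simp_all
      then have "sub_le C y k" using k(8) y(1) y2 by blast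
      then obtain v where v: "v \<in> Arr C" "Dom C v = Dom C y" "Cod C v = Dom C k" "k \<cdot> v = y"
          by (rule sub_leE)
      have "?x \<cdot> k = sub_arr (h \<cdot> k) ((e \<cdot> w) \<cdot> k)" by (rule sub_comp) (use ka k(2) ew h' in auto)
      moreover have "(e \<cdot> w) \<cdot> k = h \<cdot> k" using assoc[of k w e] w k(2,6) ka em e(2) by simp
      ultimately have "zero_arr (?x \<cdot> k)" using zero_arr_sub_iff[of "h \<cdot> k" "h \<cdot> k"] h' ka k(2)
          by simp
      then have "zero_arr ((?x \<cdot> k) \<cdot> v)" by (rule zero_arr_comp_right)
          (use v(1-3) ka k(2) x in auto)
      then have "zero_arr (?x \<cdot> y)" using assoc[of v k ?x] v ka k(2) x by simp
      then show False using y(3) by simp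
    qed
    then have "h = e \<cdot> w" by (rule iffD1[OF zero_arr_sub_iff[OF h'(1) ew]])
    then show ?thesis using w(1,3) em(2) e(2) by (intro sub_leI[of w]) auto
  qed
  fix f assume f: "f \<in> Arr C" "Dom C f = Cod C e" "zero_arr (f \<cdot> e)"
  show "zero_arr f"
  proof (rule ccontr)
    assume "\<not> zero_arr f"
    then obtain h where h: "h \<in> elements (Dom C f)" "\<not> zero_arr (f \<cdot> h)" using gen_test f(1)
        by blast
    then have "sub_le C h e" using fac f(2) by simp
    then obtain s where s: "s \<in> Arr C" "Cod C s = Dom C e" "e \<cdot> s = h" by (auto elim: sub_leE)
    have "zero_arr ((f \<cdot> e) \<cdot> s)" by (rule zero_arr_comp_right) (use s(1,2) f em in auto)
    then have "zero_arr (f \<cdot> h)" using assoc[of s e f] s f(1,2) em by simp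
    then show False using h(2) by simp
  qed
qed

text \<open>The arrow \<open>f\<close> extends along \<open>m\<close> in some essential extension of
  \<open>E\<close>. That extension is an isomorphism by \<open>baer_essential_iso\<close>, so the
  solution can be carried back to \<open>E\<close>.\<close>

lemma baer_injective:
  assumes E: "baer E" shows "injective_obj C E"
  unfolding injective_obj_def
proof (intro conjI allI impI)
  show "E \<in> Obj C" using E by (simp add: baer_def)
  fix m f assume mf: "mono_arr C m \<and> f \<in> Hom C (Dom C m) E"
  then have m: "mono_arr C m" and f: "f \<in> Arr C" "Dom C f = Dom C m" "Cod C f = E" by auto
  have m': "m \<in> Arr C" using m by simp
  obtain e h where e: "essential_mono C e" "Dom C e = Cod C f" "h \<in> Arr C" "Dom C h = Cod C m"
      "Cod C h = Cod C e"
    "h \<cdot> m = e \<cdot> f"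
    using essential_extension[OF m f(1,2)] .
  have eE: "Dom C e = E" using e(2) f(3) by simp
  have em: "mono_arr C e" "e \<in> Arr C" using essential_mono_mono[OF e(1)] by auto
  obtain s where s: "s \<in> Arr C" "Dom C s = Cod C e" "Cod C s = Dom C e" "e \<cdot> s = Ident C (Cod C e)"
    "s \<cdot> e = Ident C (Dom C e)"
    using mono_epi_inverse[OF em(1) baer_essential_iso[OF E e(1) eE]] .
  have "(s \<cdot> h) \<cdot> m = s \<cdot> (e \<cdot> f)" unfolding e(6)[symmetric] by (rule assoc)
      (use s(1-3) e(3-5) m' in auto)
  also have "\<dots> = f" using reassoc[OF s(5), of f] s(1-3) f em e(2) by simp
  finally show "\<exists>g\<in>Hom C (Cod C m) E. g \<cdot> m = f" using s(1-3) e(3-5) eE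
      by (intro bexI[of _ "s \<cdot> h"]) simp_all
qed

section \<open>Injective hulls\<close>

text \<open>A nonzero arrow into the limit is nonzero on some element. The element factors through a
  stage, because generators are noetherian, and each stage is an essential extension of
  \<open>X b\<close>.\<close>

lemma chain_limit_essential:
  assumes I: "(I :: 'u set) \<prec> U" and s: "mono_chain I r X t" and L: "is_direct_limit C I r X t L l"
      and b: "b \<in> I"
    and e: "\<And>i. i \<in> I \<Longrightarrow> (b, i) \<in> r" "\<And>i. i \<in> I \<Longrightarrow> essential_mono C (t b i)"
  shows "essential_mono C (l b)"
proof (rule essential_monoI)
  have s': "direct_system C I r X t" using s by (simp add: mono_chain_def)
  note S = system_arr[OF s'] and l = limit_arr[OF L]
  have lm: "mono_arr C (l i)" if "i \<in> I" for i using limit_mono[OF I s L that] .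
  show "mono_arr C (l b)" by (rule lm[OF b])
  fix x assume x: "x \<in> Arr C" "Cod C x = Cod C (l b)" "\<not> zero_arr x"
  have xL: "Cod C x = L" using x(2) l(4)[OF b] by simp
  obtain h where h: "h \<in> elements (Dom C x)" "\<not> zero_arr (x \<cdot> h)" using gen_test[OF x(1,3)] .
  have h': "h \<in> Arr C" "Dom C h \<in> \<G>" "Cod C h = Dom C x" using elements_arr[OF h(1)] by auto
  have xh: "x \<cdot> h \<in> Arr C" "Cod C (x \<cdot> h) = L" "Dom C (x \<cdot> h) = Dom C h" using h' x(1) xL by auto
  have "noetherian_obj C (Dom C (x \<cdot> h))" using noetherian_gen h'(2) xh(3) by simp
  then obtain i where i: "i \<in> I" "sub_le C (x \<cdot> h) (l i)"
      by (rule noetherian_factor[OF I s L xh(1,2)])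
  obtain v where v: "v \<in> Arr C" "Dom C v = Dom C (x \<cdot> h)" "Cod C v = Dom C (l i)" "l i \<cdot> v = x \<cdot> h"
    using i(2) by (rule sub_leE)
  note bi = e(1)[OF i(1)]
  have nv: "\<not> zero_arr v" using mono_zero_arr[OF lm[OF i(1)] v(1,3)] v(4) h(2) by simp
  have cv: "Cod C v = Cod C (t b i)" using v(3) S(8)[OF bi] l(3)[OF i(1)] by simp
  obtain y z where y: "y \<in> Arr C" "Cod C y = Dom C v" "\<not> zero_arr (v \<cdot> y)" "z \<in> Arr C"
      "Dom C z = Dom C y"
        "Cod C z = Dom C (t b i)" "t b i \<cdot> z = v \<cdot> y"
    using essential_monoE[OF e(2)[OF i(1)] v(1) cv nv] .
  have yD: "Cod C y = Dom C h" using y(2) v(2) xh(3) by simp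
  have "l i \<cdot> (v \<cdot> y) = (x \<cdot> h) \<cdot> y"
    by (rule reassoc[OF v(4)]) (use v(1,3) y(1,2) l(2)[OF i(1)] in auto)
  also have "\<dots> = x \<cdot> (h \<cdot> y)" by (rule assoc) (use y(1) yD h'(1,3) x(1) in auto)
  finally have 1: "l i \<cdot> (v \<cdot> y) = x \<cdot> (h \<cdot> y)" .
  have "l i \<cdot> (t b i \<cdot> z) = l b \<cdot> z"
    by (rule reassoc[OF l(5)[OF bi]]) (use y(4,6) S(6-8)[OF bi] l(2-4)[OF i(1)] in auto)
  then have 2: "l b \<cdot> z = x \<cdot> (h \<cdot> y)" unfolding y(7) 1 by simp
  have "\<not> zero_arr (l i \<cdot> (v \<cdot> y))"
    using mono_zero_arr[OF lm[OF i(1)], of "v \<cdot> y"] v(1,3) y(1-3) by simp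
  then have 3: "\<not> zero_arr (x \<cdot> (h \<cdot> y))" unfolding 1 .
  show "\<exists>y z. y \<in> Arr C \<and> Cod C y = Dom C x \<and> \<not> zero_arr (x \<cdot> y) \<and> z \<in> Arr C \<and>
      Cod C z = Dom C (l b) \<and> l b \<cdot> z = x \<cdot> y"
    using 2 3 y(1,4,6) yD h'(1,3) S(7)[OF bi] l(3)[OF b]
        by (intro exI[of _ "h \<cdot> y"] exI[of _ z]) simp
qed

section \<open>Extension problems and their simultaneous solution\<close>

definition problems :: "'o \<Rightarrow> ('m \<times> 'm) set" where
  "problems X = {(k, f). mono_arr C k \<and> Cod C k \<in> \<G> \<and> f \<in> Arr C \<and> Dom C f = Dom C k \<and> Cod C f = X}"

text \<open>Up to isomorphism of the subobject, an extension problem is determined by its graph on elements.\<close>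

lemma small_problems:
  assumes X: "X \<in> Obj C"
  obtains Q where "Q \<prec> U" "Q \<subseteq> problems X"
    "\<forall>k f. (k, f) \<in> problems X \<longrightarrow> (\<exists>k' f' u. (k', f') \<in> Q \<and> u \<in> Arr C \<and> Dom C u = Dom C k \<and>
        Cod C u = Dom C k' \<and>
       k' \<cdot> u = k \<and> f' \<cdot> u = f)"
proof -
  \<comment> \<open>The sources of the monomorphisms range over all objects, so
    \<open>problems X\<close> may be large. \<open>\<Phi>\<close> retains only data from the small
    set \<open>?B\<close>, and \<open>Q\<close> will contain one problem for each of its
    values.\<close>
  define \<Phi> where "\<Phi> = (\<lambda>(k, f). (Cod C k, (\<lambda>x. (k \<cdot> x, f \<cdot> x)) ` elements (Dom C k)))"
  let ?B = "SIGMA G:\<G>. Pow (elements G \<times> elements X)"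
  have G: "\<G> \<subseteq> Obj C" using generating_gen by (simp add: generating_set_def)
  have "?B \<prec> U"
  proof (rule small_Sigma[OF universe small_gen])
    fix G assume "G \<in> \<G>"
    then have "elements G \<prec> U" using G small_elements by blast
    then have "elements G \<times> elements X \<prec> U"
        by (rule small_Sigma[OF universe]) (rule small_elements[OF X])
    then show "Pow (elements G \<times> elements X) \<prec> U" by (rule small_Pow[OF universe])
  qed
  moreover have \<Phi>B: "\<Phi> ` problems X \<subseteq> ?B"
  proof
    fix b assume "b \<in> \<Phi> ` problems X"
    then obtain k f where kf: "(k, f) \<in> problems X" and b: "b = \<Phi> (k, f)" by auto
    then show "b \<in> ?B" by (auto simp: \<Phi>_def problems_def elements_def)
  qed
  ultimately have small: "\<Phi> ` problems X \<prec> U" using small_subset by blast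
  define Q where "Q = inv_into (problems X) \<Phi> ` (\<Phi> ` problems X)"
  have "Q \<prec> U" unfolding Q_def by (rule small_image[OF small])
  moreover have Qsub: "Q \<subseteq> problems X" unfolding Q_def by (rule image_subsetI) (rule inv_into_into)
  moreover have "\<exists>k' f' u. (k', f') \<in> Q \<and> u \<in> Arr C \<and> Dom C u = Dom C k \<and> Cod C u = Dom C k' \<and>
      k' \<cdot> u = k \<and> f' \<cdot> u = f"
    if kf: "(k, f) \<in> problems X" for k f
  proof -
    obtain k' f' where kf': "inv_into (problems X) \<Phi> (\<Phi> (k, f)) = (k', f')" by fastforce
    then have Q': "(k', f') \<in> Q" unfolding Q_def using kf by (metis imageI)
    have "\<Phi> (k', f') = \<Phi> (k, f)" using f_inv_into_f[of "\<Phi> (k, f)" \<Phi> "problems X"] kf kf' by simp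
    then have C: "Cod C k' = Cod C k"
        and gr: "(\<lambda>x. (k' \<cdot> x, f' \<cdot> x)) ` elements (Dom C k') = (\<lambda>x. (k \<cdot> x, f \<cdot> x)) ` elements (Dom C k)"
      by (auto simp: \<Phi>_def)
    have P: "mono_arr C k" "k \<in> Arr C" "f \<in> Arr C" "Dom C f = Dom C k" "Cod C f = X" using kf
        by (auto simp: problems_def)
    have P': "mono_arr C k'" "k' \<in> Arr C" "f' \<in> Arr C" "Dom C f' = Dom C k'" "Cod C f' = X"
      using Qsub Q' by (auto simp: problems_def)
    have get: "\<exists>x'\<in>elements (Dom C k'). k' \<cdot> x' = k \<cdot> x \<and> f' \<cdot> x' = f \<cdot> x"
        if "x \<in> elements (Dom C k)" for x
    proof -
      have "(k \<cdot> x, f \<cdot> x) \<in> (\<lambda>x. (k' \<cdot> x, f' \<cdot> x)) ` elements (Dom C k')" unfolding gr using that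
          by blast
      then show ?thesis by (auto simp: image_iff)
    qed
    \<comment> \<open>By equality of the graphs every element of \<open>k\<close> is an element of
      \<open>k'\<close>, and elements decide inclusion.\<close>
    have "sub_le C k k'"
    proof (rule sub_le_test[OF P'(1) P(2)])
      fix h assume h: "h \<in> elements (Cod C k')" "sub_le C h k"
      obtain x where x: "x \<in> Arr C" "Dom C x = Dom C h" "Cod C x = Dom C k" "k \<cdot> x = h" using h(2)
          by (rule sub_leE)
      then have "x \<in> elements (Dom C k)" using elements_arr[OF h(1)] by (simp add: elements_def)
      then obtain x' where x': "x' \<in> elements (Dom C k')" "k' \<cdot> x' = k \<cdot> x" using get by blast
      show "sub_le C h k'" by (rule sub_leI[of x']) (use x' elements_arr[OF x'(1)] x(4) P' in auto)
    qed (use C in simp)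
    then obtain u where u: "u \<in> Arr C" "Dom C u = Dom C k" "Cod C u = Dom C k'" "k' \<cdot> u = k"
        by (rule sub_leE)
    have f'u: "f' \<cdot> u \<in> Arr C" "Dom C (f' \<cdot> u) = Dom C k" "Cod C (f' \<cdot> u) = X" using u P' by auto
    \<comment> \<open>It suffices to compare on an element \<open>x\<close>. The \<open>x'\<close>
      matched with it by the graphs must be \<open>u \<cdot> x\<close>, as \<open>k'\<close> is
      monic, so \<open>f' \<cdot> u\<close> and \<open>f\<close> have the same value there.\<close>
    have "zero_arr (sub_arr (f' \<cdot> u) f)"
    proof (rule ccontr)
      assume nz: "\<not> zero_arr (sub_arr (f' \<cdot> u) f)"
      have d: "sub_arr (f' \<cdot> u) f \<in> Arr C" "Dom C (sub_arr (f' \<cdot> u) f) = Dom C k" using f'u P(3-5)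
          by auto
      obtain x where x: "x \<in> elements (Dom C k)" "\<not> zero_arr (sub_arr (f' \<cdot> u) f \<cdot> x)"
        using gen_test[OF d(1) nz] d(2) by auto
      have xa: "x \<in> Arr C" "Cod C x = Dom C k" using elements_arr[OF x(1)] by auto
      obtain x' where x': "x' \<in> elements (Dom C k')" "k' \<cdot> x' = k \<cdot> x" "f' \<cdot> x' = f \<cdot> x"
          using get x(1) by blast
      have xa': "x' \<in> Arr C" "Cod C x' = Dom C k'" using elements_arr[OF x'(1)] by auto
      have ux: "u \<cdot> x \<in> Arr C" "Cod C (u \<cdot> x) = Dom C k'" "Dom C (u \<cdot> x) = Dom C x" using u xa
          by auto
      have e1: "k' \<cdot> (u \<cdot> x) = k \<cdot> x" by (rule reassoc[OF u(4)]) (use u(1-3) xa P' in auto)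
      have "Dom C (k' \<cdot> x') = Dom C (k \<cdot> x)" by (simp only: x'(2))
      then have "Dom C x' = Dom C (u \<cdot> x)" using xa xa' ux P(2) P'(2) by simp
      then have "x' = u \<cdot> x" using mono_cancel[OF P'(1), of x' "u \<cdot> x"] x'(2) e1 xa' ux by simp
      then have e2: "f \<cdot> x = (f' \<cdot> u) \<cdot> x" using x'(3) assoc[of x u f'] u(1-3) xa P' by simp
      have "sub_arr (f' \<cdot> u) f \<cdot> x = sub_arr ((f' \<cdot> u) \<cdot> x) (f \<cdot> x)"
        by (rule sub_comp) (use f'u P(3-5) xa in auto)
      also have "zero_arr \<dots>" unfolding e2
          using zero_arr_sub_iff[of "(f' \<cdot> u) \<cdot> x" "(f' \<cdot> u) \<cdot> x"] f'u xa by simp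
      finally show False using x(2) by simp
    qed
    then have "f' \<cdot> u = f" using iffD1[OF zero_arr_sub_iff[OF f'u(1) P(3)]] f'u P(4,5) by simp
    then show ?thesis using Q' u by blast
  qed
  ultimately show ?thesis using that by blast
qed

definition solves :: "'m \<Rightarrow> 'm \<Rightarrow> 'm \<Rightarrow> bool" where
  "solves e k f \<longleftrightarrow> (\<exists>h. h \<in> Arr C \<and> Dom C h = Cod C k \<and> Cod C h = Cod C e \<and> h \<cdot> k = e \<cdot> f)"

lemma solves_comp:
  assumes "solves e k f" "g \<in> Arr C" "Dom C g = Cod C e" "e \<in> Arr C" "f \<in> Arr C" "Dom C e = Cod C f"
      "k \<in> Arr C"
  shows "solves (g \<cdot> e) k f"
proof -
  obtain h where h: "h \<in> Arr C" "Dom C h = Cod C k" "Cod C h = Cod C e" "h \<cdot> k = e \<cdot> f"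
    using assms(1) unfolding solves_def by blast
  have "(g \<cdot> h) \<cdot> k = (g \<cdot> e) \<cdot> f" using assoc[of k h g] assoc[of f e g] h assms(2-) by simp
  then show ?thesis unfolding solves_def using h(1-3) assms(2-4) by (intro exI[of _ "g \<cdot> h"]) simp
qed

text \<open>Passes from a representative problem in the small set to any problem that it
  represents.\<close>

lemma solves_precomp:
  assumes "solves e k f" "u \<in> Arr C" "Cod C u = Dom C k" "Dom C e = Cod C f" "Dom C f = Dom C k"
    "e \<in> Arr C" "k \<in> Arr C" "f \<in> Arr C"
  shows "solves e (k \<cdot> u) (f \<cdot> u)"
proof -
  obtain h where h: "h \<in> Arr C" "Dom C h = Cod C k" "Cod C h = Cod C e" "h \<cdot> k = e \<cdot> f"
    using assms(1) unfolding solves_def by blast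
  have "h \<cdot> (k \<cdot> u) = e \<cdot> (f \<cdot> u)" using assoc[of u k h] assoc[of u f e] h assms(2-) by simp
  then show ?thesis unfolding solves_def using h(1-3) assms(2,3,7) by (intro exI[of _ h]) simp
qed

text \<open>Zorn's lemma for sets \<open>T\<close> of triples \<open>(i, j, t\<^sub>i\<^sub>j)\<close> encoding chains of essential extensions
  of \<open>X\<close> in which the object with index \<open>i\<close> solves the \<open>i\<close>-th problem; \<open>b\<close> is the index of \<open>X\<close>
  itself.\<close>

definition solving_chain :: "'o \<Rightarrow> 'u set \<Rightarrow> 'u \<Rightarrow> ('u \<Rightarrow> 'm) \<Rightarrow> ('u \<Rightarrow> 'm) \<Rightarrow> ('u \<times> 'u \<times> 'm) set \<Rightarrow> bool" where
  "solving_chain X K b k f T \<longleftrightarrow>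
     (\<forall>i j a. (i, j, a) \<in> T \<longrightarrow> i \<in> insert b K \<and> j \<in> insert b K \<and> essential_mono C a) \<and>
     (\<forall>i j a a'. (i, j, a) \<in> T \<longrightarrow> (i, j, a') \<in> T \<longrightarrow> a = a') \<and>
     (\<forall>i j a. (i, j, a) \<in> T \<longrightarrow> (i, i, Ident C (Dom C a)) \<in> T \<and> (j, j, Ident C (Cod C a)) \<in> T) \<and>
     (\<forall>i j l a c. (i, j, a) \<in> T \<longrightarrow> (j, l, c) \<in> T \<longrightarrow> Dom C c = Cod C a \<and> (i, l, c \<cdot> a) \<in> T) \<and>
     (\<forall>i j a c. (i, i, a) \<in> T \<longrightarrow> (j, j, c) \<in> T \<longrightarrow> (\<exists>d. (i, j, d) \<in> T \<or> (j, i, d) \<in> T)) \<and>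
     (b, b, Ident C X) \<in> T \<and>
     (\<forall>i a. (i, i, a) \<in> T \<longrightarrow> (\<exists>d. (b, i, d) \<in> T)) \<and>
     (\<forall>i a. (b, i, a) \<in> T \<longrightarrow> i \<in> K \<longrightarrow> solves a (k i) (f i))"

lemma solving_chainD:
  assumes "solving_chain X K b k f T"
  shows "\<And>i j a. (i, j, a) \<in> T \<Longrightarrow> i \<in> insert b K" "\<And>i j a. (i, j, a) \<in> T \<Longrightarrow> j \<in> insert b K"
    "\<And>i j a. (i, j, a) \<in> T \<Longrightarrow> essential_mono C a"
    "\<And>i j a a'. (i, j, a) \<in> T \<Longrightarrow> (i, j, a') \<in> T \<Longrightarrow> a = a'"
    "\<And>i j a. (i, j, a) \<in> T \<Longrightarrow> (i, i, Ident C (Dom C a)) \<in> T"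
    "\<And>i j a. (i, j, a) \<in> T \<Longrightarrow> (j, j, Ident C (Cod C a)) \<in> T"
    "\<And>i j l a c. (i, j, a) \<in> T \<Longrightarrow> (j, l, c) \<in> T \<Longrightarrow> Dom C c = Cod C a"
    "\<And>i j l a c. (i, j, a) \<in> T \<Longrightarrow> (j, l, c) \<in> T \<Longrightarrow> (i, l, c \<cdot> a) \<in> T"
    "\<And>i j a c. (i, i, a) \<in> T \<Longrightarrow> (j, j, c) \<in> T \<Longrightarrow> \<exists>d. (i, j, d) \<in> T \<or> (j, i, d) \<in> T"
    "(b, b, Ident C X) \<in> T" "\<And>i a. (i, i, a) \<in> T \<Longrightarrow> \<exists>d. (b, i, d) \<in> T"
    "\<And>i a. (b, i, a) \<in> T \<Longrightarrow> i \<in> K \<Longrightarrow> solves a (k i) (f i)"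
  subgoal using assms[unfolded solving_chain_def, THEN conjunct1] by blast
  subgoal using assms[unfolded solving_chain_def, THEN conjunct1] by blast
  subgoal using assms[unfolded solving_chain_def, THEN conjunct1] by blast
  subgoal using assms[unfolded solving_chain_def, THEN conjunct2, THEN conjunct1] by blast
  subgoal using assms[unfolded solving_chain_def, THEN conjunct2, THEN conjunct2, THEN conjunct1]
      by blast
  subgoal using assms[unfolded solving_chain_def, THEN conjunct2, THEN conjunct2, THEN conjunct1]
      by blast
  subgoal using assms[unfolded solving_chain_def, THEN conjunct2, THEN conjunct2, THEN conjunct2,
      THEN conjunct1] by blast
  subgoal using assms[unfolded solving_chain_def, THEN conjunct2, THEN conjunct2, THEN conjunct2,
      THEN conjunct1] by blast
  subgoal using assms[unfolded solving_chain_def, THEN conjunct2, THEN conjunct2, THEN conjunct2,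
      THEN conjunct2, THEN conjunct1] by blast
  subgoal using assms[unfolded solving_chain_def, THEN conjunct2, THEN conjunct2, THEN conjunct2,
      THEN conjunct2, THEN conjunct2, THEN conjunct1] by blast
  subgoal using assms[unfolded solving_chain_def, THEN conjunct2, THEN conjunct2, THEN conjunct2,
      THEN conjunct2, THEN conjunct2, THEN conjunct2, THEN conjunct1] by blast
  subgoal using assms[unfolded solving_chain_def, THEN conjunct2, THEN conjunct2, THEN conjunct2,
      THEN conjunct2, THEN conjunct2, THEN conjunct2, THEN conjunct2] by blast
  done

text \<open>Each clause has at most two triples as premises, and two triples of the union lie in a
  common member of the chain. Nothing has to be glued by a limit at this stage.\<close>

lemma solving_chain_Union:
  assumes ne: "\<C> \<noteq> {}" and ch: "subset.chain (Collect (solving_chain X K b k f)) \<C>"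
  shows "solving_chain X K b k f (\<Union>\<C>)"
proof -
  have S: "\<And>T. T \<in> \<C> \<Longrightarrow> solving_chain X K b k f T"
    and lin: "\<And>A B. A \<in> \<C> \<Longrightarrow> B \<in> \<C> \<Longrightarrow> A \<subseteq> B \<or> B \<subseteq> A"
    using ch by (auto simp: subset_chain_def)
  have two: "\<exists>T\<in>\<C>. x \<in> T \<and> y \<in> T" if "x \<in> \<Union>\<C>" "y \<in> \<Union>\<C>" for x y
    using that lin by blast
  show ?thesis unfolding solving_chain_def
  proof (intro conjI allI impI)
    fix i j a assume "(i, j, a) \<in> \<Union>\<C>"
    then obtain T where T: "T \<in> \<C>" "(i, j, a) \<in> T" by blast
    note * = solving_chainD[OF S[OF T(1)]]
    show "i \<in> insert b K" "j \<in> insert b K" "essential_mono C a"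
      using *(1-3)[OF T(2)] by simp_all
    show "(i, i, Ident C (Dom C a)) \<in> \<Union>\<C>" "(j, j, Ident C (Cod C a)) \<in> \<Union>\<C>"
      using *(5,6)[OF T(2)] T(1) by blast+
  next
    fix i j a a' assume "(i, j, a) \<in> \<Union>\<C>" "(i, j, a') \<in> \<Union>\<C>"
    then obtain T where T: "T \<in> \<C>" "(i, j, a) \<in> T" "(i, j, a') \<in> T" using two by blast
    note * = solving_chainD[OF S[OF T(1)]]
    show "a = a'" by (rule *(4)[OF T(2,3)])
  next
    fix i j l a c assume "(i, j, a) \<in> \<Union>\<C>" "(j, l, c) \<in> \<Union>\<C>"
    then obtain T where T: "T \<in> \<C>" "(i, j, a) \<in> T" "(j, l, c) \<in> T" using two by blast
    note * = solving_chainD[OF S[OF T(1)]]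
    have "Dom C c = Cod C a \<and> (i, l, c \<cdot> a) \<in> T" using *(7,8)[OF T(2,3)] by simp
    then show "Dom C c = Cod C a" "(i, l, c \<cdot> a) \<in> \<Union>\<C>" using T(1) by blast+
  next
    fix i j a c assume "(i, i, a) \<in> \<Union>\<C>" "(j, j, c) \<in> \<Union>\<C>"
    then obtain T where T: "T \<in> \<C>" "(i, i, a) \<in> T" "(j, j, c) \<in> T" using two by blast
    note * = solving_chainD[OF S[OF T(1)]]
    have "\<exists>d. (i, j, d) \<in> T \<or> (j, i, d) \<in> T" by (rule *(9)[OF T(2,3)])
    then show "\<exists>d. (i, j, d) \<in> \<Union>\<C> \<or> (j, i, d) \<in> \<Union>\<C>" using T(1) by blast
  next
    obtain T where T: "T \<in> \<C>" using ne by blast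
    note * = solving_chainD[OF S[OF T]]
    show "(b, b, Ident C X) \<in> \<Union>\<C>" using *(10) T by blast
  next
    fix i a assume "(i, i, a) \<in> \<Union>\<C>"
    then obtain T where T: "T \<in> \<C>" "(i, i, a) \<in> T" by blast
    note * = solving_chainD[OF S[OF T(1)]]
    have "\<exists>d. (b, i, d) \<in> T" by (rule *(11)[OF T(2)])
    then show "\<exists>d. (b, i, d) \<in> \<Union>\<C>" using T(1) by blast
  next
    fix i a assume "(b, i, a) \<in> \<Union>\<C>" and iK: "i \<in> K"
    then obtain T where T: "T \<in> \<C>" "(b, i, a) \<in> T" by blast
    note * = solving_chainD[OF S[OF T(1)]]
    show "solves a (k i) (f i)" by (rule *(12)[OF T(2) iK])
  qed
qed

text \<open>In a maximal chain every problem occurs as an index. Otherwise a missing problem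
  \<open>m\<close> would be solved in an essential extension \<open>g\<close> of the limit, and
  \<open>Cod C g\<close> with index \<open>m\<close> could be put on top of the chain. Hence the
  limit of a maximal chain solves all problems at once.\<close>

lemma solve_problems:
  assumes X: "X \<in> Obj C"
  obtains e where "essential_mono C e" "Dom C e = X" "\<forall>k f. (k, f) \<in> problems X \<longrightarrow> solves e k f"
proof -
  obtain Q where Q: "Q \<prec> U" "Q \<subseteq> problems X"
    "\<forall>k f. (k, f) \<in> problems X \<longrightarrow> (\<exists>k' f' u. (k', f') \<in> Q \<and> u \<in> Arr C \<and> Dom C u = Dom C k \<and>
        Cod C u = Dom C k' \<and>
       k' \<cdot> u = k \<and> f' \<cdot> u = f)"
    using small_problems[OF X] .
  obtain \<psi> :: "'m \<times> 'm \<Rightarrow> 'u" where \<psi>: "inj_on \<psi> Q" "\<psi> ` Q \<prec> U" using small_index[OF Q(1)] .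
  define K where "K = \<psi> ` Q"
  have K: "K \<prec> U" using \<psi>(2) by (simp add: K_def)
  define k where "k i = fst (inv_into Q \<psi> i)" for i
  define f where "f i = snd (inv_into Q \<psi> i)" for i
  have kf: "(k i, f i) \<in> Q" if "i \<in> K" for i using that inv_into_into[of i \<psi> Q]
      by (simp add: k_def f_def K_def)
  have kfQ: "\<exists>i\<in>K. k i = k' \<and> f i = f'" if "(k', f') \<in> Q" for k' f'
    using that \<psi>(1) by (intro bexI[of _ "\<psi> (k', f')"]) (simp_all add: k_def f_def K_def)
  have p: "mono_arr C (k i)" "k i \<in> Arr C" "f i \<in> Arr C" "Dom C (f i) = Dom C (k i)"
      "Cod C (f i) = X" if "i \<in> K" for i
    using kf[OF that] Q(2) by (auto simp: problems_def)
  \<comment> \<open>The index \<open>b\<close> of \<open>X\<close> itself is chosen outside the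
    problem indices, so the clause on solved problems demands nothing of \<open>X\<close>. In
    particular the one-object chain is a legitimate start.\<close>
  have "\<not> U \<subseteq> K" using K small_subset lesspoll_not_refl by blast
  then obtain b where b: "b \<notin> K" by blast
  have bK: "insert b K \<prec> U" using small_insert[OF universe_infinite[OF universe] K] .
  let ?A = "Collect (solving_chain X K b k f)"
  have "\<exists>M\<in>?A. \<forall>T\<in>?A. M \<subseteq> T \<longrightarrow> T = M"
  proof (rule subset_Zorn_nonempty)
    have "solving_chain X K b k f {(b, b, Ident C X)}"
      unfolding solving_chain_def using X b by auto
    then show "?A \<noteq> {}" by blast
    show "\<And>\<C>. \<C> \<noteq> {} \<Longrightarrow> subset.chain ?A \<C> \<Longrightarrow> \<Union>\<C> \<in> ?A" using solving_chain_Union by blast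
  qed
  then obtain T where T: "solving_chain X K b k f T"
      and max: "\<And>T'. solving_chain X K b k f T' \<Longrightarrow> T \<subseteq> T' \<Longrightarrow> T' = T"
    by blast
  note D = solving_chainD[OF T]
  note T1 = D(1-3) and T2 = D(4) and T3 = D(5,6) and T4 = D(7,8) and T5 = D(9) and T6 = D(10,11) and T7 = D(12)
  have Ta: "a \<in> Arr C" "mono_arr C a" if "(i, j, a) \<in> T" for i j a
    using essential_mono_mono[OF T1(3)[OF that]] by auto
  define I where "I = {i. \<exists>a. (i, i, a) \<in> T}"
  define r where "r = {(i, j). \<exists>a. (i, j, a) \<in> T}"
  \<comment> \<open>A triple is determined by its first two components, so this description is
    proper for every pair in \<open>r\<close>.\<close>
  define t where "t i j = (THE a. (i, j, a) \<in> T)" for i j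
  define Y where "Y i = Dom C (t i i)" for i
  have tT: "(i, j, t i j) \<in> T" if ij: "(i, j) \<in> r" for i j
  proof -
    obtain a where a: "(i, j, a) \<in> T" using ij by (auto simp: r_def)
    then have "t i j = a" unfolding t_def using T2 by blast
    then show ?thesis using a by simp
  qed
  have tI: "t i j = a" if "(i, j, a) \<in> T" for i j a
    unfolding t_def using that T2 by blast
  have rI: "i \<in> I" "j \<in> I" if "(i, j) \<in> r" for i j
    using T3[OF tT[OF that]] by (auto simp: I_def)
  have IT: "(i, i, t i i) \<in> T" if "i \<in> I" for i using that tI by (auto simp: I_def)
  have rr: "(i, i) \<in> r" if "i \<in> I" for i using that by (simp add: I_def r_def)
  have tii: "t i i = Ident C (Y i)" if i: "i \<in> I" for i
    using T2[OF IT[OF i] T3(1)[OF IT[OF i]]] by (simp add: Y_def)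
  have tD: "Dom C (t i j) = Y i" "Cod C (t i j) = Y j" if ij: "(i, j) \<in> r" for i j
    using tI[OF T3(1)[OF tT[OF ij]]] tI[OF T3(2)[OF tT[OF ij]]] Ta(1)[OF tT[OF ij]]
        by (auto simp: Y_def)
  have tr: "(i, l) \<in> r \<and> t j l \<cdot> t i j = t i l" if "(i, j) \<in> r" "(j, l) \<in> r" for i j l
  proof -
    have "(i, l, t j l \<cdot> t i j) \<in> T" by (rule T4(2)[OF tT[OF that(1)] tT[OF that(2)]])
    then show ?thesis using tI by (auto simp: r_def)
  qed
  have lin: "(i, j) \<in> r \<or> (j, i) \<in> r" if "i \<in> I" "j \<in> I" for i j
    using T5[OF IT[OF that(1)] IT[OF that(2)]] by (auto simp: r_def)
  have bI: "b \<in> I" "Y b = X" using T6(1) tI[OF T6(1)] X by (auto simp: I_def Y_def)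
  have br: "(b, i) \<in> r" if "i \<in> I" for i using T6(2) IT[OF that] by (auto simp: r_def)
  have IU: "I \<prec> U" by (rule small_subset[OF _ bK]) (use T1 in \<open>auto simp: I_def\<close>)
  have s: "direct_system C I r Y t"
    unfolding direct_system_def directed_set_def preorder_on_def
  proof (intro conjI ballI allI impI)
    show "I \<noteq> {}" using bI by blast
    show "r \<subseteq> I \<times> I" using rI by auto
    show "refl_on I r" using rr by (simp add: refl_on_def)
    show "trans r" by (rule transI) (use tr in blast)
    show "\<exists>l\<in>I. (i, l) \<in> r \<and> (j, l) \<in> r" if "i \<in> I" "j \<in> I" for i j using lin rr that by blast
    fix i assume i: "i \<in> I"
    show "Y i \<in> Obj C" unfolding Y_def using Ta(1)[OF IT[OF i]] by simp
    show "t i i = Ident C (Y i)" by (rule tii[OF i])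
  next
    fix i j assume "(i, j) \<in> r"
    then show "t i j \<in> Hom C (Y i) (Y j)" using tD Ta(1)[OF tT] by simp
  qed (use tr in blast)
  have mc: "mono_chain I r Y t" unfolding mono_chain_def using s lin Ta(2)[OF tT] by blast
  obtain L l where L: "is_direct_limit C I r Y t L l" by (rule ex_direct_limit[OF IU s])
  note l = limit_arr[OF L]
  have lm: "mono_arr C (l i)" if "i \<in> I" for i using limit_mono[OF IU mc L that] .
  have eb: "essential_mono C (l b)"
    by (rule chain_limit_essential[OF IU mc L bI(1) br]) (use T1(3)[OF tT[OF br]] in auto)
  have el: "essential_mono C (l i)" if i: "i \<in> I" for i
  proof (rule essential_comp_left[of "l i" "t b i"])
    show "essential_mono C (l i \<cdot> t b i)" using eb l(5)[OF br[OF i]] by simp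
    show "t b i \<in> Arr C" "Dom C (l i) = Cod C (t b i)"
        using Ta(1)[OF tT[OF br[OF i]]] tD[OF br[OF i]] l(3)[OF i] by auto
  qed (rule lm[OF i])
  have all: "K \<subseteq> I"
  proof (rule ccontr)
    assume "\<not> K \<subseteq> I"
    then obtain m where m: "m \<in> K" "m \<notin> I" by blast
    have lf: "l b \<cdot> f m \<in> Arr C" "Dom C (l b \<cdot> f m) = Dom C (k m)" "Cod C (l b \<cdot> f m) = L"
      using p[OF m(1)] l(2-4)[OF bI(1)] bI(2) by auto
    obtain g h where g: "essential_mono C g" "Dom C g = Cod C (l b \<cdot> f m)" "h \<in> Arr C"
        "Dom C h = Cod C (k m)"
      "Cod C h = Cod C g" "h \<cdot> k m = g \<cdot> (l b \<cdot> f m)"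
      using essential_extension[OF p(1)[OF m(1)] lf(1,2)] .
    have gm: "g \<in> Arr C" "mono_arr C g" using essential_mono_mono[OF g(1)] by auto
    have gD: "Dom C g = L" using g(2) lf(3) by simp
    have gl: "g \<cdot> l i \<in> Arr C" "Dom C (g \<cdot> l i) = Y i" "Cod C (g \<cdot> l i) = Cod C g"
        "essential_mono C (g \<cdot> l i)" if "i \<in> I" for i
      using l(2-4)[OF that] gm gD essential_comp[OF el[OF that] g(1)] by auto
    have glt: "(g \<cdot> l j) \<cdot> t i j = g \<cdot> l i" if ij: "(i, j) \<in> r" for i j
      using assoc[of "t i j"
          "l j" g] l(2-4)[OF rI(2)[OF ij]] l(5)[OF ij] gm gD Ta(1)[OF tT[OF ij]] tD[OF ij] by simp
    \<comment> \<open>The new top object \<open>Cod C g\<close> gets the index \<open>m\<close> and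
      receives \<open>g \<cdot> l i\<close> from each old stage.\<close>
    define T' where "T' = T \<union> {(i, m, g \<cdot> l i) | i. i \<in> I} \<union> {(m, m, Ident C (Cod C g))}"
    have mT: "(i, m, a) \<notin> T" "(m, i, a) \<notin> T" for i a
      using T3[of i m a] T3[of m i a] m(2) by (auto simp: I_def)
    have mb: "m \<noteq> b" using m(1) b by blast
    have T'E: "(i, j, a) \<in> T' \<longleftrightarrow> (i, j, a) \<in> T \<or> (j = m \<and> i \<in> I \<and> a = g \<cdot> l i) \<or> (i = m \<and> j = m \<and>
        a = Ident C (Cod C g))" for i j a
      unfolding T'_def by auto
    have TI: "i \<in> I" "j \<in> I" "i \<noteq> m" "j \<noteq> m" if "(i, j, a) \<in> T" for i j a
      using T3[OF that] that mT by (auto simp: I_def)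
    have IO: "i \<in> insert b K" if "i \<in> I" for i using T1(1)[OF IT[OF that]] .
    have CO: "Cod C g \<in> Obj C" using gm by simp
    have "solving_chain X K b k f T'"
      unfolding solving_chain_def
    proof (intro conjI allI impI)
      fix i j a assume "(i, j, a) \<in> T'"
      then consider "(i, j, a) \<in> T" | "j = m" "i \<in> I" "a = g \<cdot> l i" | "i = m" "j = m"
          "a = Ident C (Cod C g)"
        unfolding T'E by blast
      note cs = this
      show "i \<in> insert b K" using cs by cases (use T1 IO m in auto)
      show "j \<in> insert b K" using cs by cases (use T1 IO m in auto)
      show "essential_mono C a" using cs by cases (use T1 gl CO in auto)
      show "(i, i, Ident C (Dom C a)) \<in> T'"
        using cs by cases (use T3 tii IT gl CO in \<open>auto simp: T'E\<close>)
      show "(j, j, Ident C (Cod C a)) \<in> T'"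
        using cs by cases (use T3 gl CO in \<open>auto simp: T'E\<close>)
    next
      fix i j a a' assume "(i, j, a) \<in> T'" "(i, j, a') \<in> T'"
      then show "a = a'" unfolding T'E using T2 mT m(2) by blast
    next
      fix i j n a c assume A: "(i, j, a) \<in> T'" "(j, n, c) \<in> T'"
      consider "(i, j, a) \<in> T" "(j, n, c) \<in> T" | "(i, j, a) \<in> T" "n = m" "j \<in> I" "c = g \<cdot> l j"
        | "i \<in> I" "j = m" "n = m" "a = g \<cdot> l i" "c = Ident C (Cod C g)"
        | "i = m" "j = m" "n = m" "a = Ident C (Cod C g)" "c = Ident C (Cod C g)"
        using A unfolding T'E using TI mT m(2) by blast
      then have "Dom C c = Cod C a \<and> (i, n, c \<cdot> a) \<in> T'"
      proof cases
        case 1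
        then show ?thesis using T4[OF 1] by (simp add: T'E)
      next
        case 2
        have ij: "(i, j) \<in> r" using 2(1) by (auto simp: r_def)
        have a: "a = t i j" using tI[OF 2(1)] by simp
        have "c \<cdot> a = g \<cdot> l i" unfolding a 2(4) by (rule glt[OF ij])
        moreover have "Dom C c = Cod C a" unfolding a 2(4) using gl(2)[OF 2(3)] tD[OF ij] by simp
        ultimately show ?thesis using 2(2) TI(1)[OF 2(1)] by (simp add: T'E)
      next
        case 3
        then show ?thesis using gl[OF 3(1)] CO by (simp add: T'E)
      next
        case 4
        then show ?thesis using CO by (simp add: T'E)
      qed
      then show "Dom C c = Cod C a" "(i, n, c \<cdot> a) \<in> T'" by auto
    next
      fix i j a c assume A: "(i, i, a) \<in> T'" "(j, j, c) \<in> T'"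
      have 1: "i \<in> I \<or> i = m" "j \<in> I \<or> j = m" using A TI unfolding T'E by blast+
      then consider "i \<in> I" "j \<in> I" | "i \<in> I" "j = m" | "i = m" "j \<in> I" | "i = m" "j = m" by blast
      then show "\<exists>d. (i, j, d) \<in> T' \<or> (j, i, d) \<in> T'"
      proof cases
        case 1
        then show ?thesis using lin[OF 1] tT unfolding T'E by blast
      qed (auto simp: T'E)
    next
      show "(b, b, Ident C X) \<in> T'" using T6(1) by (simp add: T'E)
    next
      fix i a assume "(i, i, a) \<in> T'"
      then have "i \<in> I \<or> i = m" using TI unfolding T'E by blast
      then show "\<exists>d. (b, i, d) \<in> T'" using tT[OF br] bI(1) by (auto simp: T'E)
    next
      fix i a assume A: "(b, i, a) \<in> T'" and iK: "i \<in> K"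
      then consider "(b, i, a) \<in> T" | "i = m" "a = g \<cdot> l b" unfolding T'E using mb by blast
      then show "solves a (k i) (f i)"
      proof cases
        case 1
        then show ?thesis using T7 iK by blast
      next
        case 2
        have "h \<cdot> k m = (g \<cdot> l b) \<cdot> f m"
          unfolding g(6) by (rule assoc[symmetric])
              (use p[OF m(1)] l(2-4)[OF bI(1)] bI(2) gm gD in auto)
        then show ?thesis unfolding 2 solves_def using g(3-5) gl[OF bI(1)]
            by (intro exI[of _ h]) simp
      qed
    qed
    moreover have "T \<subseteq> T'" by (auto simp: T'_def)
    ultimately have "T' = T" using max by blast
    moreover have "(m, m, Ident C (Cod C g)) \<in> T'" by (simp add: T'E)
    ultimately show False using mT by metis
  qed
  have lb: "l b \<in> Arr C" "Dom C (l b) = X" using l(2,3)[OF bI(1)] bI(2) by auto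
  have Qs: "solves (l b) (k i) (f i)" if i: "i \<in> K" for i
  proof -
    have iI: "i \<in> I" using all i by blast
    note bi = br[OF iI]
    have "solves (l i \<cdot> t b i) (k i) (f i)"
      by (rule solves_comp[OF T7[OF tT[OF bi] i]])
        (use l(2-4)[OF iI] tD[OF bi] Ta(1)[OF tT[OF bi]] p[OF i] bI(2) in auto)
    then show ?thesis using l(5)[OF bi] by simp
  qed
  have "solves (l b) k' f'" if kf': "(k', f') \<in> problems X" for k' f'
  proof -
    obtain k2 f2 u where u: "(k2, f2) \<in> Q" "u \<in> Arr C" "Dom C u = Dom C k'" "Cod C u = Dom C k2"
       "k2 \<cdot> u = k'" "f2 \<cdot> u = f'" using Q(3) kf' by blast
    obtain i where i: "i \<in> K" "k i = k2" "f i = f2" using kfQ[OF u(1)] by blast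
    have "solves (l b) (k2 \<cdot> u) (f2 \<cdot> u)"
      by (rule solves_precomp) (use Qs[OF i(1)] p[OF i(1)] i u(2,4) lb in auto)
    then show ?thesis unfolding u(5,6) .
  qed
  then show ?thesis using that[of "l b"] eb lb by blast
qed

lemma baer_extension:
  assumes X: "X \<in> Obj C"
  obtains e where "essential_mono C e" "Dom C e = X" "baer (Cod C e)"
proof -
  have "\<forall>Y\<in>Obj C. \<exists>e. essential_mono C e \<and> Dom C e = Y \<and> (\<forall>k f. (k, f) \<in> problems Y \<longrightarrow> solves e k f)"
  proof
    fix Y assume Y: "Y \<in> Obj C"
    show "\<exists>e. essential_mono C e \<and> Dom C e = Y \<and> (\<forall>k f. (k, f) \<in> problems Y \<longrightarrow> solves e k f)"
      by (rule solve_problems[OF Y]) blast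
  qed
  then obtain st where st: "\<forall>Y\<in>Obj C. essential_mono C (st Y) \<and> Dom C (st Y) = Y \<and>
      (\<forall>k f. (k, f) \<in> problems Y \<longrightarrow> solves (st Y) k f)"
    unfolding bchoice_iff by blast
  define B where "B = rec_nat X (\<lambda>_ Y. Cod C (st Y))"
  have B0: "B 0 = X" and BS: "B (Suc n) = Cod C (st (B n))" for n by (simp_all add: B_def)
  have BO: "B n \<in> Obj C" for n
  proof (induction n)
    case (Suc n)
    then show ?case using st essential_mono_mono mono_arr_arr Cod_Obj unfolding BS by metis
  qed (simp add: B0 X)
  have e: "essential_mono C (st (B n))" "st (B n) \<in> Arr C" "Dom C (st (B n)) = B n"
      "Cod C (st (B n)) = B (Suc n)" for n
    using st BO[of n] essential_mono_mono[of "st (B n)"] by (auto simp: BS)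
  have sol: "solves (st (B n)) k f" if "(k, f) \<in> problems (B n)" for n k f using st BO that by blast
  \<comment> \<open>The transition from stage \<open>m\<close> to stage \<open>m + d\<close>.
    Recursion on the gap \<open>d\<close> makes the composition law \<open>csC\<close> a simple
    induction.\<close>
  define cs where "cs m d = rec_nat (Ident C (B m)) (\<lambda>d a. st (B (m + d)) \<cdot> a) d" for m d
  have cs0: "cs m 0 = Ident C (B m)" and csS: "cs m (Suc d) = st (B (m + d)) \<cdot> cs m d" for m d
    by (simp_all add: cs_def)
  have cs: "cs m d \<in> Arr C \<and> Dom C (cs m d) = B m \<and> Cod C (cs m d) = B (m + d) \<and>
      essential_mono C (cs m d)" for m d
  proof (induction d)
    case 0
    then show ?case using BO by (simp add: cs0)
  next
    case (Suc d)
    then show ?case unfolding csS using e[of "m + d"] essential_comp[of "cs m d" "st (B (m + d))"]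
        by simp
  qed
  have csC: "cs (m + d) d' \<cdot> cs m d = cs m (d + d')" for m d d'
  proof (induction d')
    case 0
    then show ?case using cs[of m d] by (simp add: cs0)
  next
    case (Suc d')
    have "cs (m + d) (Suc d') \<cdot> cs m d = st (B (m + d + d')) \<cdot> (cs (m + d) d' \<cdot> cs m d)"
      unfolding csS by (rule assoc) (use cs[of m d] cs[of "m + d" d'] e[of "m + d + d'"] in auto)
    then show ?case unfolding Suc by (simp add: csS add.assoc)
  qed
  \<comment> \<open>Limits are taken over index sets in the type of \<open>U\<close>, so the natural
    numbers are copied into that type.\<close>
  obtain \<nu> :: "nat \<Rightarrow> 'u" where \<nu>: "inj \<nu>" "range \<nu> \<prec> U"
    using universe small_index[of "UNIV :: nat set" U] unfolding universe_def by blast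
  have inv\<nu>: "inv_into UNIV \<nu> (\<nu> n) = n" for n using \<nu>(1) by simp
  define r where "r = {(\<nu> m, \<nu> n) | m n. m \<le> n}"
  have r\<nu>: "(\<nu> m, \<nu> n) \<in> r \<longleftrightarrow> m \<le> n" for m n using \<nu>(1) by (auto simp: r_def inj_def)
  have rE: "\<exists>m n. i = \<nu> m \<and> j = \<nu> n \<and> m \<le> n" if "(i, j) \<in> r" for i j using that
      by (auto simp: r_def)
  define Y where "Y i = B (inv_into UNIV \<nu> i)" for i
  define t where "t i j = cs (inv_into UNIV \<nu> i) (inv_into UNIV \<nu> j - inv_into UNIV \<nu> i)" for i j
  have Y\<nu>: "Y (\<nu> n) = B n" and t\<nu>: "t (\<nu> m) (\<nu> n) = cs m (n - m)" for m n
      by (simp_all add: Y_def t_def inv\<nu>)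
  have tt: "t i j \<in> Arr C \<and> Dom C (t i j) = Y i \<and> Cod C (t i j) = Y j \<and> essential_mono C (t i j)"
      if ij: "(i, j) \<in> r" for i j
  proof -
    obtain m n where mn: "i = \<nu> m" "j = \<nu> n" "m \<le> n" using rE[OF ij] by blast
    then show ?thesis using cs[of m "n - m"] by (simp add: Y\<nu> t\<nu>)
  qed
  let ?I = "range \<nu>"
  have s: "direct_system C ?I r Y t"
    unfolding direct_system_def directed_set_def preorder_on_def
  proof (intro conjI ballI allI impI)
    show "r \<subseteq> ?I \<times> ?I" by (auto simp: r_def)
    show "refl_on ?I r" by (auto simp: refl_on_def r\<nu>)
    show "trans r"
    proof (rule transI)
      fix i j l assume ij: "(i, j) \<in> r" and jl: "(j, l) \<in> r"
      obtain m n where mn: "i = \<nu> m" "j = \<nu> n" "m \<le> n" using rE[OF ij] by blast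
      obtain n' p where np: "j = \<nu> n'" "l = \<nu> p" "n' \<le> p" using rE[OF jl] by blast
      have "n = n'" using mn(2) np(1) \<nu>(1) by (simp add: inj_eq)
      then show "(i, l) \<in> r" unfolding mn(1) np(2) r\<nu> using mn np by simp
    qed
    fix i j assume "i \<in> ?I" "j \<in> ?I"
    then obtain m n where mn: "i = \<nu> m" "j = \<nu> n" by blast
    show "\<exists>k\<in>?I. (i, k) \<in> r \<and> (j, k) \<in> r"
      unfolding mn by (intro bexI[of _ "\<nu> (max m n)"]) (simp_all add: r\<nu>)
  next
    fix i j l assume ij: "(i, j) \<in> r" and jl: "(j, l) \<in> r"
    obtain m n where mn: "i = \<nu> m" "j = \<nu> n" "m \<le> n" using rE[OF ij] by blast
    obtain n' p where np: "j = \<nu> n'" "l = \<nu> p" "n' \<le> p" using rE[OF jl] by blast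
    have n: "n' = n" using mn(2) np(1) \<nu>(1) by (simp add: inj_eq)
    have "cs n (p - n) \<cdot> cs m (n - m) = cs m (p - m)" using csC[of m "n - m" "p - n"] mn(3) np(3) n
        by simp
    then show "t j l \<cdot> t i j = t i l" unfolding mn(1,2) np(2) t\<nu> .
  qed (use tt BO in \<open>auto simp: t\<nu> Y\<nu> cs0\<close>)
  have mc: "mono_chain ?I r Y t"
    unfolding mono_chain_def
  proof (intro conjI ballI allI impI)
    fix i j assume "i \<in> ?I" "j \<in> ?I"
    then obtain m n where mn: "i = \<nu> m" "j = \<nu> n" by blast
    show "(i, j) \<in> r \<or> (j, i) \<in> r" unfolding mn r\<nu> by (rule nat_le_linear)
  qed (use s tt essential_mono_mono in blast)+
  obtain L l where L: "is_direct_limit C ?I r Y t L l" by (rule ex_direct_limit[OF \<nu>(2) s])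
  note l = limit_arr[OF L]
  have l\<nu>: "l (\<nu> n) \<in> Arr C" "Dom C (l (\<nu> n)) = B n" "Cod C (l (\<nu> n)) = L" for n
    using l(2-4)[of "\<nu> n"] by (auto simp: Y\<nu>)
  have "essential_mono C (l (\<nu> 0))"
  proof (rule chain_limit_essential[OF \<nu>(2) mc L])
    fix i assume "i \<in> ?I"
    then obtain n where n: "i = \<nu> n" by blast
    have "(\<nu> 0, \<nu> n) \<in> r" by (simp add: r\<nu>)
    then show "(\<nu> 0, i) \<in> r" "essential_mono C (t (\<nu> 0) i)" unfolding n using tt by blast+
  qed simp
  moreover have "baer L" unfolding baer_def
  proof (intro conjI allI impI)
    show "L \<in> Obj C" by (rule l(1))
    fix k f assume k: "mono_arr C k" "Cod C k \<in> \<G>"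
        and f: "f \<in> Arr C" "Dom C f = Dom C k" "Cod C f = L"
    have k': "k \<in> Arr C" using k by simp
    have "noetherian_obj C (Dom C f)" unfolding f(2)
        by (rule noetherian_sub[OF noetherian_gen k(1)]) (rule k(2))
    then obtain i where i: "i \<in> ?I" "sub_le C f (l i)"
        by (rule noetherian_factor[OF \<nu>(2) mc L f(1,3)])
    then obtain n where n: "i = \<nu> n" by blast
    obtain v where v: "v \<in> Arr C" "Dom C v = Dom C f" "Cod C v = B n" "l (\<nu> n) \<cdot> v = f"
      using i(2) l\<nu>(2)[of n] unfolding n by (auto elim: sub_leE)
    \<comment> \<open>The problem has been pulled back to stage \<open>n\<close>; the solution found
      for it takes values in stage \<open>Suc n\<close>.\<close>
    have "(k, v) \<in> problems (B n)" using k f v by (simp add: problems_def)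
    then obtain h where h: "h \<in> Arr C" "Dom C h = Cod C k" "Cod C h = Cod C (st (B n))"
        "h \<cdot> k = st (B n) \<cdot> v"
      using sol unfolding solves_def by blast
    have hB: "Cod C h = B (Suc n)" using h(3) e(4) by simp
    have "t (\<nu> n) (\<nu> (Suc n)) = st (B n)" using e[of n] BO by (simp add: t\<nu> csS cs0)
    moreover have "(\<nu> n, \<nu> (Suc n)) \<in> r" by (simp add: r\<nu>)
    ultimately have ls: "l (\<nu> (Suc n)) \<cdot> st (B n) = l (\<nu> n)" using l(5)[of "\<nu> n" "\<nu> (Suc n)"]
        by simp
    have "(l (\<nu> (Suc n)) \<cdot> h) \<cdot> k = l (\<nu> (Suc n)) \<cdot> (st (B n) \<cdot> v)"
      unfolding h(4)[symmetric] by (rule assoc) (use h(1,2) hB k' l\<nu> in auto)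
    also have "\<dots> = l (\<nu> n) \<cdot> v" by (rule reassoc[OF ls]) (use v(1,3) e[of n] l\<nu> in auto)
    also have "\<dots> = f" by (rule v(4))
    finally have "(l (\<nu> (Suc n)) \<cdot> h) \<cdot> k = f" .
    then show "\<exists>g. g \<in> Arr C \<and> Dom C g = Cod C k \<and> Cod C g = L \<and> g \<cdot> k = f"
      using h(1,2) hB l\<nu> by (intro exI[of _ "l (\<nu> (Suc n)) \<cdot> h"]) simp
  qed
  ultimately show ?thesis using that[of "l (\<nu> 0)"] l\<nu>[of 0] B0 by simp
qed

lemma ex_injective_hull:
  assumes "X \<in> Obj C" obtains E where "is_injective_hull C X E"
proof -
  obtain e where e: "essential_mono C e" "Dom C e = X" "baer (Cod C e)"
    using baer_extension[OF assms] .
  have "is_injective_hull C X (Cod C e)"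
    unfolding is_injective_hull_def using e baer_injective essential_mono_mono[OF e(1)] by auto
  then show ?thesis by (rule that)
qed

end

section \<open>Splitting of injective subobjects and uniqueness of hulls\<close>

context abelian_category
begin

lemma injective_extend:
  assumes "injective_obj C E" "mono_arr C m" "f \<in> Arr C" "Dom C f = Dom C m" "Cod C f = E"
  obtains g where "g \<in> Arr C" "Dom C g = Cod C m" "Cod C g = E" "g \<cdot> m = f"
proof -
  have "f \<in> Hom C (Dom C m) E" using assms by simp
  then obtain g where "g \<in> Hom C (Cod C m) E" "g \<cdot> m = f"
    using assms(1,2) unfolding injective_obj_def by blast
  then show ?thesis using that[of g] unfolding Hom_iff by blast
qed

lemma injective_retraction:
  assumes "injective_obj C (Dom C m)" "mono_arr C m"
  obtains p where "p \<in> Arr C" "Dom C p = Cod C m" "Cod C p = Dom C m" "p \<cdot> m = Ident C (Dom C m)"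
  using injective_extend[OF assms, of "Ident C (Dom C m)"] assms(2) by auto

lemma isomorphicI:
  assumes "mono_arr C m" "epi_arr C m" shows "isomorphic C (Dom C m) (Cod C m)"
proof -
  have m: "m \<in> Arr C" using assms by simp
  obtain s where "s \<in> Arr C" "Dom C s = Cod C m" "Cod C s = Dom C m" "m \<cdot> s = Ident C (Cod C m)"
    "s \<cdot> m = Ident C (Dom C m)"
    using mono_epi_inverse[OF assms] .
  then show ?thesis unfolding isomorphic_def using m by (intro conjI bexI[of _ m] bexI[of _ s]) auto
qed

lemma isomorphicE:
  assumes "isomorphic C X Y" obtains m where "mono_arr C m" "epi_arr C m" "Dom C m = X"
      "Cod C m = Y"
proof -
  obtain f g where f: "f \<in> Hom C X Y" "g \<in> Hom C Y X" "g \<cdot> f = Ident C X" "f \<cdot> g = Ident C Y"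
      and O: "X \<in> Obj C" "Y \<in> Obj C"
    using assms unfolding isomorphic_def by blast
  have "mono_arr C f" by (rule mono_comp_right[of g]) (use f O in auto)
  moreover have "epi_arr C f" by (rule epi_comp_left[of _ g]) (use f O in auto)
  ultimately show ?thesis using that f by simp
qed

lemma isomorphic_refl: "X \<in> Obj C \<Longrightarrow> isomorphic C X X"
  using isomorphicI[of "Ident C X"] by simp

lemma isomorphic_sym: "isomorphic C X Y \<Longrightarrow> isomorphic C Y X"
  unfolding isomorphic_def by blast

lemma isomorphic_trans:
  assumes "isomorphic C X Y" "isomorphic C Y Z" shows "isomorphic C X Z"
proof -
  obtain f where f: "mono_arr C f" "epi_arr C f" "Dom C f = X" "Cod C f = Y" using assms(1)
      by (rule isomorphicE)
  obtain g where g: "mono_arr C g" "epi_arr C g" "Dom C g = Y" "Cod C g = Z" using assms(2)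
      by (rule isomorphicE)
  have "mono_arr C (g \<cdot> f)" "epi_arr C (g \<cdot> f)" using f g by (auto intro: mono_comp epi_comp)
  moreover have "Dom C (g \<cdot> f) = X" "Cod C (g \<cdot> f) = Z" using f g by auto
  ultimately show ?thesis using isomorphicI by metis
qed

lemma iso_class_eq_iff:
  assumes "X \<in> Obj C" shows "iso_class C X = iso_class C Y \<longleftrightarrow> isomorphic C X Y"
proof
  assume "iso_class C X = iso_class C Y"
  moreover have "X \<in> iso_class C X" using isomorphic_refl[OF assms]
      by (simp add: iso_class_def iso_rel_def)
  ultimately show "isomorphic C X Y" using isomorphic_sym by (simp add: iso_class_def iso_rel_def)
next
  assume "isomorphic C X Y"
  then have "isomorphic C X Z \<longleftrightarrow> isomorphic C Y Z" for Z
    by (metis isomorphic_sym isomorphic_trans)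
  then show "iso_class C X = iso_class C Y"
    by (simp add: iso_class_def iso_rel_def Image_def)
qed

text \<open>A retraction \<open>p\<close> of \<open>m\<close> exists by injectivity and is monic
  because \<open>m\<close> is essential. From \<open>p \<cdot> m = 1\<close> it follows that
  \<open>m \<cdot> p = 1\<close>.\<close>

lemma essential_injective_epi:
  assumes "essential_mono C m" "injective_obj C (Dom C m)" shows "epi_arr C m"
proof -
  have m: "mono_arr C m" "m \<in> Arr C" using essential_mono_mono[OF assms(1)] by auto
  obtain p where p: "p \<in> Arr C" "Dom C p = Cod C m" "Cod C p = Dom C m" "p \<cdot> m = Ident C (Dom C m)"
    using injective_retraction[OF assms(2) m(1)] .
  have "mono_arr C p" by (rule essential_extend_mono[OF assms(1)]) (use p m in auto)
  then have "m \<cdot> p = Ident C (Cod C m)"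
    by (rule mono_cancel) (use p m in \<open>auto simp: reassoc[OF p(4)]\<close>)
  then show ?thesis using epi_comp_left[of m p] p m by simp
qed

text \<open>The injective subobject splits off: \<open>Cod C m\<close> is the biproduct of
  \<open>Dom C m\<close> and the kernel of a retraction \<open>p\<close>. Indecomposability makes
  the kernel zero.\<close>

lemma injective_indecomposable_epi:
  assumes m: "mono_arr C m" and E: "injective_obj C (Dom C m)" "nonzero_obj C (Dom C m)"
    and F: "indecomposable_obj C (Cod C m)"
  shows "epi_arr C m"
proof -
  have m': "m \<in> Arr C" using m by simp
  obtain p where p: "p \<in> Arr C" "Dom C p = Cod C m" "Cod C p = Dom C m" "p \<cdot> m = Ident C (Dom C m)"
    using injective_retraction[OF E(1) m] .
  obtain k where k: "is_kernel C p k" using obtain_kernel[OF p(1)] .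
  note k' = kernel_arr[OF k]
  have kC: "Cod C k = Cod C m" using k' p by simp
  have mp: "m \<cdot> p \<in> Arr C" "Dom C (m \<cdot> p) = Cod C m" "Cod C (m \<cdot> p) = Cod C m" using m' p by auto
  let ?I = "Ident C (Cod C m)"
  \<comment> \<open>The complementary idempotent \<open>1 - m \<cdot> p\<close>. It factors through
    the kernel of \<open>p\<close>, and the factor \<open>q\<close> is the projection to the second
    summand.\<close>
  let ?d = "sub_arr ?I (m \<cdot> p)"
  have d: "?d \<in> Arr C" "Dom C ?d = Cod C m" "Cod C ?d = Cod C m" using mp m' by auto
  have "p \<cdot> ?d = sub_arr (p \<cdot> ?I) (p \<cdot> (m \<cdot> p))" by (rule comp_sub) (use mp m' p in auto)
  also have "\<dots> = sub_arr p p" using p m' by (simp add: reassoc[OF p(4)])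
  also have "zero_arr \<dots>" using zero_arr_sub_iff[of p p] p by simp
  finally have pd: "zero_arr (p \<cdot> ?d)" .
  obtain q where q: "q \<in> Arr C" "Dom C q = Dom C ?d" "Cod C q = Dom C k" "k \<cdot> q = ?d"
    by (rule kernel_factor[OF k d(1) _ pd]) (use d p in auto)
  have qD: "Dom C q = Cod C m" using q(2) d by simp
  have dm: "?d \<cdot> x = sub_arr x (m \<cdot> (p \<cdot> x))" if "x \<in> Arr C" "Cod C x = Cod C m" for x
  proof -
    have "?d \<cdot> x = sub_arr (?I \<cdot> x) ((m \<cdot> p) \<cdot> x)" by (rule sub_comp) (use mp m' that in auto)
    then show ?thesis using that m' p assoc[of x p m] by simp
  qed
  have "k \<cdot> (q \<cdot> m) = ?d \<cdot> m" by (rule reassoc[OF q(4)]) (use q(1,3) qD m' k' in auto)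
  also have "\<dots> = sub_arr m m" unfolding dm[OF m' refl] using p(4) m' by simp
  also have "zero_arr \<dots>" using zero_arr_sub_iff[of m m] m' by simp
  finally have "zero_arr (q \<cdot> m)" using mono_zero_arr[OF k'(5), of "q \<cdot> m"] q(1,3) qD m' by simp
  then have qm: "q \<cdot> m = ZeroArr C (Dom C m) (Dom C k)" using q(1,3) qD m'
      by (simp add: zero_arr_def)
  have pk: "p \<cdot> k = ZeroArr C (Dom C k) (Dom C m)" using k'(2,3,4) p by (simp add: zero_arr_def)
  have "k \<cdot> (q \<cdot> k) = ?d \<cdot> k" by (rule reassoc[OF q(4)]) (use q(1,3) qD kC k' in auto)
  also have "\<dots> = k" unfolding dm[OF k'(2) kC] pk using k'(2) kC m' by simp
  finally have *: "k \<cdot> (q \<cdot> k) = k \<cdot> Ident C (Dom C k)" using k'(2) by simp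
  have qk: "q \<cdot> k = Ident C (Dom C k)"
    by (rule mono_cancel[OF k'(5) *]) (use q(1,3) qD kC k' in auto)
  have sum: "AddArr C (m \<cdot> p) (k \<cdot> q) = ?I"
    unfolding q(4) using add_comm[of ?d "m \<cdot> p"] sub_add_cancel[of ?I "m \<cdot> p"] d mp m' by simp
  have "is_biproduct C (Dom C m) (Dom C k) (Cod C m) m k p q"
    unfolding is_biproduct_def using m' k' kC p q(1,3) qD qm pk qk sum by simp
  then have "zero_obj C (Dom C k)"
    using F E(2) m' k'(2) unfolding indecomposable_obj_def nonzero_obj_def by (metis Dom_Obj)
  then have "zero_arr q" using zero_obj_Cod[of q] q by simp
  then have "zero_arr (k \<cdot> q)" by (rule zero_arr_comp_left) (use q(1,3) k' in auto)
  then have "?I = m \<cdot> p" unfolding q(4) by (rule iffD1[OF zero_arr_sub_iff, rotated 4])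
      (use mp m' in auto)
  then have "epi_arr C (m \<cdot> p)" using m' by (metis epi_Ident Cod_Obj)
  then show ?thesis by (rule epi_comp_left) (use p m' in auto)
qed

lemma hullE:
  assumes "is_injective_hull C X E"
  obtains e where "essential_mono C e" "mono_arr C e" "e \<in> Arr C" "Dom C e = X" "Cod C e = E"
      "injective_obj C E" "E \<in> Obj C"
  using assms essential_mono_mono unfolding is_injective_hull_def injective_obj_def by auto

lemma hullI: "essential_mono C e \<Longrightarrow> injective_obj C (Cod C e) \<Longrightarrow>
    is_injective_hull C (Dom C e) (Cod C e)"
  using essential_mono_mono unfolding is_injective_hull_def by auto

text \<open>Extend \<open>e'\<close> along \<open>e\<close> to an arrow \<open>g\<close>. It is
  monic because \<open>e\<close> is essential, and essential because \<open>e'\<close> is; since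
  \<open>E\<close> is injective, \<open>g\<close> is also epi.\<close>

lemma hull_unique:
  assumes "is_injective_hull C X E" "is_injective_hull C X E'"
  shows "isomorphic C E E'"
proof -
  obtain e where e: "essential_mono C e" "mono_arr C e" "e \<in> Arr C" "Dom C e = X" "Cod C e = E"
      "injective_obj C E" "E \<in> Obj C"
    using assms(1) by (rule hullE)
  obtain e' where e': "essential_mono C e'" "mono_arr C e'" "e' \<in> Arr C" "Dom C e' = X"
      "Cod C e' = E'" "injective_obj C E'" "E' \<in> Obj C"
    using assms(2) by (rule hullE)
  obtain g where g: "g \<in> Arr C" "Dom C g = Cod C e" "Cod C g = E'" "g \<cdot> e = e'"
    using injective_extend[OF e'(6) e(2), of e'] e' e by auto
  have gm: "mono_arr C g" by (rule essential_extend_mono[OF e(1) g(1,2)]) (use g(4) e' in simp)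
  have "essential_mono C g" by (rule essential_comp_left[of g e]) (use g e e' gm in auto)
  then have "epi_arr C g" by (rule essential_injective_epi) (use g e in auto)
  then show ?thesis using isomorphicI[OF gm] g e by simp
qed

lemma uniform_indecomposable:
  assumes "uniform_obj E" shows "indecomposable_obj C E"
  unfolding indecomposable_obj_def
proof (intro conjI ballI allI impI)
  show "nonzero_obj C E" using assms by (simp add: uniform_obj_def)
  fix Y Z i j p q assume Y: "Y \<in> Obj C" and Z: "Z \<in> Obj C" and bp: "is_biproduct C Y Z E i j p q"
  note B = biproduct_arr[OF bp]
  show "zero_obj C Y \<or> zero_obj C Z"
  proof (rule ccontr)
    assume nz: "\<not> (zero_obj C Y \<or> zero_obj C Z)"
    have i: "mono_arr C i" by (rule mono_comp_right[of p]) (use B Y in auto)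
    have j: "mono_arr C j" by (rule mono_comp_right[of q]) (use B Z in auto)
    have "\<not> zero_arr i" "\<not> zero_arr j" using nz mono_zero_iff[OF i] mono_zero_iff[OF j] B by auto
    then obtain u v where u: "u \<in> Arr C" "v \<in> Arr C" "Dom C v = Dom C u" "Cod C u = Dom C i"
        "Cod C v = Dom C j"
        "i \<cdot> u = j \<cdot> v" "\<not> zero_arr (i \<cdot> u)"
      using uniformE[OF assms B(2) B(5) B(4) B(7)] by blast
    have "p \<cdot> (i \<cdot> u) = Ident C Y \<cdot> u" by (rule reassoc[OF B(14)]) (use B(1-13) u(1-5) in auto)
    moreover have "p \<cdot> (j \<cdot> v) = ZeroArr C Z Y \<cdot> v" by (rule reassoc[OF B(16)])
        (use B(1-13) u(1-5) in auto)
    ultimately have "u = ZeroArr C (Dom C u) Y" unfolding u(6) using u(1-5) B(1-13) Y by simp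
    then have "zero_arr u" using u(1) Y by (metis zero_arrI Dom_Obj)
    then have "zero_arr (i \<cdot> u)" by (rule zero_arr_comp_left) (use u B in auto)
    then show False using u(7) by simp
  qed
qed

section \<open>Atoms\<close>

lemma monoform_Obj: "monoform C H \<Longrightarrow> H \<in> Obj C"
  by (simp add: monoform_def nonzero_obj_def)

lemma monoform_embeds:
  assumes "monoform C H" "nonzero_obj C L" "embeds C L H"
  obtains i where "essential_mono C i" "mono_arr C i" "i \<in> Arr C" "Dom C i = L" "Cod C i = H"
      "monoform C L" "(H, L) \<in> atom_rel C"
proof -
  obtain i where i: "mono_arr C i" "Dom C i = L" "Cod C i = H" using assms(3) by (rule embedsE)
  have nz: "\<not> zero_arr i" using nonzero_mono_iff[OF i(1)] i assms(2) by simp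
  have L: "monoform C L" using monoform_sub[OF assms(1) i(1,3) nz] i(2) by simp
  have "embeds C L L" using embedsI[OF mono_Ident[OF monoform_Obj[OF L]]] monoform_Obj[OF L] by simp
  then have "(H, L) \<in> atom_rel C" using assms L unfolding atom_rel_def by blast
  then show ?thesis
    using that uniform_essential[OF monoform_uniform[OF assms(1)] i(1,3) nz] i L by simp
qed

lemma atom_rel_D:
  assumes "(H, H') \<in> atom_rel C"
  shows "monoform C H" "monoform C H'" "\<exists>L. nonzero_obj C L \<and> embeds C L H \<and> embeds C L H'"
  using assms by (auto simp: atom_rel_def)

text \<open>A nonzero subobject of a monoform object is essential in it. So the hulls of
  \<open>H\<close> and of \<open>H'\<close> are both hulls of the common subobject
  \<open>L\<close>.\<close>

lemma atom_rel_hull: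
  assumes "(H, H') \<in> atom_rel C" "is_injective_hull C H E" "is_injective_hull C H' E'"
  shows "isomorphic C E E'"
proof -
  obtain L where L: "nonzero_obj C L" "embeds C L H" "embeds C L H'"
      using atom_rel_D(3)[OF assms(1)] by blast
  have 1: "is_injective_hull C L F" if G: "monoform C G" "embeds C L G" "is_injective_hull C G F"
      for G F
  proof -
    obtain i where i: "essential_mono C i" "mono_arr C i" "i \<in> Arr C" "Dom C i = L" "Cod C i = G"
        "monoform C L" "(G, L) \<in> atom_rel C"
      using monoform_embeds[OF G(1) L(1) G(2)] .
    obtain e where e: "essential_mono C e" "mono_arr C e" "e \<in> Arr C" "Dom C e = G" "Cod C e = F"
        "injective_obj C F" "F \<in> Obj C"
      using G(3) by (rule hullE)
    have "essential_mono C (e \<cdot> i)" by (rule essential_comp[OF i(1) e(1)]) (use i e in simp)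
    then show ?thesis using hullI[of "e \<cdot> i"] i e by simp
  qed
  show ?thesis
    by (rule hull_unique[of L]) (use 1 atom_rel_D[OF assms(1)] L assms(2,3) in auto)
qed

lemma hull_uniform:
  assumes "monoform C H" "is_injective_hull C H E" shows "uniform_obj E"
proof -
  obtain e where e: "essential_mono C e" "mono_arr C e" "e \<in> Arr C" "Dom C e = H" "Cod C e = E"
      "injective_obj C E" "E \<in> Obj C"
    using assms(2) by (rule hullE)
  then show ?thesis using essential_uniform[OF e(1)] monoform_uniform[OF assms(1)] by simp
qed

text \<open>Inside \<open>E'\<close>, the image of \<open>H\<close> is a nonzero subobject. The
  essential subobject \<open>H'\<close> meets it, and the intersection supplies a common nonzero
  subobject.\<close>

lemma hull_atom_rel:
  assumes H: "monoform C H" "monoform C H'"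
      and E: "is_injective_hull C H E" "is_injective_hull C H' E'"
    and iso: "isomorphic C E E'"
  shows "(H, H') \<in> atom_rel C"
proof -
  obtain e where e: "essential_mono C e" "mono_arr C e" "e \<in> Arr C" "Dom C e = H" "Cod C e = E"
      "injective_obj C E" "E \<in> Obj C"
    using E(1) by (rule hullE)
  obtain e' where e': "essential_mono C e'" "mono_arr C e'" "e' \<in> Arr C" "Dom C e' = H'"
      "Cod C e' = E'" "injective_obj C E'" "E' \<in> Obj C"
    using E(2) by (rule hullE)
  obtain g where g: "mono_arr C g" "epi_arr C g" "Dom C g = E" "Cod C g = E'" using iso
      by (rule isomorphicE)
  have m: "mono_arr C (g \<cdot> e)" "Cod C (g \<cdot> e) = Cod C e'" "Dom C (g \<cdot> e) = H" using g e e'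
      by (auto intro: mono_comp)
  have "nonzero_obj C (Dom C (g \<cdot> e))" using m(3) H(1) by (simp add: monoform_def)
  then obtain k where k: "mono_arr C k" "nonzero_obj C (Dom C k)" "sub_le C k (g \<cdot> e)"
      "sub_le C k e'"
    using e'(1) m(1,2) unfolding essential_mono_def by metis
  have "embeds C (Dom C k) H" using mono_sub_le_embeds[OF k(1,3)] m by simp
  moreover have "embeds C (Dom C k) H'" using mono_sub_le_embeds[OF k(1,4)] e' by simp
  ultimately show ?thesis using H k(2) unfolding atom_rel_def by blast
qed

text \<open>Let \<open>H\<close> be a subobject of a quotient \<open>Q\<close> of \<open>M\<close>,
  and \<open>R\<close> a quotient of \<open>H\<close>. The pushout of \<open>R\<close> and
  \<open>Q\<close> over \<open>H\<close> is a quotient of \<open>Q\<close>, hence of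
  \<open>M\<close>, and contains \<open>R\<close>.\<close>

lemma subquotient_trans:
  assumes "subquotient C X H" "subquotient C H M"
  shows "subquotient C X M"
proof -
  obtain R f where f: "epi_arr C f" "Dom C f = H" "Cod C f = R" "embeds C X R"
    using assms(1) unfolding subquotient_def by auto
  obtain Q e where e: "epi_arr C e" "Dom C e = M" "Cod C e = Q" "embeds C H Q"
    using assms(2) unfolding subquotient_def by auto
  obtain m where m: "mono_arr C m" "Dom C m = H" "Cod C m = Q" using e(4) by (rule embedsE)
  have arr: "f \<in> Arr C" "m \<in> Arr C" "Dom C f = Dom C m" using f m by auto
  obtain u v where u: "u \<in> Arr C" "v \<in> Arr C" "Cod C v = Cod C u" "Dom C u = Cod C f"
      "Dom C v = Cod C m"
    "u \<cdot> f = v \<cdot> m" "mono_arr C m \<Longrightarrow> mono_arr C u" "epi_arr C f \<Longrightarrow> epi_arr C v"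
    using pushout[OF arr] by blast
  have "embeds C X (Cod C u)"
    by (rule embeds_trans[OF f(4)], rule embedsI[OF u(7)[OF m(1)]]) (use u f in auto)
  moreover have "epi_arr C (v \<cdot> e)" "Dom C (v \<cdot> e) = M" "Cod C (v \<cdot> e) = Cod C u"
    using u e m f by (auto intro: epi_comp)
  ultimately show ?thesis unfolding subquotient_def
      by (intro exI[of _ "Cod C u"] conjI bexI[of _ "v \<cdot> e"]) auto
qed

lemma embeds_subquotient:
  assumes "embeds C X M" shows "subquotient C X M"
proof -
  have "M \<in> Obj C" using assms by (metis embedsE mono_arr_arr Cod_Obj)
  then show ?thesis unfolding subquotient_def using assms
    by (intro exI[of _ M] conjI bexI[of _ "Ident C M"]) auto
qed

lemma ASupp_mono: "subquotient C H M \<Longrightarrow> ASupp C H \<subseteq> ASupp C M"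
  unfolding ASupp_def using subquotient_trans by blast

end

section \<open>Atoms as equivalence classes and the map to injective hulls\<close>

context noetherian_generators
begin

text \<open>The image of a nonzero element is a quotient of a noetherian generator, so
  \<open>noetherian_monoform\<close> applies to it.\<close>

lemma ex_noetherian_monoform:
  assumes X: "nonzero_obj C X"
  obtains L where "monoform C L" "noetherian_obj C L" "embeds C L X"
proof -
  have XO: "X \<in> Obj C" and nz: "\<not> zero_arr (Ident C X)" using X
      by (auto simp: nonzero_obj_def zero_obj_iff)
  obtain h where h: "h \<in> elements (Dom C (Ident C X))" "\<not> zero_arr (Ident C X \<cdot> h)"
    using gen_test[OF _ nz] XO by auto
  have h': "h \<in> Arr C" "Dom C h \<in> \<G>" "Cod C h = X" using elements_arr[OF h(1)] XO by auto
  have hz: "\<not> zero_arr h" using h(2) h' by simp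
  obtain m e where m: "mono_arr C m" "epi_arr C e" "Dom C m = Cod C e" "Cod C m = Cod C h"
      "Dom C e = Dom C h" "m \<cdot> e = h"
    using image_factorization[OF h'(1)] .
  have "noetherian_obj C (Dom C e)" using noetherian_gen[OF h'(2)] m(5) by simp
  then have n: "noetherian_obj C (Dom C m)" unfolding m(3) using noetherian_quotient m(2) by blast
  have "\<not> zero_arr m"
    using zero_arr_comp_right[of m e] m(3,6) hz mono_arr_arr[OF m(1)] epi_arr_arr[OF m(2)] by metis
  then have "nonzero_obj C (Dom C m)" using nonzero_mono_iff[OF m(1)] by blast
  then obtain L where L: "monoform C L" "embeds C L (Dom C m)" using noetherian_monoform[OF n]
      by blast
  obtain k where k: "mono_arr C k" "Dom C k = L" "Cod C k = Dom C m" using L(2) by (rule embedsE)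
  have "noetherian_obj C L" using noetherian_sub[of k] k n by simp
  moreover have "embeds C L X" using L(2) embedsI[OF m(1)] m(4) h'(3) by (metis embeds_trans)
  ultimately show ?thesis using that L(1) by blast
qed

lemma monoform_hull:
  assumes "monoform C H" obtains E where "is_injective_hull C H E"
  using ex_injective_hull[OF monoform_Obj[OF assms]] .

text \<open>Transitivity is the point. Having isomorphic hulls is transitive, and it characterises
  atom equivalence by \<open>atom_rel_hull\<close> and \<open>hull_atom_rel\<close>.\<close>

lemma equiv_atom_rel: "equiv {H. monoform C H} (atom_rel C)"
proof (rule equivI)
  show "atom_rel C \<subseteq> {H. monoform C H} \<times> {H. monoform C H}" by (auto simp: atom_rel_def)
  show "refl_on {H. monoform C H} (atom_rel C)"
  proof (rule refl_onI)
    fix H assume "H \<in> {H. monoform C H}"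
    then have H: "monoform C H" by simp
    have "embeds C H H" using embedsI[OF mono_Ident[OF monoform_Obj[OF H]]] monoform_Obj[OF H]
        by simp
    then show "(H, H) \<in> atom_rel C" using H by (auto simp: atom_rel_def monoform_def)
  qed
  show "sym (atom_rel C)" by (rule symI) (auto simp: atom_rel_def)
  show "trans (atom_rel C)"
  proof (rule transI)
    fix H H' H'' assume 1: "(H, H') \<in> atom_rel C" and 2: "(H', H'') \<in> atom_rel C"
    note m = atom_rel_D(1,2)[OF 1] atom_rel_D(2)[OF 2]
    obtain E where E: "is_injective_hull C H E" using monoform_hull[OF m(1)] .
    obtain E' where E': "is_injective_hull C H' E'" using monoform_hull[OF m(2)] .
    obtain E'' where E'': "is_injective_hull C H'' E''" using monoform_hull[OF m(3)] .
    have "isomorphic C E E''"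
      using atom_rel_hull[OF 1 E E'] atom_rel_hull[OF 2 E' E''] by (rule isomorphic_trans)
    then show "(H, H'') \<in> atom_rel C" by (rule hull_atom_rel[OF m(1,3) E E''])
  qed
qed

lemma ASpecE:
  assumes "\<alpha> \<in> ASpec C"
  obtains H where "monoform C H" "\<alpha> = atom C H"
  using assms unfolding ASpec_def atom_def by (auto elim: quotientE)

lemma atom_ASpec: "monoform C H \<Longrightarrow> atom C H \<in> ASpec C"
  unfolding ASpec_def atom_def by (simp add: quotientI)

lemma mem_atom_iff: "H' \<in> atom C H \<longleftrightarrow> (H, H') \<in> atom_rel C"
  by (simp add: atom_def)

lemma ASpec_mem:
  assumes "\<alpha> \<in> ASpec C" "H \<in> \<alpha>" shows "monoform C H" "\<alpha> = atom C H"
proof -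
  obtain H0 where H0: "monoform C H0" "\<alpha> = atom C H0" using assms(1) by (rule ASpecE)
  then have r: "(H0, H) \<in> atom_rel C" using assms(2) by (simp add: mem_atom_iff)
  then show "monoform C H" by (rule atom_rel_D(2))
  show "\<alpha> = atom C H" unfolding H0(2) atom_def using equiv_class_eq[OF equiv_atom_rel r] .
qed

lemma ASpec_ne:
  assumes "\<alpha> \<in> ASpec C" obtains H where "H \<in> \<alpha>"
proof -
  obtain H where "monoform C H" "\<alpha> = atom C H" using assms by (rule ASpecE)
  then show ?thesis using that[of H] equiv_atom_rel
      by (simp add: mem_atom_iff equiv_def refl_on_def)
qed

lemma atom_sub:
  assumes "\<alpha> \<in> ASpec C" "H \<in> \<alpha>" "nonzero_obj C L" "embeds C L H" shows "L \<in> \<alpha>"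
proof -
  note H = ASpec_mem[OF assms(1,2)]
  have "(H, L) \<in> atom_rel C" using monoform_embeds[OF H(1) assms(3,4)] by metis
  then show ?thesis using H(2) by (simp add: mem_atom_iff)
qed

text \<open>Removes the two choices made by \<open>SOME\<close> in \<open>Ebar\<close>: neither
  another representative of the atom nor another hull changes the isomorphism class.\<close>

lemma Ebar_eq:
  assumes "\<alpha> \<in> ASpec C" "H \<in> \<alpha>" "is_injective_hull C H E"
  shows "Ebar C \<alpha> = iso_class C E"
proof -
  define H0 where "H0 = (SOME H. H \<in> \<alpha>)"
  have H0: "H0 \<in> \<alpha>" unfolding H0_def using assms(2) by (rule someI)
  note m = ASpec_mem[OF assms(1) H0]
  obtain F where "is_injective_hull C H0 F" using monoform_hull[OF m(1)] .
  then have hull: "is_injective_hull C H0 (injective_hull C H0)" unfolding injective_hull_def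
      by (rule someI)
  have "(H0, H) \<in> atom_rel C" using assms(2) m(2) by (simp add: mem_atom_iff)
  then have iso: "isomorphic C (injective_hull C H0) E" using hull assms(3) by (rule atom_rel_hull)
  have "injective_hull C H0 \<in> Obj C" using hull by (rule hullE)
  then show ?thesis unfolding Ebar_def H0_def[symmetric] using iso_class_eq_iff iso by blast
qed

lemma Zg_iso_class:
  assumes "indecomposable_obj C I" "injective_obj C I" shows "iso_class C I \<in> Zg C"
  unfolding Zg_def iso_class_def using assms by (simp add: quotientI)

lemma ZgE:
  assumes "c \<in> Zg C"
  obtains I where "indecomposable_obj C I" "injective_obj C I" "c = iso_class C I"
  using assms unfolding Zg_def iso_class_def by (auto elim: quotientE)

lemma Ebar_hull:
  assumes "\<alpha> \<in> ASpec C"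
  obtains H E where "H \<in> \<alpha>" "monoform C H" "is_injective_hull C H E" "Ebar C \<alpha> = iso_class C E"
    "indecomposable_obj C E" "injective_obj C E" "E \<in> Obj C"
proof -
  obtain H where H: "H \<in> \<alpha>" using ASpec_ne[OF assms] .
  note m = ASpec_mem[OF assms H]
  obtain E where E: "is_injective_hull C H E" using monoform_hull[OF m(1)] .
  have "indecomposable_obj C E" by (rule uniform_indecomposable[OF hull_uniform[OF m(1) E]])
  moreover have "injective_obj C E" "E \<in> Obj C" using E by (auto elim: hullE)
  ultimately show ?thesis using that H m(1) E Ebar_eq[OF assms H E] by blast
qed

lemma bij_Ebar: "bij_betw (Ebar C) (ASpec C) (Zg C)"
proof (rule bij_betw_imageI)
  show "inj_on (Ebar C) (ASpec C)"
  proof (rule inj_onI)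
    fix \<alpha> \<beta> assume \<alpha>: "\<alpha> \<in> ASpec C" and \<beta>: "\<beta> \<in> ASpec C" and eq: "Ebar C \<alpha> = Ebar C \<beta>"
    obtain H E where H: "H \<in> \<alpha>" "monoform C H" "is_injective_hull C H E" "Ebar C \<alpha> = iso_class C E"
      "indecomposable_obj C E" "injective_obj C E" "E \<in> Obj C" using Ebar_hull[OF \<alpha>] .
    obtain H' E' where H': "H' \<in> \<beta>" "monoform C H'" "is_injective_hull C H' E'"
        "Ebar C \<beta> = iso_class C E'"
      "indecomposable_obj C E'" "injective_obj C E'" "E' \<in> Obj C" using Ebar_hull[OF \<beta>] .
    have "iso_class C E = iso_class C E'" using H(4) H'(4) eq by (simp only:)
    then have "isomorphic C E E'" unfolding iso_class_eq_iff[OF H(7)] .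
    then have "(H, H') \<in> atom_rel C" by (rule hull_atom_rel[OF H(2) H'(2) H(3) H'(3)])
    then have "atom C H = atom C H'" unfolding atom_def by (rule equiv_class_eq[OF equiv_atom_rel])
    then show "\<alpha> = \<beta>" using ASpec_mem(2)[OF \<alpha> H(1)] ASpec_mem(2)[OF \<beta> H'(1)] by simp
  qed
  show "Ebar C ` ASpec C = Zg C"
  proof
    show "Ebar C ` ASpec C \<subseteq> Zg C"
    proof
      fix c assume "c \<in> Ebar C ` ASpec C"
      then obtain \<alpha> where \<alpha>: "\<alpha> \<in> ASpec C" and c: "c = Ebar C \<alpha>" by blast
      show "c \<in> Zg C" by (rule Ebar_hull[OF \<alpha>]) (use Zg_iso_class c in simp)
    qed
    show "Zg C \<subseteq> Ebar C ` ASpec C"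
    proof
      fix c assume "c \<in> Zg C"
      then obtain I where I: "indecomposable_obj C I" "injective_obj C I" "c = iso_class C I"
          by (rule ZgE)
      have "nonzero_obj C I" using I(1) by (simp add: indecomposable_obj_def)
      then obtain H where H: "monoform C H" "noetherian_obj C H" "embeds C H I"
          by (rule ex_noetherian_monoform)
      obtain i where i: "mono_arr C i" "Dom C i = H" "Cod C i = I" using H(3) by (rule embedsE)
      obtain E where E: "is_injective_hull C H E" using monoform_hull[OF H(1)] .
      obtain e where e: "essential_mono C e" "mono_arr C e" "e \<in> Arr C" "Dom C e = H" "Cod C e = E"
          "injective_obj C E" "E \<in> Obj C"
        using E by (rule hullE)
      \<comment> \<open>Injectivity of \<open>I\<close> extends \<open>i\<close> to the hull of
        \<open>H\<close>. The extension is monic because \<open>e\<close> is essential, so the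
        injective object \<open>E\<close> splits off the indecomposable \<open>I\<close>.\<close>
      obtain g where g: "g \<in> Arr C" "Dom C g = Cod C e" "Cod C g = I" "g \<cdot> e = i"
        using injective_extend[OF I(2) e(2), of i] i e(4) by auto
      have gm: "mono_arr C g" by (rule essential_extend_mono[OF e(1) g(1,2)]) (use g(4) i in simp)
      have gE: "Dom C g = E" using g(2) e(5) by simp
      have "nonzero_obj C E" using hull_uniform[OF H(1) E] by (simp add: uniform_obj_def)
      then have "epi_arr C g" by (intro injective_indecomposable_epi[OF gm])
          (use gE g(3) e(6) I in simp_all)
      then have "isomorphic C E I" using isomorphicI[OF gm] gE g(3) by simp
      then have "iso_class C E = c" using iso_class_eq_iff[OF e(7)] I(3) by blast
      moreover have "H \<in> atom C H" using equiv_atom_rel H(1)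
          by (simp add: mem_atom_iff equiv_def refl_on_def)
      ultimately have "Ebar C (atom C H) = c" using Ebar_eq[OF atom_ASpec[OF H(1)] _ E] by simp
      then show "c \<in> Ebar C ` ASpec C" using atom_ASpec[OF H(1)] by blast
    qed
  qed
qed

lemma Ebar_ASupp:
  assumes M: "M \<in> Obj C"
  shows "Ebar C ` ASupp C M = Zg_open C M"
proof
  show "Ebar C ` ASupp C M \<subseteq> Zg_open C M"
  proof
    fix c assume "c \<in> Ebar C ` ASupp C M"
    then obtain \<alpha> H where \<alpha>: "\<alpha> \<in> ASpec C" "H \<in> \<alpha>" "subquotient C H M" and c: "c = Ebar C \<alpha>"
      by (auto simp: ASupp_def)
    obtain Q e where Q: "epi_arr C e" "Dom C e = M" "Cod C e = Q" "embeds C H Q"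
      using \<alpha>(3) unfolding subquotient_def by auto
    obtain m where m: "mono_arr C m" "Dom C m = H" "Cod C m = Q" using Q(4) by (rule embedsE)
    note H = ASpec_mem(1)[OF \<alpha>(1,2)]
    obtain E where E: "is_injective_hull C H E" using monoform_hull[OF H] .
    obtain j where j: "essential_mono C j" "mono_arr C j" "j \<in> Arr C" "Dom C j = H" "Cod C j = E"
        "injective_obj C E" "E \<in> Obj C"
      using E by (rule hullE)
    \<comment> \<open>The inclusion of \<open>H\<close> in its hull extends from \<open>H\<close> to
      the quotient \<open>Q\<close> of \<open>M\<close>; composing with \<open>e\<close> gives a
      nonzero arrow from \<open>M\<close> to \<open>E\<close>.\<close>
    obtain g where g: "g \<in> Arr C" "Dom C g = Cod C m" "Cod C g = E" "g \<cdot> m = j"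
      using injective_extend[OF j(6) m(1), of j] m j by auto
    have "\<not> zero_arr j" using nonzero_mono_iff[OF j(2)] j(4) H by (simp add: monoform_def)
    then have "\<not> zero_arr g" using zero_arr_comp_right[of g m] g m mono_arr_arr[OF m(1)] by metis
    then have nz: "\<not> zero_arr (g \<cdot> e)" using epi_zero_arr[OF Q(1), of g] g m(3) Q(3) by simp
    have ge: "g \<cdot> e \<in> Hom C M E" using g Q m(3) by simp
    have "g \<cdot> e \<noteq> ZeroArr C M E" using nz zero_arrI[OF M j(7)] by metis
    then have "Hom C M E \<noteq> {ZeroArr C M E}" using ge by blast
    moreover have "c = iso_class C E" unfolding c by (rule Ebar_eq[OF \<alpha>(1,2) E])
    moreover have "E \<in> iso_class C E" using isomorphic_refl[OF j(7)]
        by (simp add: iso_class_def iso_rel_def)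
    moreover have "c \<in> Zg C" unfolding c using bij_Ebar \<alpha>(1) by (rule bij_betwE[rule_format])
    ultimately show "c \<in> Zg_open C M" unfolding Zg_open_def by blast
  qed
  show "Zg_open C M \<subseteq> Ebar C ` ASupp C M"
  proof
    fix c assume "c \<in> Zg_open C M"
    then obtain I where c: "c \<in> Zg C" "I \<in> c" "Hom C M I \<noteq> {ZeroArr C M I}" unfolding Zg_open_def
        by blast
    obtain \<alpha> where \<alpha>: "\<alpha> \<in> ASpec C" "c = Ebar C \<alpha>" using c(1) bij_Ebar by (auto simp: bij_betw_def)
    obtain H E where H: "H \<in> \<alpha>" "monoform C H" "is_injective_hull C H E" "Ebar C \<alpha> = iso_class C E"
      "indecomposable_obj C E" "injective_obj C E" "E \<in> Obj C" using Ebar_hull[OF \<alpha>(1)] .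
    have "isomorphic C I E" using c(2) \<alpha>(2) H(4) isomorphic_sym
        by (simp add: iso_class_def iso_rel_def)
    \<comment> \<open>\<open>I\<close> is an arbitrary member of the class, so the nonzero arrow out
      of \<open>M\<close> is first carried over to the hull \<open>E\<close>.\<close>
    then obtain s where s: "mono_arr C s" "epi_arr C s" "Dom C s = I" "Cod C s = E"
        by (rule isomorphicE)
    have IO: "I \<in> Obj C" using s(1,3) Dom_Obj[of s] by simp
    have "ZeroArr C M I \<in> Hom C M I" using M IO by simp
    then obtain f where f: "f \<in> Hom C M I" "f \<noteq> ZeroArr C M I" using c(3) by blast
    then have f': "f \<in> Arr C" "Dom C f = M" "Cod C f = I" "\<not> zero_arr f"
        by (auto simp: zero_arr_def)
    have sf: "s \<cdot> f \<in> Arr C" "Dom C (s \<cdot> f) = M" "Cod C (s \<cdot> f) = E" using f' s by auto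
    have sfz: "\<not> zero_arr (s \<cdot> f)" using mono_zero_arr[OF s(1), of f] f' s(3) by simp
    obtain m e where m: "mono_arr C m" "epi_arr C e" "Dom C m = Cod C e" "Cod C m = Cod C (s \<cdot> f)"
      "Dom C e = Dom C (s \<cdot> f)" "m \<cdot> e = s \<cdot> f"
      using image_factorization[OF sf(1)] .
    have "\<not> zero_arr m"
      using zero_arr_comp_right[of m e] m(3,6) sfz mono_arr_arr[OF m(1)] epi_arr_arr[OF m(2)]
          by metis
    then have nm: "nonzero_obj C (Dom C m)" using nonzero_mono_iff[OF m(1)] by blast
    obtain j where j: "essential_mono C j" "mono_arr C j" "j \<in> Arr C" "Dom C j = H" "Cod C j = E"
        "injective_obj C E" "E \<in> Obj C"
      using H(3) by (rule hullE)
    have "Cod C m = Cod C j" using m(4) sf(3) j(5) by simp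
    then obtain k where k: "mono_arr C k" "nonzero_obj C (Dom C k)" "sub_le C k m" "sub_le C k j"
      using j(1) m(1) nm unfolding essential_mono_def by metis
    have "embeds C (Dom C k) H" using mono_sub_le_embeds[OF k(1,4) j(3)] j(4) by simp
    then have L: "Dom C k \<in> \<alpha>" by (rule atom_sub[OF \<alpha>(1) H(1) k(2)])
    have "embeds C (Dom C k) (Cod C e)" using mono_sub_le_embeds[OF k(1,3)] m(1,3) by simp
    moreover have "e \<in> Hom C M (Cod C e)" using m(2,5) sf(2) by simp
    ultimately have "subquotient C (Dom C k) M" unfolding subquotient_def using m(2) by blast
    then have "\<alpha> \<in> ASupp C M" unfolding ASupp_def using L \<alpha>(1) by blast
    then show "c \<in> Ebar C ` ASupp C M" unfolding \<alpha>(2) by blast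
  qed
qed

section \<open>Topology\<close>

text \<open>Named apart from \<open>atom_topology\<close>, because \<open>topology\<close> gives
  access to this predicate only after \<open>istopology\<close> has been proved for it.\<close>

definition atom_open :: "'o set set \<Rightarrow> bool" where
  "atom_open \<Phi> \<longleftrightarrow> \<Phi> \<subseteq> ASpec C \<and> (\<forall>\<alpha> \<in> \<Phi>. \<exists>H \<in> \<alpha>. ASupp C H \<subseteq> \<Phi>)"

lemma atom_openD: "atom_open \<Phi> \<Longrightarrow> \<Phi> \<subseteq> ASpec C"
  by (simp add: atom_open_def)

lemma istopology_atom_open: "istopology atom_open"
  unfolding istopology_def
proof (intro conjI allI impI)
  fix S T assume S: "atom_open S" and T: "atom_open T"
  show "atom_open (S \<inter> T)" unfolding atom_open_def
  proof (intro conjI ballI)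
    show "S \<inter> T \<subseteq> ASpec C" using atom_openD[OF S] by blast
    fix \<alpha> assume \<alpha>: "\<alpha> \<in> S \<inter> T"
    then have \<alpha>A: "\<alpha> \<in> ASpec C" using atom_openD[OF S] by blast
    obtain H where H: "H \<in> \<alpha>" "ASupp C H \<subseteq> S" using S \<alpha> unfolding atom_open_def by blast
    obtain H' where H': "H' \<in> \<alpha>" "ASupp C H' \<subseteq> T" using T \<alpha> unfolding atom_open_def by blast
    \<comment> \<open>\<open>H\<close> and \<open>H'\<close> represent the same atom, so they share
      a nonzero subobject \<open>L\<close>. It represents that atom too, and its support is
      contained in both of theirs.\<close>
    have "(H, H') \<in> atom_rel C" using H'(1) ASpec_mem(2)[OF \<alpha>A H(1)] by (simp add: mem_atom_iff)
    then obtain L where L: "nonzero_obj C L" "embeds C L H" "embeds C L H'" using atom_rel_D(3)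
        by blast
    have "L \<in> \<alpha>" by (rule atom_sub[OF \<alpha>A H(1) L(1,2)])
    moreover have "ASupp C L \<subseteq> S \<inter> T"
      using ASupp_mono[OF embeds_subquotient[OF L(2)]] ASupp_mono[OF embeds_subquotient[OF L(3)]]
          H(2) H'(2) by blast
    ultimately show "\<exists>H\<in>\<alpha>. ASupp C H \<subseteq> S \<inter> T" by blast
  qed
next
  fix \<K> assume K: "\<forall>S\<in>\<K>. atom_open S"
  show "atom_open (\<Union>\<K>)" unfolding atom_open_def
  proof (intro conjI ballI)
    show "\<Union>\<K> \<subseteq> ASpec C" using K atom_openD by blast
    fix \<alpha> assume "\<alpha> \<in> \<Union>\<K>"
    then obtain S where S: "S \<in> \<K>" "\<alpha> \<in> S" by blast
    then obtain H where "H \<in> \<alpha>" "ASupp C H \<subseteq> S" using K unfolding atom_open_def by blast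
    then show "\<exists>H\<in>\<alpha>. ASupp C H \<subseteq> \<Union>\<K>" using S(1) by blast
  qed
qed

lemma openin_atom_topology: "openin (atom_topology C) = atom_open"
proof -
  have "atom_topology C = topology atom_open" unfolding atom_topology_def atom_open_def ..
  then show ?thesis using istopology_atom_open by (simp add: topology_inverse')
qed

lemma atom_open_ASupp: "atom_open (ASupp C M)"
  unfolding atom_open_def
proof (intro conjI ballI)
  show "ASupp C M \<subseteq> ASpec C" by (auto simp: ASupp_def)
  fix \<alpha> assume "\<alpha> \<in> ASupp C M"
  then obtain H where "H \<in> \<alpha>" "subquotient C H M" by (auto simp: ASupp_def)
  then show "\<exists>H\<in>\<alpha>. ASupp C H \<subseteq> ASupp C M" using ASupp_mono by blast
qed

lemma atom_open_ASpec: "atom_open (ASpec C)"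
  unfolding atom_open_def using ASpec_ne by (auto simp: ASupp_def)

lemma noetherian_Obj: "noetherian_obj C M \<Longrightarrow> M \<in> Obj C"
  by (simp add: noetherian_obj_def)

definition Zg_basic :: "'o set set \<Rightarrow> bool" where
  "Zg_basic W \<longleftrightarrow> (\<exists>M. noetherian_obj C M \<and> W = Zg_open C M)"

text \<open>By \<open>Ebar_ASupp\<close> the basic sets are the images of supports of noetherian
  objects. Every open set of atoms is a union of such supports: a witness \<open>H\<close> at an
  atom can be replaced by a noetherian monoform subobject, which represents the same atom and has no
  larger support.\<close>

lemma Zg_union_iff:
  "(arbitrary union_of Zg_basic) W \<longleftrightarrow> (\<exists>\<Phi>. atom_open \<Phi> \<and> W = Ebar C ` \<Phi>)"
proof
  assume "(arbitrary union_of Zg_basic) W"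
  then obtain \<W> where \<W>: "\<W> \<subseteq> Collect Zg_basic" "\<Union>\<W> = W" by (auto simp: union_of_def)
  define \<F> where "\<F> = {ASupp C M | M. noetherian_obj C M \<and> Zg_open C M \<in> \<W>}"
  have "atom_open (\<Union>\<F>)"
    by (rule istopology_atom_open[unfolded istopology_def, THEN conjunct2, rule_format])
      (auto simp: \<F>_def atom_open_ASupp)
  moreover have "Ebar C ` \<Union>\<F> = W"
  proof
    show "Ebar C ` \<Union>\<F> \<subseteq> W" unfolding \<F>_def \<W>(2)[symmetric] using Ebar_ASupp noetherian_Obj by blast
    show "W \<subseteq> Ebar C ` \<Union>\<F>"
    proof
      fix c assume "c \<in> W"
      then obtain V where V: "V \<in> \<W>" "c \<in> V" using \<W>(2) by blast
      then have "Zg_basic V" using \<W>(1) by blast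
      then obtain M where M: "noetherian_obj C M" "V = Zg_open C M" unfolding Zg_basic_def by blast
      then have "c \<in> Ebar C ` ASupp C M" using V(2) Ebar_ASupp[OF noetherian_Obj[OF M(1)]] by simp
      then show "c \<in> Ebar C ` \<Union>\<F>" unfolding \<F>_def using M V(1) by blast
    qed
  qed
  ultimately show "\<exists>\<Phi>. atom_open \<Phi> \<and> W = Ebar C ` \<Phi>" by blast
next
  assume "\<exists>\<Phi>. atom_open \<Phi> \<and> W = Ebar C ` \<Phi>"
  then obtain \<Phi> where \<Phi>: "atom_open \<Phi>" "W = Ebar C ` \<Phi>" by blast
  define \<W> where "\<W> = {Zg_open C M | M. noetherian_obj C M \<and> ASupp C M \<subseteq> \<Phi>}"
  have "\<W> \<subseteq> Collect Zg_basic" by (auto simp: \<W>_def Zg_basic_def)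
  moreover have "\<Union>\<W> = W"
  proof
    show "\<Union>\<W> \<subseteq> W" unfolding \<W>_def \<Phi>(2) using Ebar_ASupp noetherian_Obj by blast
    show "W \<subseteq> \<Union>\<W>"
    proof
      fix c assume "c \<in> W"
      then obtain \<alpha> where \<alpha>: "\<alpha> \<in> \<Phi>" "c = Ebar C \<alpha>" unfolding \<Phi>(2) by blast
      have \<alpha>A: "\<alpha> \<in> ASpec C" using \<alpha>(1) atom_openD[OF \<Phi>(1)] by blast
      obtain H where H: "H \<in> \<alpha>" "ASupp C H \<subseteq> \<Phi>" using \<Phi>(1) \<alpha>(1) unfolding atom_open_def by blast
      have "nonzero_obj C H" using ASpec_mem(1)[OF \<alpha>A H(1)] by (simp add: monoform_def)
      then obtain L where L: "monoform C L" "noetherian_obj C L" "embeds C L H"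
          by (rule ex_noetherian_monoform)
      have nL: "nonzero_obj C L" using L(1) by (simp add: monoform_def)
      have L\<alpha>: "L \<in> \<alpha>" by (rule atom_sub[OF \<alpha>A H(1) nL L(3)])
      have LO: "L \<in> Obj C" using nL by (simp add: nonzero_obj_def)
      have "embeds C L L" using embedsI[OF mono_Ident[OF LO]] LO by simp
      then have "\<alpha> \<in> ASupp C L" unfolding ASupp_def using \<alpha>A L\<alpha> embeds_subquotient by blast
      then have "c \<in> Zg_open C L" unfolding \<alpha>(2) Ebar_ASupp[OF LO, symmetric] by blast
      moreover have "ASupp C L \<subseteq> \<Phi>" using ASupp_mono[OF embeds_subquotient[OF L(3)]] H(2) by blast
      ultimately show "c \<in> \<Union>\<W>" unfolding \<W>_def using L(2) by blast
    qed
  qed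
  ultimately show "(arbitrary union_of Zg_basic) W" unfolding union_of_def arbitrary_def by blast
qed

text \<open>Closure under intersections is inherited from the atom spectrum, since the injective map
  \<open>Ebar\<close> preserves intersections.\<close>

lemma istopology_Zg: "istopology (arbitrary union_of Zg_basic)"
  unfolding istopology_def
proof (intro conjI allI impI)
  fix S T assume "(arbitrary union_of Zg_basic) S" "(arbitrary union_of Zg_basic) T"
  then obtain \<Phi> \<Psi> where *: "atom_open \<Phi>" "S = Ebar C ` \<Phi>" "atom_open \<Psi>" "T = Ebar C ` \<Psi>"
    unfolding Zg_union_iff by blast
  have "Ebar C ` (\<Phi> \<inter> \<Psi>) = Ebar C ` \<Phi> \<inter> Ebar C ` \<Psi>"
    by (rule inj_on_image_Int[OF bij_betw_imp_inj_on[OF bij_Ebar]]) (use * atom_openD in blast)+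
  moreover have "atom_open (\<Phi> \<inter> \<Psi>)"
    by (rule istopology_atom_open[unfolded istopology_def, THEN conjunct1, rule_format]) (rule *)+
  ultimately show "(arbitrary union_of Zg_basic) (S \<inter> T)" unfolding Zg_union_iff *(2,4) by blast
next
  fix \<K> assume "\<forall>S\<in>\<K>. (arbitrary union_of Zg_basic) S"
  then show "(arbitrary union_of Zg_basic) (\<Union>\<K>)" by (simp add: arbitrary_union_of_Union)
qed

lemma openin_Zg_topology: "openin (Zg_topology C) W \<longleftrightarrow> (\<exists>\<Phi>. atom_open \<Phi> \<and> W = Ebar C ` \<Phi>)"
proof -
  have "Zg_topology C = topology (arbitrary union_of Zg_basic)"
      unfolding Zg_topology_def Zg_basic_def ..
  then show ?thesis using istopology_Zg by (simp add: topology_inverse' Zg_union_iff)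
qed

lemma topspace_atom: "topspace (atom_topology C) = ASpec C"
  unfolding topspace_def openin_atom_topology using atom_open_ASpec atom_openD by blast

lemma topspace_Zg: "topspace (Zg_topology C) = Zg C"
proof -
  have "Ebar C ` ASpec C = Zg C" using bij_Ebar by (simp add: bij_betw_def)
  then show ?thesis unfolding topspace_def openin_Zg_topology using atom_open_ASpec atom_openD
      by blast
qed

lemma homeomorphic_ASpec_Zg: "atom_topology C homeomorphic_space Zg_topology C"
proof (rule homeomorphic_map_imp_homeomorphic_space)
  have inj: "inj_on (Ebar C) (ASpec C)" and im: "Ebar C ` ASpec C = Zg C"
    using bij_Ebar by (simp_all add: bij_betw_def)
  show "homeomorphic_map (atom_topology C) (Zg_topology C) (Ebar C)"
  proof (rule bijective_open_imp_homeomorphic_map)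
    show "continuous_map (atom_topology C) (Zg_topology C) (Ebar C)"
      unfolding continuous_map_def topspace_atom topspace_Zg
    proof (intro conjI allI impI)
      show "Ebar C \<in> ASpec C \<rightarrow> Zg C" using im by blast
      fix V assume "openin (Zg_topology C) V"
      then obtain \<Phi> where \<Phi>: "atom_open \<Phi>" "V = Ebar C ` \<Phi>" unfolding openin_Zg_topology by blast
      have "{x \<in> ASpec C. Ebar C x \<in> V} = \<Phi>"
        unfolding \<Phi>(2) using inj atom_openD[OF \<Phi>(1)] by (auto simp: inj_on_def)
      then show "openin (atom_topology C) {x \<in> ASpec C. Ebar C x \<in> V}" using \<Phi>(1)
          by (simp add: openin_atom_topology)
    qed
    show "open_map (atom_topology C) (Zg_topology C) (Ebar C)"
      unfolding open_map_def openin_atom_topology openin_Zg_topology by blast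
    show "Ebar C ` topspace (atom_topology C) = topspace (Zg_topology C)"
        unfolding topspace_atom topspace_Zg by (rule im)
    show "inj_on (Ebar C) (topspace (atom_topology C))" unfolding topspace_atom by (rule inj)
  qed
qed

end

theorem theorem5p9:
  fixes C :: "('o, 'm) category" and U :: "'u set"
  assumes "locally_noetherian_grothendieck_category C U"
  shows "(\<forall>H. monoform C H \<longrightarrow>
            (\<exists>E. is_injective_hull C H E) \<and>
            (\<forall>E. is_injective_hull C H E \<longrightarrow> Ebar C (atom C H) = iso_class C E)) \<and>
         bij_betw (Ebar C) (ASpec C) (Zg C) \<and>
         (\<forall>M. noetherian_obj C M \<longrightarrow> Ebar C ` ASupp C M = Zg_open C M) \<and>
         atom_topology C homeomorphic_space Zg_topology C"
proof -
  interpret locally_noetherian_grothendieck_category C U by (rule assms)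
  obtain \<G> where \<G>: "\<G> \<prec> U" "generating_set C \<G>" "\<forall>G\<in>\<G>. noetherian_obj C G"
    using ex_noetherian_generators by blast
  interpret noetherian_generators C U \<G>
    by unfold_locales (use \<G> in auto)
  show ?thesis
  proof (intro conjI allI impI)
    fix H assume H: "monoform C H"
    show "\<exists>E. is_injective_hull C H E" using monoform_hull[OF H] by blast
    fix E assume E: "is_injective_hull C H E"
    have "H \<in> atom C H" using equiv_atom_rel H by (simp add: mem_atom_iff equiv_def refl_on_def)
    then show "Ebar C (atom C H) = iso_class C E" by (rule Ebar_eq[OF atom_ASpec[OF H] _ E])
  next
    fix M assume "noetherian_obj C M"
    then show "Ebar C ` ASupp C M = Zg_open C M" by (intro Ebar_ASupp noetherian_Obj)
  qed (rule bij_Ebar homeomorphic_ASpec_Zg)+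
qed

end
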